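(* There is a universal constant $C>0$ such that the following holds. Let $\pi\colon\mathrm{GL}(n)\to\mathrm{GL}(V)$ be a rational representation on a finite-dimensional complex vector space $V$ with a $U(n)$-invariant Hermitian inner product, let $v\in V$ be a unit vector with $\operatorname{cap}(v)>0$, and let $\varepsilon>0$. Then the geodesic gradient descent algorithm described in the context, run with $$T=\max\Bigl\{1,\Bigl\lceil C\,\frac{N(\pi)^2}{\varepsilon^2}\,\bigl|\log\operatorname{cap}(v)\bigr|\Bigr\rceil\Bigr\}$$ iterations, outputs a group element $g\in\mathrm{GL}(n)$ satisfying $\|\mu(\pi(g)v)\|_F\le\varepsilon$.
   Context: Rational representation: a group homomorphism whose matrix entries are polynomials in the $g_{i,j}$ and $\det(g)^{-1}$; the inner product is such that $\pi(U(n))$ acts by unitary maps, and $\|\cdot\|$ is its norm. $\|\cdot\|_F$ is the Frobenius norm. Capacity: $\operatorname{cap}(v)=\inf_{g\in \mathrm{GL}(n)}\|\pi(g)v\|$. Moment map: $\mu\colon V\setminus\{0\}\to \mathrm{Herm}(n)$ is defined by $\operatorname{tr}[\mu(v)H]=\partial_{t=0}\log\|\pi(e^{tH})v\|$ for all Hermitian $n\times n$ matrices $H$. Weight norm: $N(\pi)$ is the maximum of $\|\lambda\|_2$ over the highest weights $\lambda\in\mathbb Z^n$ of the irreducible subrepresentations of $\pi$. Algorithm (with $T\ge1$ iterations): set $g_0=I$ and $\eta=1/(2N(\pi)^2)$ (if $N(\pi)=0$ the moment map vanishes identically and $\eta$ is irrelevant). For $t=0,\dots,T-1$ set $g_{t+1}=e^{-\eta\,\mu(\pi(g_t)v)}g_t$.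 Return an element $g\in\{g_0,\dots,g_{T-1}\}$ minimizing $\|\mu(\pi(g)v)\|_F$. *)

theory Defs
  imports
    "Jordan_Normal_Form.Schur_Decomposition"
    "Jordan_Normal_Form.VS_Connect"
begin

text \<open>
  The dimensions \<open>n\<close> and \<open>d = dim V\<close> are natural numbers (not types), so that a constant can be chosen
  uniformly in them.  The representation space is \<open>V = carrier_vec d\<close>, i.e. coordinates with respect to
  some basis, and its Hermitian inner product is an arbitrary one.
\<close>

definition GL :: "nat \<Rightarrow> complex mat monoid" where
  "GL n = units_of (ring_mat TYPE(complex) n ())"

lemma carrier_GL: "carrier (GL n) = {g \<in> carrier_mat n n. invertible_mat g}"
proof -
  have "carrier (GL n) =
      {g \<in> carrier_mat n n. \<exists>h\<in>carrier_mat n n. h * g = 1\<^sub>m n \<and> g * h = 1\<^sub>m n}"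
    unfolding GL_def units_of_def Units_def by (auto simp: ring_mat_simps)
  also have "\<dots> = {g \<in> carrier_mat n n. invertible_mat g}"
  proof (intro Collect_cong conj_cong refl)
    fix g :: "complex mat" assume g: "g \<in> carrier_mat n n"
    show "(\<exists>h\<in>carrier_mat n n. h * g = 1\<^sub>m n \<and> g * h = 1\<^sub>m n) \<longleftrightarrow> invertible_mat g"
    proof
      assume "\<exists>h\<in>carrier_mat n n. h * g = 1\<^sub>m n \<and> g * h = 1\<^sub>m n"
      then show "invertible_mat g"
        using g unfolding invertible_mat_def inverts_mat_def by auto
    next
      assume "invertible_mat g"
      then obtain h where h: "g * h = 1\<^sub>m n" "h * g = 1\<^sub>m (dim_row h)"
        using g unfolding invertible_mat_def inverts_mat_def by auto
      have "dim_col h = n" using arg_cong[OF h(1), of dim_col] by simp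
      moreover have "dim_row h = n" using arg_cong[OF h(2), of dim_col] g by simp
      ultimately show "\<exists>h\<in>carrier_mat n n. h * g = 1\<^sub>m n \<and> g * h = 1\<^sub>m n"
        using h by auto
    qed
  qed
  finally show ?thesis .
qed

definition hermitian_mats :: "nat \<Rightarrow> complex mat set" where
  "hermitian_mats n = {H \<in> carrier_mat n n. mat_adjoint H = H}"

definition unitary_mats :: "nat \<Rightarrow> complex mat set" where
  "unitary_mats n = {u \<in> carrier_mat n n. mat_adjoint u * u = 1\<^sub>m n}"

definition mat_trace :: "complex mat \<Rightarrow> complex" where
  "mat_trace A = (\<Sum>i<dim_row A. A $$ (i, i))"

definition frobenius_norm :: "complex mat \<Rightarrow> real" where
  "frobenius_norm A = sqrt (\<Sum>i<dim_row A. \<Sum>j<dim_col A. (cmod (A $$ (i, j)))\<^sup>2)"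

text \<open>The exponential power series, summed entrywise.\<close>
definition mat_exp :: "complex mat \<Rightarrow> complex mat" where
  "mat_exp A = Matrix.mat (dim_row A) (dim_row A) (\<lambda>(i, j). \<Sum>k. (A ^\<^sub>m k) $$ (i, j) / fact k)"

definition hermitian_inner_product ::
    "nat \<Rightarrow> (complex Matrix.vec \<Rightarrow> complex Matrix.vec \<Rightarrow> complex) \<Rightarrow> bool" where
  "hermitian_inner_product d ip \<longleftrightarrow>
     (\<forall>x\<in>carrier_vec d. \<forall>y\<in>carrier_vec d. \<forall>z\<in>carrier_vec d. ip (x + y) z = ip x z + ip y z) \<and>
     (\<forall>c. \<forall>x\<in>carrier_vec d. \<forall>y\<in>carrier_vec d. ip (c \<cdot>\<^sub>v x) y = c * ip x y) \<and>
     (\<forall>x\<in>carrier_vec d. \<forall>y\<in>carrier_vec d. ip y x = cnj (ip x y)) \<and>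
     (\<forall>x\<in>carrier_vec d. x \<noteq> 0\<^sub>v d \<longrightarrow> Re (ip x x) > 0)"

definition ip_norm ::
    "(complex Matrix.vec \<Rightarrow> complex Matrix.vec \<Rightarrow> complex) \<Rightarrow> complex Matrix.vec \<Rightarrow> real" where
  "ip_norm ip x = sqrt (Re (ip x x))"

text \<open>Polynomials in the entries \<open>g\<^sub>i\<^sub>j\<close> and in \<open>det(g)\<inverse>\<close>, as functions of \<open>g\<close>.\<close>
inductive_set regular_functions :: "nat \<Rightarrow> (complex mat \<Rightarrow> complex) set" for n where
  const: "(\<lambda>g. c) \<in> regular_functions n"
| entry: "i < n \<Longrightarrow> j < n \<Longrightarrow> (\<lambda>g. g $$ (i, j)) \<in> regular_functions n"
| inverse_det: "(\<lambda>g. inverse (Determinant.det g)) \<in> regular_functions n"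
| add: "p \<in> regular_functions n \<Longrightarrow> q \<in> regular_functions n \<Longrightarrow> (\<lambda>g. p g + q g) \<in> regular_functions n"
| mult: "p \<in> regular_functions n \<Longrightarrow> q \<in> regular_functions n \<Longrightarrow> (\<lambda>g. p g * q g) \<in> regular_functions n"

definition rational_representation :: "nat \<Rightarrow> nat \<Rightarrow> (complex mat \<Rightarrow> complex mat) \<Rightarrow> bool" where
  "rational_representation n d \<pi> \<longleftrightarrow>
     \<pi> \<in> hom (GL n) (GL d) \<and>
     (\<forall>i<d. \<forall>j<d. \<exists>p\<in>regular_functions n. \<forall>g\<in>carrier (GL n). \<pi> g $$ (i, j) = p g)"

definition unitary_invariant ::
    "nat \<Rightarrow> nat \<Rightarrow> (complex mat \<Rightarrow> complex mat) \<Rightarrow>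
     (complex Matrix.vec \<Rightarrow> complex Matrix.vec \<Rightarrow> complex) \<Rightarrow> bool" where
  "unitary_invariant n d \<pi> ip \<longleftrightarrow>
     (\<forall>u\<in>unitary_mats n. \<forall>x\<in>carrier_vec d. \<forall>y\<in>carrier_vec d.
        ip (\<pi> u *\<^sub>v x) (\<pi> u *\<^sub>v y) = ip x y)"

definition subrepresentation ::
    "nat \<Rightarrow> nat \<Rightarrow> (complex mat \<Rightarrow> complex mat) \<Rightarrow> complex Matrix.vec set \<Rightarrow> bool" where
  "subrepresentation n d \<pi> W \<longleftrightarrow>
     VectorSpace.subspace class_ring W (module_vec TYPE(complex) d) \<and>
     (\<forall>g\<in>carrier (GL n). \<forall>w\<in>W. \<pi> g *\<^sub>v w \<in> W)"

definition irreducible_subrepresentation ::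
    "nat \<Rightarrow> nat \<Rightarrow> (complex mat \<Rightarrow> complex mat) \<Rightarrow> complex Matrix.vec set \<Rightarrow> bool" where
  "irreducible_subrepresentation n d \<pi> W \<longleftrightarrow>
     subrepresentation n d \<pi> W \<and> W \<noteq> {0\<^sub>v d} \<and>
     (\<forall>U. subrepresentation n d \<pi> U \<and> U \<subseteq> W \<longrightarrow> U = {0\<^sub>v d} \<or> U = W)"

text \<open>
  A highest weight vector is an eigenvector of the Borel subgroup of upper triangular matrices: it is a
  weight vector for the diagonal torus that is fixed by the upper unitriangular matrices.
\<close>
definition highest_weight ::
    "nat \<Rightarrow> nat \<Rightarrow> (complex mat \<Rightarrow> complex mat) \<Rightarrow> complex Matrix.vec set \<Rightarrow> int Matrix.vec \<Rightarrow> bool" where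
  "highest_weight n d \<pi> W wt \<longleftrightarrow>
     wt \<in> carrier_vec n \<and>
     (\<exists>w\<in>W. w \<noteq> 0\<^sub>v d \<and>
        (\<forall>b\<in>carrier (GL n). upper_triangular b \<longrightarrow>
           \<pi> b *\<^sub>v w = (\<Prod>i<n. b $$ (i, i) powi (vec_index wt i)) \<cdot>\<^sub>v w))"

definition weight_norm :: "nat \<Rightarrow> nat \<Rightarrow> (complex mat \<Rightarrow> complex mat) \<Rightarrow> real" where
  "weight_norm n d \<pi> =
     Max {sqrt (\<Sum>i<n. (real_of_int (vec_index wt i))\<^sup>2) | wt.
            \<exists>W. irreducible_subrepresentation n d \<pi> W \<and> highest_weight n d \<pi> W wt}"

definition capacity ::
    "nat \<Rightarrow> (complex mat \<Rightarrow> complex mat) \<Rightarrow>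
     (complex Matrix.vec \<Rightarrow> complex Matrix.vec \<Rightarrow> complex) \<Rightarrow> complex Matrix.vec \<Rightarrow> real" where
  "capacity n \<pi> ip v = (INF g\<in>carrier (GL n). ip_norm ip (\<pi> g *\<^sub>v v))"

text \<open>The trace of a product of two Hermitian matrices is real, so taking its real part loses nothing.\<close>
definition moment_map ::
    "nat \<Rightarrow> (complex mat \<Rightarrow> complex mat) \<Rightarrow>
     (complex Matrix.vec \<Rightarrow> complex Matrix.vec \<Rightarrow> complex) \<Rightarrow> complex Matrix.vec \<Rightarrow> complex mat" where
  "moment_map n \<pi> ip v =
     (THE M. M \<in> hermitian_mats n \<and>
        (\<forall>H\<in>hermitian_mats n.
           ((\<lambda>t::real. ln (ip_norm ip (\<pi> (mat_exp (complex_of_real t \<cdot>\<^sub>m H)) *\<^sub>v v)))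
              has_real_derivative Re (mat_trace (M * H))) (at 0)))"

fun descent_iterate ::
    "nat \<Rightarrow> (complex mat \<Rightarrow> complex mat) \<Rightarrow>
     (complex Matrix.vec \<Rightarrow> complex Matrix.vec \<Rightarrow> complex) \<Rightarrow> complex Matrix.vec \<Rightarrow>
     real \<Rightarrow> nat \<Rightarrow> complex mat" where
  "descent_iterate n \<pi> ip v \<eta> 0 = 1\<^sub>m n"
| "descent_iterate n \<pi> ip v \<eta> (Suc t) =
     (let g = descent_iterate n \<pi> ip v \<eta> t
      in mat_exp (complex_of_real (- \<eta>) \<cdot>\<^sub>m moment_map n \<pi> ip (\<pi> g *\<^sub>v v)) * g)"

text \<open>
  All admissible outputs of the algorithm with \<open>T\<close> iterations: ties between minimizers may be broken
  arbitrarily.  If the weight norm is 0, the step size evaluates to 0, which is harmless because the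
  moment map vanishes identically in that case.
\<close>
definition descent_outputs ::
    "nat \<Rightarrow> nat \<Rightarrow> (complex mat \<Rightarrow> complex mat) \<Rightarrow>
     (complex Matrix.vec \<Rightarrow> complex Matrix.vec \<Rightarrow> complex) \<Rightarrow> complex Matrix.vec \<Rightarrow>
     nat \<Rightarrow> complex mat set" where
  "descent_outputs n d \<pi> ip v T =
     (let \<eta> = 1 / (2 * (weight_norm n d \<pi>)\<^sup>2)
      in {g. is_arg_min (\<lambda>g. frobenius_norm (moment_map n \<pi> ip (\<pi> g *\<^sub>v v)))
               (\<lambda>g. g \<in> descent_iterate n \<pi> ip v \<eta> ` {..<T}) g})"

end

theory Submission
  imports Defs "HOL-Analysis.L2_Norm"
begin

text \<open>
  Diagonalise a Hermitian matrix \<open>H\<close> by a unitary matrix, with eigenvalues \<open>h\<close>.  The weight spaces of the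
  diagonal torus are pairwise orthogonal, so the squared norm of \<open>\<pi> (exp (s H)) x\<close> is a sum over the weights
  \<open>l\<close> of terms \<open>q l * exp (2 s a l)\<close> with \<open>q l \<ge> 0\<close>, where \<open>a l\<close> is the pairing of \<open>l\<close> with \<open>h\<close>
  (\<open>exp_norm_expansion\<close>).  If \<open>N\<close> bounds the norms of all weights, then \<open>\<bar>a l\<bar>\<close> is at most \<open>N\<close> times the
  Frobenius norm of \<open>H\<close>, so along such a curve the logarithm of the norm has a first derivative bounded by
  this number and a second derivative bounded by twice its square.  A gradient step of length
  \<open>1 / (2 N\<^sup>2)\<close> therefore lowers the logarithm of the norm by a fixed multiple of
  \<open>\<parallel>\<mu>\<parallel>\<^sup>2 / N\<^sup>2\<close> (\<open>descent_step\<close>).  It starts at \<open>0\<close> and never drops below the logarithm of the capacity;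
  summing the decrements bounds the number of steps with a large moment map
  (\<open>descent_outputs_small\<close>).

  The weight norm is a maximum over highest weights only, so that it has to be shown to bound
  all weights (\<open>weight_norm_bounds_weights\<close>).  Choose a weight \<open>l\<close> of maximal norm; transposition matrices permute the
  weights, so \<open>l\<close> may be taken dominant.  Being the unique weight farthest in its own direction, \<open>l\<close> is
  separated from all other weights by a strictly dominant cocharacter.  Conjugation by this cocharacter
  contracts an upper triangular matrix to its diagonal, and comparing growth rates shows that every vector of
  weight \<open>l\<close> is an eigenvector of all upper triangular matrices (\<open>top_weight_vector_borel\<close>).  A subrepresentation that is minimal among those containing a nonzero vector of
  weight \<open>l\<close> is irreducible (\<open>irreducible_meeting_weight_space\<close>), because orthogonal complements of
  subrepresentations are subrepresentations; this follows from the Cartan decomposition \<open>GL_cartan\<close>,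
  since unitary matrices act by unitary maps and positive diagonal matrices by self-adjoint ones.

  Finally the moment map exists: matrix coefficients are regular functions of the group
  element, so the derivative of the logarithm of the norm at the identity is a real linear function of
  the velocity (\<open>is_moment_exists\<close>).
\<close>

section \<open>Matrices and the general linear group\<close>

lemma mat_adjoint_carrier [simp]: "A \<in> carrier_mat m k \<Longrightarrow> mat_adjoint A \<in> carrier_mat k m"
  unfolding mat_adjoint_def mat_of_rows_def by auto

lemma mat_adjoint_index [simp]:
  fixes A :: "complex mat"
  assumes "i < dim_col A" "j < dim_row A"
  shows "mat_adjoint A $$ (i, j) = cnj (A $$ (j, i))"
  using assms unfolding mat_adjoint_def mat_of_rows_def by (auto simp: conjugate_complex_def)

lemma mat_adjoint_dim [simp]:
  "dim_row (mat_adjoint A) = dim_col A" "dim_col (mat_adjoint A) = dim_row A"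
  unfolding mat_adjoint_def mat_of_rows_def by auto

lemma index_mult_mat_sum:
  "A \<in> carrier_mat l m \<Longrightarrow> B \<in> carrier_mat m k \<Longrightarrow> i < l \<Longrightarrow> j < k \<Longrightarrow>
    (A * B) $$ (i, j) = (\<Sum>a<m. A $$ (i, a) * B $$ (a, j))"
  by (auto simp: scalar_prod_def atLeast0LessThan)

lemma index_mult_mat_vec_sum:
  "A \<in> carrier_mat l m \<Longrightarrow> v \<in> carrier_vec m \<Longrightarrow> i < l \<Longrightarrow>
    (A *\<^sub>v v) $ i = (\<Sum>a<m. A $$ (i, a) * v $ a)"
  by (auto simp: scalar_prod_def atLeast0LessThan)

lemma mat_adjoint_mult:
  fixes A B :: "complex mat"
  assumes "A \<in> carrier_mat l m" "B \<in> carrier_mat m k"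
  shows "mat_adjoint (A * B) = mat_adjoint B * mat_adjoint A"
proof (rule eq_matI)
  fix i j assume "i < dim_row (mat_adjoint B * mat_adjoint A)" "j < dim_col (mat_adjoint B * mat_adjoint A)"
  then have ij: "i < k" "j < l" using assms by auto
  show "mat_adjoint (A * B) $$ (i, j) = (mat_adjoint B * mat_adjoint A) $$ (i, j)"
    using ij assms
    by (subst index_mult_mat_sum[of _ k m _ l])
       (auto simp: scalar_prod_def atLeast0LessThan mult.commute intro!: sum.cong)
qed (use assms in auto)

lemma mat_adjoint_adjoint [simp]: "mat_adjoint (mat_adjoint A) = (A :: complex mat)"
  by (rule eq_matI) auto

lemma mat_adjoint_one [simp]: "mat_adjoint (1\<^sub>m n) = (1\<^sub>m n :: complex mat)"
  by (rule eq_matI) auto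

definition dmat :: "nat \<Rightarrow> (nat \<Rightarrow> complex) \<Rightarrow> complex mat" where
  "dmat n t = Matrix.mat n n (\<lambda>(i, j). if i = j then t i else 0)"

lemma dmat_carrier [simp]: "dmat n t \<in> carrier_mat n n"
  and dmat_dim [simp]: "dim_row (dmat n t) = n" "dim_col (dmat n t) = n"
  and dmat_index [simp]: "i < n \<Longrightarrow> j < n \<Longrightarrow> dmat n t $$ (i, j) = (if i = j then t i else 0)"
  unfolding dmat_def by auto

lemma dmat_one: "dmat n (\<lambda>_. 1) = 1\<^sub>m n"
  by (rule eq_matI) auto

lemma dmat_cong: "(\<And>i. i < n \<Longrightarrow> s i = t i) \<Longrightarrow> dmat n s = dmat n t"
  by (rule eq_matI) auto

lemma dmat_mult_left_index:
  assumes "A \<in> carrier_mat n k" "i < n" "j < k"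
  shows "(dmat n t * A) $$ (i, j) = t i * A $$ (i, j)"
proof -
  have "(dmat n t * A) $$ (i, j) = (\<Sum>a<n. dmat n t $$ (i, a) * A $$ (a, j))"
    using assms by (intro index_mult_mat_sum) auto
  also have "\<dots> = (\<Sum>a<n. if a = i then t i * A $$ (i, j) else 0)"
    using assms by (intro sum.cong) auto
  finally show ?thesis using assms by simp
qed

lemma dmat_mult_right_index:
  assumes "A \<in> carrier_mat k n" "i < k" "j < n"
  shows "(A * dmat n t) $$ (i, j) = A $$ (i, j) * t j"
proof -
  have "(A * dmat n t) $$ (i, j) = (\<Sum>a<n. A $$ (i, a) * dmat n t $$ (a, j))"
    using assms by (intro index_mult_mat_sum) auto
  also have "\<dots> = (\<Sum>a<n. if a = j then A $$ (i, j) * t j else 0)"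
    using assms by (intro sum.cong) auto
  finally show ?thesis using assms by simp
qed

lemma dmat_mult: "dmat n s * dmat n t = dmat n (\<lambda>i. s i * t i)"
proof (rule eq_matI)
  fix i j assume "i < dim_row (dmat n (\<lambda>i. s i * t i))" "j < dim_col (dmat n (\<lambda>i. s i * t i))"
  then have "i < n" "j < n" by auto
  then show "(dmat n s * dmat n t) $$ (i, j) = dmat n (\<lambda>i. s i * t i) $$ (i, j)"
    by (subst dmat_mult_left_index[OF dmat_carrier]) auto
qed auto

lemma dmat_adjoint: "mat_adjoint (dmat n t) = dmat n (\<lambda>i. cnj (t i))"
  by (rule eq_matI) auto

lemma conj_dmat_index:
  assumes "u \<in> carrier_mat n n" "i < n" "j < n"
  shows "(u * dmat n t * mat_adjoint u) $$ (i, j) = (\<Sum>a<n. u $$ (i, a) * t a * cnj (u $$ (j, a)))"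
proof -
  have "(u * dmat n t * mat_adjoint u) $$ (i, j)
      = (\<Sum>a<n. (u * dmat n t) $$ (i, a) * mat_adjoint u $$ (a, j))"
    using assms by (intro index_mult_mat_sum[of _ n n _ n]) auto
  also have "\<dots> = (\<Sum>a<n. u $$ (i, a) * t a * cnj (u $$ (j, a)))"
    using assms by (intro sum.cong refl) (auto simp: dmat_mult_right_index simp del: index_mult_mat)
  finally show ?thesis .
qed

lemma dmat_GL: "(\<And>i. i < n \<Longrightarrow> t i \<noteq> 0) \<Longrightarrow> dmat n t \<in> carrier (GL n)"
proof -
  assume nz: "\<And>i. i < n \<Longrightarrow> t i \<noteq> 0"
  have "dmat n t * dmat n (\<lambda>i. inverse (t i)) = 1\<^sub>m n" "dmat n (\<lambda>i. inverse (t i)) * dmat n t = 1\<^sub>m n"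
    unfolding dmat_mult dmat_one[symmetric] using nz by (auto intro!: dmat_cong)
  then show ?thesis unfolding carrier_GL invertible_mat_def inverts_mat_def
    by (auto intro!: exI[of _ "dmat n (\<lambda>i. inverse (t i))"])
qed

lemma GL_carrier_mat: "g \<in> carrier (GL n) \<Longrightarrow> g \<in> carrier_mat n n"
  unfolding carrier_GL by auto

text \<open>
  A one-sided inverse of a square matrix is two-sided.
\<close>
lemma GL_I:
  assumes "g \<in> carrier_mat n n" "h \<in> carrier_mat n n" "g * h = 1\<^sub>m n"
  shows "g \<in> carrier (GL n)"
proof -
  have "h * g = 1\<^sub>m n" using mat_mult_left_right_inverse[OF assms(1,2,3)] .
  then show ?thesis using assms unfolding carrier_GL invertible_mat_def inverts_mat_def by auto
qed

lemma GL_inverse: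
  assumes "g \<in> carrier (GL n)"
  obtains h where "h \<in> carrier (GL n)" "g * h = 1\<^sub>m n" "h * g = 1\<^sub>m n"
proof -
  from assms obtain h where h: "h \<in> carrier_mat n n" "h * g = 1\<^sub>m n" "g * h = 1\<^sub>m n"
    unfolding GL_def units_of_def Units_def by (auto simp: ring_mat_simps)
  have "h \<in> carrier (GL n)" by (rule GL_I[OF h(1) _ h(2)]) (use assms GL_carrier_mat in auto)
  then show ?thesis using h that by auto
qed

lemma GL_mult_mat: "g \<otimes>\<^bsub>GL n\<^esub> h = g * h" and GL_one_mat: "\<one>\<^bsub>GL n\<^esub> = 1\<^sub>m n"
  unfolding GL_def units_of_def by (auto simp: ring_mat_simps)

lemma group_GL: "group (GL n)"
proof -
  interpret ring "ring_mat TYPE(complex) n ()" by (rule ring_mat)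
  show ?thesis unfolding GL_def by (rule units_group)
qed

lemma GL_mult_closed: "g \<in> carrier (GL n) \<Longrightarrow> h \<in> carrier (GL n) \<Longrightarrow> g * h \<in> carrier (GL n)"
  using monoid.m_closed[OF group.is_monoid[OF group_GL]] by (metis GL_mult_mat)

lemma GL_one_closed [simp]: "1\<^sub>m n \<in> carrier (GL n)"
  using monoid.one_closed[OF group.is_monoid[OF group_GL]] by (metis GL_one_mat)

lemma GL_det_nonzero: "g \<in> carrier (GL n) \<longleftrightarrow> g \<in> carrier_mat n n \<and> Determinant.det g \<noteq> 0"
proof
  assume g: "g \<in> carrier (GL n)"
  then obtain h where h: "h \<in> carrier (GL n)" "g * h = 1\<^sub>m n" by (rule GL_inverse)
  have "Determinant.det g * Determinant.det h = 1"
    using det_mult[of g n h] g h GL_carrier_mat by auto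
  then show "g \<in> carrier_mat n n \<and> Determinant.det g \<noteq> 0" using g GL_carrier_mat by auto
next
  assume "g \<in> carrier_mat n n \<and> Determinant.det g \<noteq> 0"
  then show "g \<in> carrier (GL n)"
    using det_non_zero_imp_unit[of g n "()"] unfolding GL_def units_of_def by auto
qed

lemma unitary_matsD:
  assumes "u \<in> unitary_mats n"
  shows "u \<in> carrier_mat n n" "mat_adjoint u * u = 1\<^sub>m n" "u * mat_adjoint u = 1\<^sub>m n"
    "u \<in> carrier (GL n)" "mat_adjoint u \<in> unitary_mats n"
proof -
  show 1: "u \<in> carrier_mat n n" "mat_adjoint u * u = 1\<^sub>m n" using assms unfolding unitary_mats_def by auto
  then show 2: "u * mat_adjoint u = 1\<^sub>m n"
    using mat_mult_left_right_inverse[of "mat_adjoint u" n u] by auto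
  show "u \<in> carrier (GL n)" by (rule GL_I[OF _ _ 2]) (use 1 in auto)
  show "mat_adjoint u \<in> unitary_mats n" unfolding unitary_mats_def using 1 2 by auto
qed

lemma unitary_mult:
  assumes u: "u \<in> unitary_mats n" and w: "w \<in> unitary_mats n"
  shows "u * w \<in> unitary_mats n"
proof -
  note c = unitary_matsD[OF u] unitary_matsD[OF w]
  have "mat_adjoint (u * w) * (u * w) = mat_adjoint w * mat_adjoint u * (u * w)"
    using c by (simp add: mat_adjoint_mult[of u n n w n])
  also have "\<dots> = mat_adjoint w * (mat_adjoint u * (u * w))"
    using c by (intro assoc_mult_mat[of _ n n _ n _ n]) auto
  also have "mat_adjoint u * (u * w) = (mat_adjoint u * u) * w"
    using c by (intro assoc_mult_mat[of _ n n _ n _ n, symmetric]) auto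
  finally show ?thesis using c unfolding unitary_mats_def by auto
qed

lemma dmat_unitary: "(\<And>i. i < n \<Longrightarrow> cmod (t i) = 1) \<Longrightarrow> dmat n t \<in> unitary_mats n"
  unfolding unitary_mats_def mem_Collect_eq dmat_adjoint dmat_mult dmat_one[symmetric]
  by (intro conjI dmat_carrier dmat_cong) (simp add: mult.commute[of "cnj _"] complex_norm_square[symmetric])

lemma mult_unit_vec:
  fixes A :: "complex mat"
  assumes "A \<in> carrier_mat m n" "i < n"
  shows "A *\<^sub>v unit_vec n i = col A i"
proof (rule eq_vecI)
  fix k assume "k < dim_vec (col A i)"
  then have k: "k < m" using assms by auto
  have "row A k \<in> carrier_vec n" using assms by auto
  then show "(A *\<^sub>v unit_vec n i) $ k = col A i $ k"
    using scalar_prod_right_unit[OF assms(2), of "row A k"] assms k by auto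
qed (use assms in auto)

section \<open>Spectral theorem, exponential and Cartan decomposition\<close>

text \<open>
  Gram-Schmidt orthogonalisation of a basis that starts with \<open>v\<close> keeps \<open>v\<close>
  as the first vector; it remains to normalise the columns.
\<close>
lemma unitary_with_first_column:
  assumes v: "v \<in> carrier_vec n" and v0: "v \<noteq> 0\<^sub>v n"
  obtains u c where "u \<in> unitary_mats n" "c \<noteq> 0" "col u 0 = c \<cdot>\<^sub>v v"
proof -
  interpret cof_vec_space n "TYPE(complex)" .
  define b where "b = basis_completion v"
  note bc = basis_completion[OF v v0, folded b_def]
  define ws where "ws = gram_schmidt n b"
  from gram_schmidt_result[OF bc(2,4,5) ws_def] bc(6)
  have ws: "set ws \<subseteq> carrier_vec n" "corthogonal ws" "length ws = n" by auto
  have n: "n > 0" using v v0 by (cases n) auto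
  obtain vs where bv: "b = v # vs" using bc(6,7) n by (cases b) auto
  have hd: "ws ! 0 = v"
    using gram_schmidt_hd[OF v, of vs] n ws(3) hd_conv_nth[of ws] unfolding ws_def bv by fastforce
  have wsi: "ws ! i \<in> carrier_vec n" if "i < n" for i using ws that by auto
  define r where "r i = (\<Sum>k<n. (cmod (ws ! i $ k))\<^sup>2)" for i
  have ip: "ws ! j \<bullet>c ws ! i = (\<Sum>k<n. ws ! j $ k * cnj (ws ! i $ k))" if "i < n" "j < n" for i j
    using wsi[OF that(1)] wsi[OF that(2)] by (auto simp: scalar_prod_def atLeast0LessThan)
  have ipr: "ws ! i \<bullet>c ws ! i = of_real (r i)" if "i < n" for i
    unfolding ip[OF that that] r_def by (simp only: of_real_sum complex_norm_square)
  have r: "r i > 0" if "i < n" for i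
  proof -
    have "r i \<noteq> 0" using corthogonalD[OF ws(2), of i i] that ws(3) ipr[OF that] by auto
    moreover have "r i \<ge> 0" unfolding r_def by (intro sum_nonneg) auto
    ultimately show ?thesis by simp
  qed
  define u where "u = Matrix.mat n n (\<lambda>(i, j). ws ! j $ i / of_real (sqrt (r j)))"
  have uc: "u \<in> carrier_mat n n" unfolding u_def by auto
  have "mat_adjoint u * u = 1\<^sub>m n"
  proof (rule eq_matI)
    fix i j assume "i < dim_row (1\<^sub>m n)" "j < dim_col (1\<^sub>m n)"
    then have ij: "i < n" "j < n" by auto
    have "(mat_adjoint u * u) $$ (i, j) = (\<Sum>k<n. cnj (u $$ (k, i)) * u $$ (k, j))"
      using uc ij by (subst index_mult_mat_sum[of _ n n _ n]) (auto intro!: sum.cong)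
    also have "\<dots> = (\<Sum>k<n. ws ! j $ k * cnj (ws ! i $ k)) / (of_real (sqrt (r i)) * of_real (sqrt (r j)))"
      unfolding sum_divide_distrib using ij by (intro sum.cong) (auto simp: u_def)
    also have "\<dots> = (1\<^sub>m n) $$ (i, j)"
    proof (cases "i = j")
      case True
      have "complex_of_real (sqrt (r i)) * complex_of_real (sqrt (r i)) = of_real (r i)"
        using r[OF ij(1)] by (simp flip: of_real_mult)
      then show ?thesis using ij True r[OF ij(1)] ip[OF ij(1) ij(1)] ipr[OF ij(1)] by auto
    next
      case False
      then show ?thesis using ip[OF ij] corthogonalD[OF ws(2), of j i] ij ws(3) by auto
    qed
    finally show "(mat_adjoint u * u) $$ (i, j) = (1\<^sub>m n) $$ (i, j)" .
  qed (use uc in auto)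
  then have "u \<in> unitary_mats n" unfolding unitary_mats_def using uc by auto
  moreover have "col u 0 = (1 / of_real (sqrt (r 0))) \<cdot>\<^sub>v v"
    using n hd v by (intro eq_vecI) (auto simp: u_def)
  moreover have "1 / complex_of_real (sqrt (r 0)) \<noteq> 0" using r[OF n] by auto
  ultimately show ?thesis using that by blast
qed

lemma complex_mat_has_eigenvector:
  fixes A :: "complex mat"
  assumes A: "A \<in> carrier_mat n n" and n: "n > 0"
  obtains v e where "v \<in> carrier_vec n" "v \<noteq> 0\<^sub>v n" "A *\<^sub>v v = e \<cdot>\<^sub>v v"
proof -
  obtain es where es: "char_poly A = (\<Prod>a\<leftarrow>es. [:- a, 1:])" "length es = n"
    using char_poly_factorized[OF A] by blast
  then obtain e es' where "es = e # es'" using n by (cases es) auto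
  then have "poly (char_poly A) e = 0" unfolding es(1) by simp
  then have "eigenvalue A e" using eigenvalue_root_char_poly[OF A] by simp
  then show ?thesis using that A unfolding eigenvalue_def eigenvector_def by auto
qed

lemma hermitian_conj:
  assumes H: "H \<in> hermitian_mats n" and u: "u \<in> carrier_mat n n"
  shows "mat_adjoint u * H * u \<in> hermitian_mats n"
proof -
  have c: "H \<in> carrier_mat n n" "mat_adjoint H = H" using H unfolding hermitian_mats_def by auto
  have "mat_adjoint (mat_adjoint u * H * u) = mat_adjoint u * (mat_adjoint H * u)"
    using c(1) u mat_adjoint_mult[of "mat_adjoint u * H" n n u n] mat_adjoint_mult[of "mat_adjoint u" n n H n]
    by (simp add: mult_carrier_mat[of _ n n])
  also have "\<dots> = mat_adjoint u * H * u"
    using c u by (simp add: assoc_mult_mat[of _ n n _ n _ n])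
  finally show ?thesis using c u unfolding hermitian_mats_def by (auto intro!: mult_carrier_mat)
qed

lemma hermitian_index:
  assumes "H \<in> hermitian_mats n" "i < n" "j < n"
  shows "cnj (H $$ (i, j)) = H $$ (j, i)"
  using assms mat_adjoint_index[of j H i] unfolding hermitian_mats_def by auto

lemma unitary_conj_cancel:
  assumes u: "u \<in> unitary_mats n" and H: "H \<in> carrier_mat n n"
  shows "u * (mat_adjoint u * H * u) * mat_adjoint u = H"
proof -
  note c = unitary_matsD[OF u]
  have ca: "mat_adjoint u \<in> carrier_mat n n" using c by auto
  have "u * (mat_adjoint u * H * u) * mat_adjoint u = (u * mat_adjoint u) * H * (u * mat_adjoint u)"
    using c(1) ca H by (simp add: assoc_mult_mat[of _ n n _ n _ n] mult_carrier_mat[of _ n n])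
  then show ?thesis using c H by simp
qed

text \<open>
  By induction on the size: in a unitary basis that starts with an eigenvector the first column
  vanishes below the diagonal, by symmetry so does the first row to its right, and the complementary
  block is again Hermitian.
\<close>
theorem hermitian_spectral:
  assumes "H \<in> hermitian_mats n"
  shows "\<exists>u h. u \<in> unitary_mats n \<and> H = u * dmat n (\<lambda>i. complex_of_real (h i)) * mat_adjoint u"
  using assms
proof (induction n arbitrary: H)
  case 0
  have "H = 1\<^sub>m 0 * dmat 0 (\<lambda>i. complex_of_real 0) * mat_adjoint (1\<^sub>m 0)"
    using 0 unfolding hermitian_mats_def by (intro eq_matI) auto
  moreover have "1\<^sub>m 0 \<in> unitary_mats 0" unfolding unitary_mats_def by auto
  ultimately show ?case by (intro exI[of _ "1\<^sub>m 0"] exI[of _ "\<lambda>_. 0"]) auto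
next
  case (Suc n)
  let ?N = "Suc n"
  have H: "H \<in> carrier_mat ?N ?N" using Suc.prems unfolding hermitian_mats_def by auto
  obtain v e where v: "v \<in> carrier_vec ?N" "v \<noteq> 0\<^sub>v ?N" "H *\<^sub>v v = e \<cdot>\<^sub>v v"
    using complex_mat_has_eigenvector[OF H] by auto
  obtain u1 c where u1: "u1 \<in> unitary_mats ?N" and c: "c \<noteq> 0" "col u1 0 = c \<cdot>\<^sub>v v"
    using unitary_with_first_column[OF v(1,2)] by blast
  note u1c = unitary_matsD[OF u1]
  have u1a: "mat_adjoint u1 \<in> carrier_mat ?N ?N" using u1c by auto
  define A where "A = mat_adjoint u1 * H * u1"
  have A: "A \<in> hermitian_mats ?N" unfolding A_def by (rule hermitian_conj[OF Suc.prems u1c(1)])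
  then have Ac: "A \<in> carrier_mat ?N ?N" unfolding hermitian_mats_def by auto
  have "col A 0 = A *\<^sub>v unit_vec ?N 0"
    using mult_unit_vec[OF Ac, of 0] by simp
  also have "\<dots> = mat_adjoint u1 *\<^sub>v (H *\<^sub>v (u1 *\<^sub>v unit_vec ?N 0))"
    unfolding A_def using u1c(1) u1a H
    by (simp add: assoc_mult_mat_vec[of _ ?N ?N _ ?N] mult_carrier_mat[of _ ?N ?N])
  also have "u1 *\<^sub>v unit_vec ?N 0 = c \<cdot>\<^sub>v v"
    using mult_unit_vec[OF u1c(1), of 0] c(2) by simp
  also have "H *\<^sub>v (c \<cdot>\<^sub>v v) = e \<cdot>\<^sub>v (c \<cdot>\<^sub>v v)"
    using v H by (simp add: mult_mat_vec smult_smult_assoc mult.commute)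
  also have "mat_adjoint u1 *\<^sub>v (e \<cdot>\<^sub>v (c \<cdot>\<^sub>v v)) = e \<cdot>\<^sub>v (mat_adjoint u1 *\<^sub>v (u1 *\<^sub>v unit_vec ?N 0))"
    using mult_unit_vec[OF u1c(1), of 0] c(2) v(1) u1a by (simp add: mult_mat_vec[of _ ?N ?N])
  also have "mat_adjoint u1 *\<^sub>v (u1 *\<^sub>v unit_vec ?N 0) = unit_vec ?N 0"
    using u1c(1,2) u1a by (simp flip: assoc_mult_mat_vec[of _ ?N ?N _ ?N])
  finally have colA: "col A 0 = e \<cdot>\<^sub>v unit_vec ?N 0" .
  have A0: "A $$ (i, 0) = (if i = 0 then e else 0)" if "i < ?N" for i
    using arg_cong[OF colA, of "\<lambda>x. x $ i"] that Ac by (auto simp: unit_vec_def)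
  have A0': "A $$ (0, i) = (if i = 0 then cnj e else 0)" if "i < ?N" for i
    using hermitian_index[OF A that, of 0] A0[OF that] by auto
  have e: "cnj e = e" using A0[of 0] A0'[of 0] by simp
  have er: "e = complex_of_real (Re e)" using e by (metis Reals_cnj_iff of_real_Re)
  define B where "B = Matrix.mat n n (\<lambda>(i, j). A $$ (Suc i, Suc j))"
  have "B \<in> hermitian_mats n"
    unfolding hermitian_mats_def
    by (auto intro!: eq_matI simp: B_def hermitian_index[OF A])
  then obtain u3 h where u3: "u3 \<in> unitary_mats n"
    and B: "B = u3 * dmat n (\<lambda>i. complex_of_real (h i)) * mat_adjoint u3"
    using Suc.IH by blast
  note u3c = unitary_matsD[OF u3]
  \<comment> \<open>The block diagonal matrix with blocks \<open>1\<close> and \<open>u3\<close>.\<close>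
  define u2 where "u2 = Matrix.mat ?N ?N (\<lambda>(i, j). case i of 0 \<Rightarrow> (if j = 0 then 1 else 0)
     | Suc i' \<Rightarrow> (case j of 0 \<Rightarrow> 0 | Suc j' \<Rightarrow> u3 $$ (i', j')))"
  define k where "k = case_nat (Re e) h"
  have u2c: "u2 \<in> carrier_mat ?N ?N" unfolding u2_def by auto
  have u2i: "u2 $$ (0, 0) = 1" "i < n \<Longrightarrow> u2 $$ (Suc i, 0) = 0" "i < n \<Longrightarrow> u2 $$ (0, Suc i) = 0"
    "i < n \<Longrightarrow> j < n \<Longrightarrow> u2 $$ (Suc i, Suc j) = u3 $$ (i, j)" for i j
    unfolding u2_def by auto
  have u3u: "(\<Sum>a<n. cnj (u3 $$ (a, i)) * u3 $$ (a, j)) = (if i = j then 1 else 0)" if "i < n" "j < n" for i j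
  proof -
    have "(\<Sum>a<n. cnj (u3 $$ (a, i)) * u3 $$ (a, j)) = (mat_adjoint u3 * u3) $$ (i, j)"
      using that u3c(1) by (subst index_mult_mat_sum[of _ n n _ n]) (auto intro!: sum.cong)
    then show ?thesis using that u3c by auto
  qed
  have u2: "u2 \<in> unitary_mats ?N"
  proof -
    have "mat_adjoint u2 * u2 = 1\<^sub>m ?N"
    proof (rule eq_matI)
      fix i j assume "i < dim_row (1\<^sub>m ?N :: complex mat)" "j < dim_col (1\<^sub>m ?N :: complex mat)"
      then have ij: "i < ?N" "j < ?N" by auto
      have "(mat_adjoint u2 * u2) $$ (i, j) = (\<Sum>a<?N. cnj (u2 $$ (a, i)) * u2 $$ (a, j))"
        using ij u2c by (subst index_mult_mat_sum[of _ ?N ?N _ ?N]) (auto intro!: sum.cong)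
      also have "\<dots> = cnj (u2 $$ (0, i)) * u2 $$ (0, j) + (\<Sum>a<n. cnj (u2 $$ (Suc a, i)) * u2 $$ (Suc a, j))"
        by (rule sum.lessThan_Suc_shift)
      also have "\<dots> = (1\<^sub>m ?N) $$ (i, j)"
        using ij by (cases i; cases j) (auto simp: u2i u3u)
      finally show "(mat_adjoint u2 * u2) $$ (i, j) = (1\<^sub>m ?N) $$ (i, j)" .
    qed (use u2c in auto)
    then show ?thesis using u2c unfolding unitary_mats_def by auto
  qed
  have A2: "A = u2 * dmat ?N (\<lambda>i. complex_of_real (k i)) * mat_adjoint u2"
  proof (rule eq_matI)
    fix i j assume "i < dim_row (u2 * dmat ?N (\<lambda>i. complex_of_real (k i)) * mat_adjoint u2)"
      "j < dim_col (u2 * dmat ?N (\<lambda>i. complex_of_real (k i)) * mat_adjoint u2)"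
    then have ij: "i < ?N" "j < ?N" using u2c by auto
    have Bij: "A $$ (Suc i, Suc j) = (\<Sum>a<n. u3 $$ (i, a) * of_real (h a) * cnj (u3 $$ (j, a)))"
      if "i < n" "j < n" for i j
    proof -
      have "A $$ (Suc i, Suc j) = B $$ (i, j)" using that unfolding B_def by simp
      then show ?thesis unfolding B using conj_dmat_index[OF u3c(1) that] by simp
    qed
    have "(u2 * dmat ?N (\<lambda>i. complex_of_real (k i)) * mat_adjoint u2) $$ (i, j)
        = (\<Sum>a<?N. u2 $$ (i, a) * of_real (k a) * cnj (u2 $$ (j, a)))"
      by (rule conj_dmat_index[OF u2c ij])
    also have "\<dots> = u2 $$ (i, 0) * of_real (k 0) * cnj (u2 $$ (j, 0))
        + (\<Sum>a<n. u2 $$ (i, Suc a) * of_real (k (Suc a)) * cnj (u2 $$ (j, Suc a)))"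
      by (rule sum.lessThan_Suc_shift)
    also have "\<dots> = A $$ (i, j)"
      using ij er by (cases i; cases j) (auto simp: u2i k_def A0 A0' Bij e)
    finally show "A $$ (i, j) = (u2 * dmat ?N (\<lambda>i. complex_of_real (k i)) * mat_adjoint u2) $$ (i, j)" by simp
  qed (use Ac u2c in auto)
  define D where "D = dmat ?N (\<lambda>i. complex_of_real (k i))"
  have Dc: "D \<in> carrier_mat ?N ?N" unfolding D_def by auto
  have u2a: "mat_adjoint u2 \<in> carrier_mat ?N ?N" using u2c by auto
  have "H = u1 * (u2 * D * mat_adjoint u2) * mat_adjoint u1"
    using unitary_conj_cancel[OF u1 H] A2 unfolding A_def D_def by simp
  also have "\<dots> = (u1 * u2) * D * mat_adjoint (u1 * u2)"
    using u1c(1) u2c u1a u2a Dc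
    by (simp add: mat_adjoint_mult[of _ ?N ?N _ ?N] assoc_mult_mat[of _ ?N ?N _ ?N _ ?N] mult_carrier_mat[of _ ?N ?N])
  finally show ?case using unitary_mult[OF u1 u2] unfolding D_def by blast
qed

lemma mult_conj_dmat:
  assumes u: "u \<in> unitary_mats n"
  shows "(u * dmat n s * mat_adjoint u) * (u * dmat n t * mat_adjoint u)
       = u * dmat n (\<lambda>i. s i * t i) * mat_adjoint u"
proof -
  note c = unitary_matsD[OF u]
  have ca: "mat_adjoint u \<in> carrier_mat n n" using c by auto
  have "(u * dmat n s * mat_adjoint u) * (u * dmat n t * mat_adjoint u)
     = u * dmat n s * ((mat_adjoint u * u) * dmat n t) * mat_adjoint u"
    using c(1) ca by (simp add: assoc_mult_mat[of _ n n _ n _ n] mult_carrier_mat[of _ n n])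
  also have "\<dots> = u * (dmat n s * dmat n t) * mat_adjoint u"
    using c(1,2) ca by (simp add: assoc_mult_mat[of _ n n _ n _ n] mult_carrier_mat[of _ n n])
  finally show ?thesis by (simp add: dmat_mult)
qed

lemma pow_conj_dmat:
  assumes u: "u \<in> unitary_mats n"
  shows "(u * dmat n t * mat_adjoint u) ^\<^sub>m k = u * dmat n (\<lambda>i. t i ^ k) * mat_adjoint u"
proof (induction k)
  case 0
  then show ?case using unitary_matsD[OF u] by (simp add: dmat_one)
next
  case (Suc k)
  then show ?case by (simp add: mult_conj_dmat[OF u] mult.commute)
qed

text \<open>
  Powers, and hence the exponential series, pass through conjugation by a unitary matrix, so
  everything reduces to the scalar series on the diagonal.
\<close>
lemma mat_exp_conj_dmat:
  assumes u: "u \<in> unitary_mats n"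
  shows "mat_exp (u * dmat n t * mat_adjoint u) = u * dmat n (\<lambda>i. exp (t i)) * mat_adjoint u"
proof (rule eq_matI)
  note c = unitary_matsD[OF u]
  fix i j assume "i < dim_row (u * dmat n (\<lambda>i. exp (t i)) * mat_adjoint u)"
    "j < dim_col (u * dmat n (\<lambda>i. exp (t i)) * mat_adjoint u)"
  then have ij: "i < n" "j < n" using c by auto
  have exps: "(\<lambda>k. x ^ k / fact k) sums exp x" for x :: complex
  proof -
    have "x ^ k /\<^sub>R fact k = x ^ k / fact k" for k by (simp add: scaleR_conv_of_real divide_simps)
    then show ?thesis using exp_converges[of x] by simp
  qed
  have "(\<lambda>k. \<Sum>a<n. u $$ (i, a) * (t a ^ k / fact k) * cnj (u $$ (j, a)))
      sums (\<Sum>a<n. u $$ (i, a) * exp (t a) * cnj (u $$ (j, a)))"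
    by (intro sums_sum sums_mult sums_mult2 exps)
  moreover have "(\<Sum>a<n. u $$ (i, a) * (t a ^ k / fact k) * cnj (u $$ (j, a)))
      = ((u * dmat n t * mat_adjoint u) ^\<^sub>m k) $$ (i, j) / fact k" for k
    unfolding pow_conj_dmat[OF u] conj_dmat_index[OF c(1) ij] sum_divide_distrib by simp
  ultimately have "(\<lambda>k. ((u * dmat n t * mat_adjoint u) ^\<^sub>m k) $$ (i, j) / fact k)
      sums (u * dmat n (\<lambda>i. exp (t i)) * mat_adjoint u) $$ (i, j)"
    unfolding conj_dmat_index[OF c(1) ij] by simp
  then show "mat_exp (u * dmat n t * mat_adjoint u) $$ (i, j)
      = (u * dmat n (\<lambda>i. exp (t i)) * mat_adjoint u) $$ (i, j)"
    using ij c(1) unfolding mat_exp_def by (simp add: sums_iff)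
qed (use unitary_matsD[OF u] in \<open>auto simp: mat_exp_def\<close>)

lemma smult_conj_dmat:
  assumes u: "u \<in> carrier_mat n n"
  shows "c \<cdot>\<^sub>m (u * dmat n t * mat_adjoint u) = u * dmat n (\<lambda>i. c * t i) * mat_adjoint u"
proof (rule eq_matI)
  fix i j assume "i < dim_row (u * dmat n (\<lambda>i. c * t i) * mat_adjoint u)"
    "j < dim_col (u * dmat n (\<lambda>i. c * t i) * mat_adjoint u)"
  then have ij: "i < n" "j < n" using u by auto
  have "(c \<cdot>\<^sub>m (u * dmat n t * mat_adjoint u)) $$ (i, j) = c * (u * dmat n t * mat_adjoint u) $$ (i, j)"
    using ij u by auto
  then show "(c \<cdot>\<^sub>m (u * dmat n t * mat_adjoint u)) $$ (i, j)
     = (u * dmat n (\<lambda>i. c * t i) * mat_adjoint u) $$ (i, j)"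
    unfolding conj_dmat_index[OF u ij] sum_distrib_left by (simp add: algebra_simps)
qed (use u in auto)

lemma conj_dmat_GL:
  assumes "u \<in> unitary_mats n" "w \<in> unitary_mats n" "\<And>i. i < n \<Longrightarrow> t i \<noteq> 0"
  shows "u * dmat n t * w \<in> carrier (GL n)"
  using unitary_matsD[OF assms(1)] unitary_matsD[OF assms(2)] dmat_GL[OF assms(3)]
  by (auto intro!: GL_mult_closed)

text \<open>
  If \<open>u\<close> diagonalises the positive matrix \<open>g\<^sup>* g\<close>, then the columns
  of \<open>g u\<close> are orthogonal, and dividing them by their lengths gives the other unitary
  factor.
\<close>
lemma GL_cartan:
  assumes g: "g \<in> carrier (GL n)"
  obtains w u and t :: "nat \<Rightarrow> real" where "w \<in> unitary_mats n" "u \<in> unitary_mats n"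
    "\<And>i. i < n \<Longrightarrow> t i > 0" "g = w * dmat n (\<lambda>i. complex_of_real (t i)) * u"
proof -
  have gc: "g \<in> carrier_mat n n" using g GL_carrier_mat by auto
  then have ga: "mat_adjoint g \<in> carrier_mat n n" by simp
  have "mat_adjoint g * g \<in> hermitian_mats n"
    unfolding hermitian_mats_def using gc ga by (auto simp: mat_adjoint_mult[of _ n n _ n])
  then obtain u h where u: "u \<in> unitary_mats n"
    and uh: "mat_adjoint g * g = u * dmat n (\<lambda>i. complex_of_real (h i)) * mat_adjoint u"
    using hermitian_spectral by blast
  note uc = unitary_matsD[OF u]
  have ua: "mat_adjoint u \<in> carrier_mat n n" using uc by auto
  define G where "G = g * u"
  have G: "G \<in> carrier (GL n)" unfolding G_def using g uc(4) by (rule GL_mult_closed)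
  then have Gc: "G \<in> carrier_mat n n" using GL_carrier_mat by auto
  have "mat_adjoint G * G = mat_adjoint u * (mat_adjoint g * g) * u"
    unfolding G_def using gc ga uc(1) ua
    by (simp add: mat_adjoint_mult[of _ n n _ n] assoc_mult_mat[of _ n n _ n _ n] mult_carrier_mat[of _ n n])
  also have "\<dots> = (mat_adjoint u * u) * dmat n (\<lambda>i. complex_of_real (h i)) * (mat_adjoint u * u)"
    unfolding uh using uc(1) ua
    by (simp add: assoc_mult_mat[of _ n n _ n _ n] mult_carrier_mat[of _ n n])
  finally have GG: "mat_adjoint G * G = dmat n (\<lambda>i. complex_of_real (h i))" using uc(2) by simp
  have hsum: "h i = (\<Sum>k<n. (cmod (G $$ (k, i)))\<^sup>2)" if "i < n" for i
  proof -
    have "(mat_adjoint G * G) $$ (i, i) = (\<Sum>k<n. mat_adjoint G $$ (i, k) * G $$ (k, i))"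
      using that Gc by (intro index_mult_mat_sum[of _ n n _ n]) auto
    also have "\<dots> = complex_of_real (\<Sum>k<n. (cmod (G $$ (k, i)))\<^sup>2)"
      unfolding of_real_sum using that Gc by (intro sum.cong) (auto simp: complex_norm_square mult.commute simp del: of_real_power)
    finally show ?thesis using that unfolding GG by (simp only: dmat_index if_True of_real_eq_iff simp_thms)
  qed
  have hpos: "h i > 0" if i: "i < n" for i
  proof (rule ccontr)
    assume "\<not> h i > 0"
    moreover have "h i \<ge> 0" unfolding hsum[OF i] by (intro sum_nonneg) auto
    ultimately have "(\<Sum>k<n. (cmod (G $$ (k, i)))\<^sup>2) = 0" using hsum[OF i] by simp
    then have z: "G $$ (k, i) = 0" if "k < n" for k
      using that by (subst (asm) sum_nonneg_eq_0_iff) auto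
    obtain K where K: "K \<in> carrier (GL n)" "K * G = 1\<^sub>m n" using GL_inverse[OF G] by metis
    have "(K * G) $$ (i, i) = (\<Sum>k<n. K $$ (i, k) * G $$ (k, i))"
      using K Gc i GL_carrier_mat by (intro index_mult_mat_sum[of _ n n _ n]) auto
    then show False using K i z by simp
  qed
  define t where "t i = sqrt (h i)" for i
  have t: "t i > 0" "complex_of_real (t i) * complex_of_real (t i) = of_real (h i)" if "i < n" for i
    using hpos[OF that] by (auto simp: t_def simp flip: of_real_mult)
  \<comment> \<open>Right multiplication by \<open>E\<close> normalises the columns of \<open>G\<close>.\<close>
  define E where "E = dmat n (\<lambda>i. complex_of_real (1 / t i))"
  have Ec: "E \<in> carrier_mat n n" unfolding E_def by simp
  have Ea: "mat_adjoint E = E" unfolding E_def dmat_adjoint by simp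
  define w where "w = G * E"
  have "mat_adjoint w * w = E * (mat_adjoint G * G) * E"
    unfolding w_def using Gc Ec Ea mat_adjoint_mult[OF Gc Ec]
    by (simp add: assoc_mult_mat[of _ n n _ n _ n] mult_carrier_mat[of _ n n])
  also have "\<dots> = 1\<^sub>m n"
    unfolding GG E_def dmat_mult dmat_one[symmetric] using t(1) t(2)[symmetric]
    by (intro dmat_cong) (auto simp: less_imp_neq[symmetric])
  finally have w: "w \<in> unitary_mats n" unfolding unitary_mats_def w_def using Gc Ec by auto
  have "E * dmat n (\<lambda>i. complex_of_real (t i)) = 1\<^sub>m n"
    unfolding E_def dmat_mult dmat_one[symmetric] using t(1)
    by (intro dmat_cong) (auto simp: less_imp_neq[symmetric])
  then have "w * dmat n (\<lambda>i. complex_of_real (t i)) * mat_adjoint u = G * mat_adjoint u"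
    unfolding w_def using Gc Ec ua by (simp add: assoc_mult_mat[of _ n n _ n _ n])
  also have "\<dots> = g" unfolding G_def using gc uc ua by (simp add: assoc_mult_mat[of _ n n _ n _ n])
  finally show ?thesis using that[OF w uc(5) t(1)] by simp
qed

section \<open>Continuity and differentiability of regular functions\<close>

lemma permutes_lt: "q permutes {0..<n} \<Longrightarrow> i < n \<Longrightarrow> q i < (n::nat)"
  using permutes_in_image[of q "{0..<n}" i] by simp

text \<open>
  The limit has to be invertible because of the inverse determinant among the generators.
\<close>
lemma regular_function_tendsto:
  assumes "p \<in> regular_functions n" and "\<And>s. \<gamma> s \<in> carrier_mat n n" and "g \<in> carrier (GL n)"
    and "\<And>i j. i < n \<Longrightarrow> j < n \<Longrightarrow> ((\<lambda>s. \<gamma> s $$ (i, j)) \<longlongrightarrow> g $$ (i, j)) F"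
  shows "((\<lambda>s. p (\<gamma> s)) \<longlongrightarrow> p g) F"
  using assms(1)
proof induction
  case inverse_det
  have gc: "g \<in> carrier_mat n n" using assms(3) GL_carrier_mat by auto
  have "((\<lambda>s. \<Sum>q | q permutes {0..<n}. of_int (sign q) * (\<Prod>i = 0..<n. \<gamma> s $$ (i, q i)))
      \<longlongrightarrow> (\<Sum>q | q permutes {0..<n}. of_int (sign q) * (\<Prod>i = 0..<n. g $$ (i, q i)))) F"
    by (intro tendsto_sum tendsto_mult_left tendsto_prod assms(4)) (auto dest: permutes_lt)
  then have "((\<lambda>s. Determinant.det (\<gamma> s)) \<longlongrightarrow> Determinant.det g) F"
    by (simp add: det_def'[OF gc] det_def'[OF assms(2)])
  then show ?case using assms(3) GL_det_nonzero by (intro tendsto_inverse) auto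
next
  case (entry i j)
  then show ?case by (rule assms(4))
next
  case (add p q)
  from add.IH show ?case by (rule tendsto_add)
next
  case (mult p q)
  from mult.IH show ?case by (rule tendsto_mult)
qed (rule tendsto_const)

lemma mat_vec_tendsto:
  assumes "\<And>k. A k \<in> carrier_mat m d" "B \<in> carrier_mat m d" "\<And>k. x k \<in> carrier_vec d" "y \<in> carrier_vec d"
    and "\<And>i j. i < m \<Longrightarrow> j < d \<Longrightarrow> ((\<lambda>k. A k $$ (i, j)) \<longlongrightarrow> (B $$ (i, j) :: complex)) F"
    and "\<And>j. j < d \<Longrightarrow> ((\<lambda>k. x k $ j) \<longlongrightarrow> y $ j) F" and "i < m"
  shows "((\<lambda>k. (A k *\<^sub>v x k) $ i) \<longlongrightarrow> (B *\<^sub>v y) $ i) F"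
proof -
  have "((\<lambda>k. \<Sum>j<d. A k $$ (i, j) * x k $ j) \<longlongrightarrow> (\<Sum>j<d. B $$ (i, j) * y $ j)) F"
    using assms(5,6,7) by (intro tendsto_sum tendsto_mult) auto
  then show ?thesis
    using index_mult_mat_vec_sum[OF assms(1) assms(3) assms(7)] index_mult_mat_vec_sum[OF assms(2,4,7)] by simp
qed

text \<open>
  The matrix \<open>D\<close> is the velocity of the curve at the identity.
\<close>
definition group_curve :: "nat \<Rightarrow> (real \<Rightarrow> complex mat) \<Rightarrow> (nat \<Rightarrow> nat \<Rightarrow> complex) \<Rightarrow> bool" where
  "group_curve n \<gamma> D \<longleftrightarrow> (\<forall>t. \<gamma> t \<in> carrier (GL n)) \<and> \<gamma> 0 = 1\<^sub>m n \<and>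
     (\<forall>i<n. \<forall>j<n. ((\<lambda>t. \<gamma> t $$ (i, j)) has_vector_derivative D i j) (at 0))"

text \<open>
  One real linear map has to give the derivative along all curves.  Squared norms of matrix
  coefficients are not holomorphic in the group element, hence the terms with conjugates.
\<close>
definition differentiable_at_one :: "nat \<Rightarrow> (complex mat \<Rightarrow> complex) \<Rightarrow> bool" where
  "differentiable_at_one n F \<longleftrightarrow> (\<exists>c e. \<forall>\<gamma> D. group_curve n \<gamma> D \<longrightarrow>
     ((\<lambda>t. F (\<gamma> t)) has_vector_derivative
       (\<Sum>i<n. \<Sum>j<n. c i j * D i j + e i j * cnj (D i j))) (at 0))"

lemma differentiable_at_oneI:
  assumes "\<And>\<gamma> D. group_curve n \<gamma> D \<Longrightarrow> ((\<lambda>t. F (\<gamma> t)) has_vector_derivative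
       (\<Sum>i<n. \<Sum>j<n. c i j * D i j + e i j * cnj (D i j))) (at 0)"
  shows "differentiable_at_one n F"
  unfolding differentiable_at_one_def using assms by blast

lemma differentiable_at_one_const: "differentiable_at_one n (\<lambda>g. a)"
  by (rule differentiable_at_oneI[where c = "\<lambda>_ _. 0" and e = "\<lambda>_ _. 0"]) simp

lemma differentiable_at_one_entry:
  assumes "i < n" "j < n"
  shows "differentiable_at_one n (\<lambda>g. g $$ (i, j))"
proof (rule differentiable_at_oneI[where c = "\<lambda>a b. if a = i then if b = j then 1 else 0 else 0" and e = "\<lambda>_ _. 0"])
  fix \<gamma> D assume "group_curve n \<gamma> D"
  then have "((\<lambda>t. \<gamma> t $$ (i, j)) has_vector_derivative D i j) (at 0)"
    using assms unfolding group_curve_def by auto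
  moreover have "(\<Sum>a<n. \<Sum>b<n. (if a = i then if b = j then 1 else 0 else 0) * D a b + 0 * cnj (D a b))
     = (\<Sum>a<n. if a = i then (\<Sum>b<n. if b = j then D a b else 0) else 0)"
    by (intro sum.cong refl) (simp add: if_distrib[of "\<lambda>x. x * _"] cong: if_cong)
  ultimately show "((\<lambda>t. \<gamma> t $$ (i, j)) has_vector_derivative
     (\<Sum>a<n. \<Sum>b<n. (if a = i then if b = j then 1 else 0 else 0) * D a b + 0 * cnj (D a b))) (at 0)"
    using assms by simp
qed

lemma differentiable_at_one_add:
  assumes "differentiable_at_one n F" "differentiable_at_one n G"
  shows "differentiable_at_one n (\<lambda>g. F g + G g)"
proof -
  obtain c e where F0: "\<forall>\<gamma> D. group_curve n \<gamma> D \<longrightarrow> ((\<lambda>t. F (\<gamma> t)) has_vector_derivative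
       (\<Sum>i<n. \<Sum>j<n. c i j * D i j + e i j * cnj (D i j))) (at 0)"
    using assms(1) unfolding differentiable_at_one_def by blast
  note F = F0[rule_format]
  obtain c' e' where G0: "\<forall>\<gamma> D. group_curve n \<gamma> D \<longrightarrow> ((\<lambda>t. G (\<gamma> t)) has_vector_derivative
       (\<Sum>i<n. \<Sum>j<n. c' i j * D i j + e' i j * cnj (D i j))) (at 0)"
    using assms(2) unfolding differentiable_at_one_def by blast
  note G = G0[rule_format]
  show ?thesis
  proof (rule differentiable_at_oneI[where c = "\<lambda>i j. c i j + c' i j" and e = "\<lambda>i j. e i j + e' i j"])
    fix \<gamma> D assume "group_curve n \<gamma> D"
    then show "((\<lambda>t. F (\<gamma> t) + G (\<gamma> t)) has_vector_derivative
      (\<Sum>i<n. \<Sum>j<n. (c i j + c' i j) * D i j + (e i j + e' i j) * cnj (D i j))) (at 0)"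
      using has_vector_derivative_add[OF F G] by (simp add: sum.distrib distrib_right add_ac)
  qed
qed

lemma differentiable_at_one_mult:
  assumes "differentiable_at_one n F" "differentiable_at_one n G"
  shows "differentiable_at_one n (\<lambda>g. F g * G g)"
proof -
  obtain c e where F0: "\<forall>\<gamma> D. group_curve n \<gamma> D \<longrightarrow> ((\<lambda>t. F (\<gamma> t)) has_vector_derivative
       (\<Sum>i<n. \<Sum>j<n. c i j * D i j + e i j * cnj (D i j))) (at 0)"
    using assms(1) unfolding differentiable_at_one_def by blast
  note F = F0[rule_format]
  obtain c' e' where G0: "\<forall>\<gamma> D. group_curve n \<gamma> D \<longrightarrow> ((\<lambda>t. G (\<gamma> t)) has_vector_derivative
       (\<Sum>i<n. \<Sum>j<n. c' i j * D i j + e' i j * cnj (D i j))) (at 0)"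
    using assms(2) unfolding differentiable_at_one_def by blast
  note G = G0[rule_format]
  let ?f = "F (1\<^sub>m n)" and ?g = "G (1\<^sub>m n)"
  show ?thesis
  proof (rule differentiable_at_oneI[where c = "\<lambda>i j. ?f * c' i j + ?g * c i j" and e = "\<lambda>i j. ?f * e' i j + ?g * e i j"])
    fix \<gamma> D assume \<gamma>: "group_curve n \<gamma> D"
    then have "\<gamma> 0 = 1\<^sub>m n" unfolding group_curve_def by auto
    then show "((\<lambda>t. F (\<gamma> t) * G (\<gamma> t)) has_vector_derivative
      (\<Sum>i<n. \<Sum>j<n. (?f * c' i j + ?g * c i j) * D i j + (?f * e' i j + ?g * e i j) * cnj (D i j))) (at 0)"
      using has_vector_derivative_mult[OF F[OF \<gamma>] G[OF \<gamma>]]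
      by (simp add: sum.distrib sum_distrib_left sum_distrib_right distrib_left distrib_right add_ac mult_ac)
  qed
qed

lemma differentiable_at_one_cnj:
  assumes "differentiable_at_one n F"
  shows "differentiable_at_one n (\<lambda>g. cnj (F g))"
proof -
  obtain c e where F0: "\<forall>\<gamma> D. group_curve n \<gamma> D \<longrightarrow> ((\<lambda>t. F (\<gamma> t)) has_vector_derivative
       (\<Sum>i<n. \<Sum>j<n. c i j * D i j + e i j * cnj (D i j))) (at 0)"
    using assms unfolding differentiable_at_one_def by blast
  note F = F0[rule_format]
  show ?thesis
  proof (rule differentiable_at_oneI[where c = "\<lambda>i j. cnj (e i j)" and e = "\<lambda>i j. cnj (c i j)"])
    fix \<gamma> D assume "group_curve n \<gamma> D"
    then show "((\<lambda>t. cnj (F (\<gamma> t))) has_vector_derivative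
      (\<Sum>i<n. \<Sum>j<n. cnj (e i j) * D i j + cnj (c i j) * cnj (D i j))) (at 0)"
      using bounded_linear.has_vector_derivative[OF bounded_linear_cnj F]
      by (simp add: add.commute)
  qed
qed

lemma differentiable_at_one_inverse:
  assumes "differentiable_at_one n F" "F (1\<^sub>m n) \<noteq> 0"
  shows "differentiable_at_one n (\<lambda>g. inverse (F g))"
proof -
  obtain c e where F0: "\<forall>\<gamma> D. group_curve n \<gamma> D \<longrightarrow> ((\<lambda>t. F (\<gamma> t)) has_vector_derivative
       (\<Sum>i<n. \<Sum>j<n. c i j * D i j + e i j * cnj (D i j))) (at 0)"
    using assms(1) unfolding differentiable_at_one_def by blast
  note F = F0[rule_format]
  define q where "q = - (inverse (F (1\<^sub>m n)) * inverse (F (1\<^sub>m n)))"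
  show ?thesis
  proof (rule differentiable_at_oneI[where c = "\<lambda>i j. q * c i j" and e = "\<lambda>i j. q * e i j"])
    fix \<gamma> D assume \<gamma>: "group_curve n \<gamma> D"
    then have 1: "\<gamma> 0 = 1\<^sub>m n" unfolding group_curve_def by auto
    define S where "S = (\<Sum>i<n. \<Sum>j<n. c i j * D i j + e i j * cnj (D i j))"
    have "((\<lambda>t. F (\<gamma> t)) has_derivative (\<lambda>h. h *\<^sub>R S)) (at 0)"
      using F[OF \<gamma>] unfolding has_vector_derivative_def S_def .
    from has_derivative_inverse[OF _ this] assms(2)
    have "((\<lambda>t. inverse (F (\<gamma> t))) has_derivative
        (\<lambda>h. - (inverse (F (\<gamma> 0)) * (h *\<^sub>R S) * inverse (F (\<gamma> 0))))) (at 0)"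
      unfolding 1 by auto
    also have "(\<lambda>h. - (inverse (F (\<gamma> 0)) * (h *\<^sub>R S) * inverse (F (\<gamma> 0)))) = (\<lambda>h. h *\<^sub>R (q * S))"
      unfolding 1 q_def by (simp add: fun_eq_iff scaleR_conv_of_real algebra_simps)
    finally show "((\<lambda>t. inverse (F (\<gamma> t))) has_vector_derivative
      (\<Sum>i<n. \<Sum>j<n. q * c i j * D i j + q * e i j * cnj (D i j))) (at 0)"
      unfolding has_vector_derivative_def S_def by (simp add: sum_distrib_left distrib_left mult.assoc)
  qed
qed

lemma differentiable_at_one_sum:
  "finite I \<Longrightarrow> (\<And>i. i \<in> I \<Longrightarrow> differentiable_at_one n (F i)) \<Longrightarrow> differentiable_at_one n (\<lambda>g. \<Sum>i\<in>I. F i g)"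
  by (induction I rule: finite_induct) (auto intro: differentiable_at_one_add differentiable_at_one_const)

lemma differentiable_at_one_prod:
  "finite I \<Longrightarrow> (\<And>i. i \<in> I \<Longrightarrow> differentiable_at_one n (F i)) \<Longrightarrow> differentiable_at_one n (\<lambda>g. \<Prod>i\<in>I. F i g)"
  by (induction I rule: finite_induct) (auto intro: differentiable_at_one_mult differentiable_at_one_const)

lemma differentiable_at_one_cong:
  assumes "differentiable_at_one n F" "\<And>g. g \<in> carrier (GL n) \<Longrightarrow> F g = G g"
  shows "differentiable_at_one n G"
proof -
  obtain c e where F: "\<forall>\<gamma> D. group_curve n \<gamma> D \<longrightarrow> ((\<lambda>t. F (\<gamma> t)) has_vector_derivative
       (\<Sum>i<n. \<Sum>j<n. c i j * D i j + e i j * cnj (D i j))) (at 0)"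
    using assms(1) unfolding differentiable_at_one_def by blast
  show ?thesis
  proof (rule differentiable_at_oneI)
    fix \<gamma> D assume \<gamma>: "group_curve n \<gamma> D"
    then have "(\<lambda>t. G (\<gamma> t)) = (\<lambda>t. F (\<gamma> t))"
      using assms(2) unfolding group_curve_def by auto
    then show "((\<lambda>t. G (\<gamma> t)) has_vector_derivative
       (\<Sum>i<n. \<Sum>j<n. c i j * D i j + e i j * cnj (D i j))) (at 0)"
      using F[rule_format, OF \<gamma>] by simp
  qed
qed

text \<open>
  All generators except the inverse determinant are immediate; the determinant is a polynomial in
  the entries with value \<open>1\<close> at the identity.
\<close>
lemma differentiable_at_one_regular:
  assumes "p \<in> regular_functions n"
  shows "differentiable_at_one n p"
  using assms
proof induction
  case inverse_det
  have "differentiable_at_one n (\<lambda>g. \<Sum>q | q permutes {0..<n}. of_int (sign q) * (\<Prod>i = 0..<n. g $$ (i, q i)))"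
    by (intro differentiable_at_one_sum differentiable_at_one_mult differentiable_at_one_const differentiable_at_one_prod differentiable_at_one_entry)
       (auto dest: permutes_lt simp: finite_permutations)
  then have "differentiable_at_one n Determinant.det"
    by (rule differentiable_at_one_cong) (simp add: det_def'[OF GL_carrier_mat])
  then show ?case by (rule differentiable_at_one_inverse) simp
qed (auto intro: differentiable_at_one_const differentiable_at_one_entry differentiable_at_one_add differentiable_at_one_mult)

section \<open>Characters of the diagonal torus\<close>

definition torus :: "nat \<Rightarrow> (nat \<Rightarrow> complex) set" where
  "torus n = {t. \<forall>i<n. t i \<noteq> 0}"

text \<open>
  Vectors of length \<open>n\<close> are functions that vanish beyond \<open>n\<close>, so that
  equality of functions is equality of weights.
\<close>
definition weight_lattice :: "nat \<Rightarrow> (nat \<Rightarrow> int) set" where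
  "weight_lattice n = {l. \<forall>i\<ge>n. l i = 0}"

definition torus_char :: "nat \<Rightarrow> (nat \<Rightarrow> int) \<Rightarrow> (nat \<Rightarrow> complex) \<Rightarrow> complex" where
  "torus_char n l t = (\<Prod>i<n. t i powi l i)"

lemma torus_char_add:
  "t \<in> torus n \<Longrightarrow> torus_char n (\<lambda>i. l i + m i) t = torus_char n l t * torus_char n m t"
  unfolding torus_char_def torus_def prod.distrib[symmetric]
  by (intro prod.cong) (auto simp: power_int_add)

lemma torus_char_mult:
  "torus_char n l (\<lambda>i. s i * t i) = torus_char n l s * torus_char n l t"
  unfolding torus_char_def prod.distrib[symmetric]
  by (intro prod.cong) (auto simp: power_int_mult_distrib)

lemma torus_char_one [simp]: "torus_char n l (\<lambda>_. 1) = 1"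
  unfolding torus_char_def by simp

lemma torus_mult: "s \<in> torus n \<Longrightarrow> t \<in> torus n \<Longrightarrow> (\<lambda>i. s i * t i) \<in> torus n"
  unfolding torus_def by auto

lemma torus_one [simp]: "(\<lambda>_. 1) \<in> torus n"
  unfolding torus_def by auto

lemma unit_circle_torus: "(\<And>i. cmod (t i) = 1) \<Longrightarrow> t \<in> torus n"
  unfolding torus_def by (intro CollectI allI impI notI) (metis norm_zero zero_neq_one)

lemma weight_lattice_eqI:
  assumes "l \<in> weight_lattice n" "m \<in> weight_lattice n" "\<And>i. i < n \<Longrightarrow> l i = m i"
  shows "l = m"
proof
  fix i show "l i = m i" using assms unfolding weight_lattice_def by (cases "i < n") auto
qed

text \<open>
  Where two weights differ in coordinate \<open>k\<close>, the angle \<open>pi / (l k - m k)\<close>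
  in that coordinate makes the two values opposite to each other.  The point is kept on the unit
  circle, so that its diagonal matrix is unitary.
\<close>
lemma torus_char_separates:
  assumes "l \<in> weight_lattice n" "m \<in> weight_lattice n" "l \<noteq> m"
  obtains t where "\<forall>i. cmod (t i) = 1" "torus_char n l t \<noteq> torus_char n m t"
proof -
  obtain k where k: "k < n" "l k \<noteq> m k" using weight_lattice_eqI[OF assms(1,2)] assms(3) by auto
  define \<theta> where "\<theta> = pi / real_of_int (l k - m k)"
  define t where "t i = (if i = k then cis \<theta> else 1)" for i
  have c: "torus_char n x t = cis (real_of_int (x k) * \<theta>)" for x
  proof -
    have "torus_char n x t = (\<Prod>i<n. if i = k then cis \<theta> powi x k else 1)"
      unfolding torus_char_def by (intro prod.cong) (auto simp: t_def)
    then show ?thesis using k by (simp add: cis_power_int)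
  qed
  have "real_of_int (l k) * \<theta> = real_of_int (m k) * \<theta> + pi"
    using k(2) unfolding \<theta>_def by (simp add: field_simps)
  then have "torus_char n l t = - torus_char n m t"
    unfolding c by (simp flip: cis_mult)
  moreover have "torus_char n m t \<noteq> 0" unfolding c by simp
  ultimately have "torus_char n l t \<noteq> torus_char n m t" by auto
  moreover have "\<forall>i. cmod (t i) = 1" unfolding t_def by simp
  ultimately show ?thesis using that by blast
qed

text \<open>
  Dedekind's argument: multiplying the relation by the value of one character at \<open>s\<close>
  and subtracting it from its translate by \<open>s\<close> removes this character.
\<close>
lemma torus_char_independent:
  assumes "finite S" "S \<subseteq> weight_lattice n"
    and "\<And>t. t \<in> torus n \<Longrightarrow> (\<Sum>l\<in>S. c l * torus_char n l t) = 0" and "l \<in> S"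
  shows "c l = 0"
  using assms
proof (induction S arbitrary: c l rule: finite_induct)
  case empty
  then show ?case by simp
next
  case (insert a S)
  have S: "c m = 0" if "m \<in> S" for m
  proof -
    have "m \<in> weight_lattice n" "a \<in> weight_lattice n" "m \<noteq> a"
      using insert.prems(1) insert.hyps(2) that by auto
    then obtain s where s: "\<forall>i. cmod (s i) = 1" "torus_char n m s \<noteq> torus_char n a s"
      by (rule torus_char_separates)
    have st: "s \<in> torus n" using unit_circle_torus s(1) by auto
    have "(\<Sum>l\<in>S. (c l * (torus_char n l s - torus_char n a s)) * torus_char n l t) = 0" if t: "t \<in> torus n" for t
    proof -
      have "(\<Sum>l\<in>insert a S. c l * torus_char n l (\<lambda>i. s i * t i))
          - torus_char n a s * (\<Sum>l\<in>insert a S. c l * torus_char n l t) = 0"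
        using insert.prems(2)[OF t] insert.prems(2)[OF torus_mult[OF st t]] by simp
      then show ?thesis using insert.hyps
        by (simp add: torus_char_mult sum_distrib_left algebra_simps sum_subtractf)
    qed
    from insert.IH[OF _ this that] insert.prems(1) s(2) show ?thesis by auto
  qed
  have "c a = 0" using insert.prems(2)[OF torus_one] insert.hyps S by simp
  then show ?case using S insert.prems(3) by auto
qed

lemma det_dmat: "Determinant.det (dmat n t) = (\<Prod>i<n. t i)"
proof -
  have "Determinant.det (dmat n t) = prod_list (diag_mat (dmat n t))"
    by (intro det_upper_triangular[of _ n]) (auto simp: upper_triangular_def)
  also have "diag_mat (dmat n t) = map t [0..<n]" unfolding diag_mat_def by auto
  finally show ?thesis by (simp add: prod.list_conv_set_nth atLeast0LessThan)
qed

definition laurent_on_torus :: "nat \<Rightarrow> (complex mat \<Rightarrow> complex) \<Rightarrow> bool" where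
  "laurent_on_torus n p \<longleftrightarrow> (\<exists>S c. finite S \<and> S \<subseteq> weight_lattice n \<and>
     (\<forall>t\<in>torus n. p (dmat n t) = (\<Sum>l\<in>S. c l * torus_char n l t)))"

lemma laurent_on_torusI:
  assumes "finite S" "S \<subseteq> weight_lattice n" "\<And>t. t \<in> torus n \<Longrightarrow> p (dmat n t) = (\<Sum>l\<in>S. c l * torus_char n l t)"
  shows "laurent_on_torus n p"
  using assms unfolding laurent_on_torus_def by blast

text \<open>
  Off-diagonal entries vanish on the torus, diagonal entries and the inverse determinant are
  characters, and products of characters are characters.
\<close>
lemma laurent_on_torus_regular:
  assumes "p \<in> regular_functions n"
  shows "laurent_on_torus n p"
  using assms
proof induction
  case (const c)
  show ?case
    by (rule laurent_on_torusI[of "{\<lambda>_. 0}" _ _ "\<lambda>_. c"]) (auto simp: weight_lattice_def torus_char_def)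
next
  case (entry i j)
  show ?case
  proof (rule laurent_on_torusI[of "{\<lambda>k. if k = i then 1 else 0}" _ _ "\<lambda>_. if i = j then 1 else 0"])
    fix t assume "t \<in> torus n"
    have "torus_char n (\<lambda>k. if k = i then 1 else 0) t = (\<Prod>k<n. if k = i then t i else 1)"
      unfolding torus_char_def by (intro prod.cong) auto
    also have "\<dots> = t i" using entry by simp
    finally show "dmat n t $$ (i, j) = (\<Sum>l\<in>{\<lambda>k. if k = i then 1 else 0}. (if i = j then 1 else 0) * torus_char n l t)"
      using entry by simp
  qed (use entry in \<open>auto simp: weight_lattice_def\<close>)
next
  case inverse_det
  show ?case
  proof (rule laurent_on_torusI[of "{\<lambda>k. if k < n then -1 else 0}" _ _ "\<lambda>_. 1"])
    fix t assume "t \<in> torus n"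
    have "torus_char n (\<lambda>k. if k < n then -1 else 0) t = (\<Prod>k<n. inverse (t k))"
      unfolding torus_char_def by (intro prod.cong) (auto simp: power_int_minus)
    then show "inverse (Determinant.det (dmat n t)) = (\<Sum>l\<in>{\<lambda>k. if k < n then -1 else 0}. 1 * torus_char n l t)"
      by (simp add: det_dmat flip: prod_inversef)
  qed (auto simp: weight_lattice_def)
next
  case (add p q)
  obtain S c where 1: "finite S" "S \<subseteq> weight_lattice n"
    "\<And>t. t \<in> torus n \<Longrightarrow> p (dmat n t) = (\<Sum>l\<in>S. c l * torus_char n l t)"
    using add.IH(1) unfolding laurent_on_torus_def by blast
  obtain R e where 2: "finite R" "R \<subseteq> weight_lattice n"
    "\<And>t. t \<in> torus n \<Longrightarrow> q (dmat n t) = (\<Sum>l\<in>R. e l * torus_char n l t)"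
    using add.IH(2) unfolding laurent_on_torus_def by blast
  show ?case
  proof (rule laurent_on_torusI[of "S \<union> R" _ _ "\<lambda>l. (if l \<in> S then c l else 0) + (if l \<in> R then e l else 0)"])
    fix t assume t: "t \<in> torus n"
    have "(\<Sum>l\<in>S \<union> R. (if l \<in> S then c l else 0) * torus_char n l t) = p (dmat n t)"
      unfolding 1(3)[OF t] by (rule sum.mono_neutral_cong_right) (use 1(1) 2(1) in auto)
    moreover have "(\<Sum>l\<in>S \<union> R. (if l \<in> R then e l else 0) * torus_char n l t) = q (dmat n t)"
      unfolding 2(3)[OF t] by (rule sum.mono_neutral_cong_right) (use 1(1) 2(1) in auto)
    ultimately show "p (dmat n t) + q (dmat n t) =
       (\<Sum>l\<in>S \<union> R. ((if l \<in> S then c l else 0) + (if l \<in> R then e l else 0)) * torus_char n l t)"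
      by (simp only: distrib_right sum.distrib)
  qed (use 1 2 in auto)
next
  case (mult p q)
  obtain S c where 1: "finite S" "S \<subseteq> weight_lattice n"
    "\<And>t. t \<in> torus n \<Longrightarrow> p (dmat n t) = (\<Sum>l\<in>S. c l * torus_char n l t)"
    using mult.IH(1) unfolding laurent_on_torus_def by blast
  obtain R e where 2: "finite R" "R \<subseteq> weight_lattice n"
    "\<And>t. t \<in> torus n \<Longrightarrow> q (dmat n t) = (\<Sum>l\<in>R. e l * torus_char n l t)"
    using mult.IH(2) unfolding laurent_on_torus_def by blast
  define f :: "(nat \<Rightarrow> int) \<times> (nat \<Rightarrow> int) \<Rightarrow> nat \<Rightarrow> int" where "f = (\<lambda>(l, m) i. l i + m i)"
  show ?case
  proof (rule laurent_on_torusI[of "f ` (S \<times> R)" _ _ "\<lambda>k. \<Sum>z | z \<in> S \<times> R \<and> f z = k. c (fst z) * e (snd z)"])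
    fix t assume t: "t \<in> torus n"
    have fz: "torus_char n (f z) t = torus_char n (fst z) t * torus_char n (snd z) t" for z
      unfolding f_def case_prod_beta by (rule torus_char_add[OF t])
    have "p (dmat n t) * q (dmat n t) = (\<Sum>z\<in>S \<times> R. c (fst z) * torus_char n (fst z) t * (e (snd z) * torus_char n (snd z) t))"
      unfolding 1(3)[OF t] 2(3)[OF t] sum_product by (simp add: sum.cartesian_product case_prod_beta)
    also have "\<dots> = (\<Sum>z\<in>S \<times> R. c (fst z) * e (snd z) * torus_char n (f z) t)"
      by (simp add: fz mult_ac)
    also have "\<dots> = (\<Sum>k\<in>f ` (S \<times> R). \<Sum>z | z \<in> S \<times> R \<and> f z = k. c (fst z) * e (snd z) * torus_char n (f z) t)"
      using 1(1) 2(1) by (intro sum.image_gen) auto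
    also have "\<dots> = (\<Sum>k\<in>f ` (S \<times> R). (\<Sum>z | z \<in> S \<times> R \<and> f z = k. c (fst z) * e (snd z)) * torus_char n k t)"
      unfolding sum_distrib_right by (intro sum.cong refl) auto
    finally show "p (dmat n t) * q (dmat n t) = \<dots>" .
  qed (use 1 2 in \<open>auto simp: weight_lattice_def f_def subset_iff\<close>)
qed

section \<open>Hermitian inner products\<close>

definition vsum :: "nat \<Rightarrow> 'a set \<Rightarrow> ('a \<Rightarrow> complex Matrix.vec) \<Rightarrow> complex Matrix.vec" where
  "vsum d S X = Matrix.vec d (\<lambda>i. \<Sum>s\<in>S. X s $ i)"

lemma vsum_carrier [simp]: "vsum d S X \<in> carrier_vec d"
  and vsum_index [simp]: "i < d \<Longrightarrow> vsum d S X $ i = (\<Sum>s\<in>S. X s $ i)"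
  unfolding vsum_def by auto

lemma vsum_empty [simp]: "vsum d {} X = 0\<^sub>v d"
  by (rule eq_vecI) (auto simp: vsum_def)

lemma vsum_insert:
  assumes "finite S" "a \<notin> S" "X a \<in> carrier_vec d"
  shows "vsum d (insert a S) X = X a + vsum d S X"
  using assms by (intro eq_vecI) (auto simp: vsum_def)

lemma vsum_cong: "S = R \<Longrightarrow> (\<And>s. s \<in> R \<Longrightarrow> X s = Y s) \<Longrightarrow> vsum d S X = vsum d R Y"
  unfolding vsum_def by auto

lemma mult_mat_vsum:
  assumes A: "A \<in> carrier_mat m d" and X: "\<And>s. s \<in> S \<Longrightarrow> X s \<in> carrier_vec d"
  shows "A *\<^sub>v vsum d S X = vsum m S (\<lambda>s. A *\<^sub>v X s)"
proof (rule eq_vecI)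
  fix i assume "i < dim_vec (vsum m S (\<lambda>s. A *\<^sub>v X s))"
  then have i: "i < m" by (simp add: vsum_def)
  have "(A *\<^sub>v vsum d S X) $ i = (\<Sum>k<d. A $$ (i, k) * (\<Sum>s\<in>S. X s $ k))"
    using A i by (subst index_mult_mat_vec_sum[OF A]) auto
  also have "\<dots> = (\<Sum>s\<in>S. \<Sum>k<d. A $$ (i, k) * X s $ k)"
    unfolding sum_distrib_left by (rule sum.swap)
  also have "\<dots> = (\<Sum>s\<in>S. (A *\<^sub>v X s) $ i)"
    using A i X by (intro sum.cong refl) (subst index_mult_mat_vec_sum[OF A], auto)
  finally show "(A *\<^sub>v vsum d S X) $ i = vsum m S (\<lambda>s. A *\<^sub>v X s) $ i" using i by simp
qed (use A in \<open>auto simp: vsum_def\<close>)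

lemma vsum_single:
  assumes "finite S" "a \<in> S" "\<And>s. s \<in> S \<Longrightarrow> s \<noteq> a \<Longrightarrow> X s = 0\<^sub>v d" "X a \<in> carrier_vec d"
  shows "vsum d S X = X a"
proof (rule eq_vecI)
  fix i assume "i < dim_vec (X a)"
  then have i: "i < d" using assms(4) by auto
  have "(\<Sum>s\<in>S. X s $ i) = (\<Sum>s\<in>S. if s = a then X a $ i else 0)"
    using assms(3) i by (intro sum.cong refl) auto
  then show "vsum d S X $ i = X a $ i" using assms(1,2) i by simp
qed (use assms in \<open>auto simp: vsum_def\<close>)

locale hermitian_space =
  fixes d :: nat and ip :: "complex Matrix.vec \<Rightarrow> complex Matrix.vec \<Rightarrow> complex"
  assumes hermitian_ip: "hermitian_inner_product d ip"
begin

lemma ip_add_left: "x \<in> carrier_vec d \<Longrightarrow> y \<in> carrier_vec d \<Longrightarrow> z \<in> carrier_vec d \<Longrightarrow> ip (x + y) z = ip x z + ip y z"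
  using hermitian_ip unfolding hermitian_inner_product_def by blast

lemma ip_smult_left: "x \<in> carrier_vec d \<Longrightarrow> y \<in> carrier_vec d \<Longrightarrow> ip (c \<cdot>\<^sub>v x) y = c * ip x y"
  using hermitian_ip unfolding hermitian_inner_product_def by blast

lemma ip_cnj: "x \<in> carrier_vec d \<Longrightarrow> y \<in> carrier_vec d \<Longrightarrow> cnj (ip x y) = ip y x"
  using hermitian_ip unfolding hermitian_inner_product_def by metis

lemma ip_pos: "x \<in> carrier_vec d \<Longrightarrow> x \<noteq> 0\<^sub>v d \<Longrightarrow> Re (ip x x) > 0"
  using hermitian_ip unfolding hermitian_inner_product_def by blast

lemma ip_add_right:
  assumes "x \<in> carrier_vec d" "y \<in> carrier_vec d" "z \<in> carrier_vec d"
  shows "ip z (x + y) = ip z x + ip z y"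
  using ip_cnj[OF add_carrier_vec[OF assms(1,2)] assms(3), symmetric] ip_cnj[OF assms(1,3)] ip_cnj[OF assms(2,3)]
  by (simp add: ip_add_left assms)

lemma ip_smult_right:
  assumes "x \<in> carrier_vec d" "y \<in> carrier_vec d"
  shows "ip x (c \<cdot>\<^sub>v y) = cnj c * ip x y"
proof -
  have "ip x (c \<cdot>\<^sub>v y) = cnj (ip (c \<cdot>\<^sub>v y) x)" using assms by (intro ip_cnj[symmetric]) auto
  then show ?thesis using assms ip_cnj[OF assms(2,1)] by (simp add: ip_smult_left)
qed

lemma ip_zero_left [simp]: "x \<in> carrier_vec d \<Longrightarrow> ip (0\<^sub>v d) x = 0"
proof -
  assume x: "x \<in> carrier_vec d"
  have "0 \<cdot>\<^sub>v 0\<^sub>v d = (0\<^sub>v d :: complex Matrix.vec)" by (rule eq_vecI) auto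
  then show ?thesis using ip_smult_left[of "0\<^sub>v d" x 0] x by simp
qed

lemma ip_zero_right [simp]: "x \<in> carrier_vec d \<Longrightarrow> ip x (0\<^sub>v d) = 0"
  using ip_cnj[of "0\<^sub>v d" x] by simp

lemma ip_self_nonneg: "x \<in> carrier_vec d \<Longrightarrow> Re (ip x x) \<ge> 0"
  using ip_pos[of x] by (cases "x = 0\<^sub>v d") auto

lemma ip_vsum_left:
  assumes "finite S" "\<And>s. s \<in> S \<Longrightarrow> X s \<in> carrier_vec d" "y \<in> carrier_vec d"
  shows "ip (vsum d S X) y = (\<Sum>s\<in>S. ip (X s) y)"
  using assms by (induction S rule: finite_induct) (auto simp: vsum_insert ip_add_left)

lemma ip_vsum_right:
  assumes "finite S" "\<And>s. s \<in> S \<Longrightarrow> X s \<in> carrier_vec d" "y \<in> carrier_vec d"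
  shows "ip y (vsum d S X) = (\<Sum>s\<in>S. ip y (X s))"
  using assms by (induction S rule: finite_induct) (auto simp: vsum_insert ip_add_right)

lemma ip_vsum_orthogonal:
  assumes "finite S" "\<And>s. s \<in> S \<Longrightarrow> X s \<in> carrier_vec d" "\<And>s. s \<in> S \<Longrightarrow> Y s \<in> carrier_vec d"
    and "\<And>s r. s \<in> S \<Longrightarrow> r \<in> S \<Longrightarrow> s \<noteq> r \<Longrightarrow> ip (X s) (Y r) = 0"
  shows "ip (vsum d S X) (vsum d S Y) = (\<Sum>s\<in>S. ip (X s) (Y s))"
proof -
  have "ip (vsum d S X) (vsum d S Y) = (\<Sum>s\<in>S. \<Sum>r\<in>S. ip (X s) (Y r))"
    using assms(1,2,3) by (subst ip_vsum_left) (auto intro!: sum.cong simp: ip_vsum_right)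
  also have "\<dots> = (\<Sum>s\<in>S. \<Sum>r\<in>S. if r = s then ip (X s) (Y s) else 0)"
    using assms(4) by (intro sum.cong refl) auto
  finally show ?thesis using assms(1) by simp
qed

text \<open>
  Expanding both arguments in the standard basis makes the inner product a polynomial in coordinates
  and their conjugates.
\<close>
lemma ip_gram:
  assumes "x \<in> carrier_vec d" "y \<in> carrier_vec d"
  shows "ip x y = (\<Sum>i<d. \<Sum>j<d. x $ i * cnj (y $ j) * ip (unit_vec d i) (unit_vec d j))"
proof -
  have e: "z = vsum d {..<d} (\<lambda>i. z $ i \<cdot>\<^sub>v unit_vec d i)" if "z \<in> carrier_vec d" for z :: "complex Matrix.vec"
  proof (rule eq_vecI)
    fix i assume "i < dim_vec (vsum d {..<d} (\<lambda>i. z $ i \<cdot>\<^sub>v unit_vec d i))"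
    then have i: "i < d" by (simp add: vsum_def)
    have "(\<Sum>s<d. (z $ s \<cdot>\<^sub>v unit_vec d s) $ i) = (\<Sum>s<d. if s = i then z $ i else 0)"
      using i by (intro sum.cong) (auto simp: unit_vec_def)
    then show "z $ i = vsum d {..<d} (\<lambda>i. z $ i \<cdot>\<^sub>v unit_vec d i) $ i" using i by simp
  qed (use that in \<open>auto simp: vsum_def\<close>)
  have "ip x y = ip (vsum d {..<d} (\<lambda>i. x $ i \<cdot>\<^sub>v unit_vec d i)) (vsum d {..<d} (\<lambda>i. y $ i \<cdot>\<^sub>v unit_vec d i))"
    using e[OF assms(1)] e[OF assms(2)] by simp
  also have "\<dots> = (\<Sum>i<d. \<Sum>j<d. ip (x $ i \<cdot>\<^sub>v unit_vec d i) (y $ j \<cdot>\<^sub>v unit_vec d j))"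
    by (subst ip_vsum_left) (auto intro!: sum.cong simp: ip_vsum_right)
  finally show ?thesis by (simp add: ip_smult_left ip_smult_right mult_ac)
qed

end

section \<open>Weight spaces of a unitary representation\<close>

locale unitary_rep = hermitian_space d ip for d ip +
  fixes n :: nat and \<pi> :: "complex mat \<Rightarrow> complex mat"
  assumes rational: "rational_representation n d \<pi>" and unitary: "unitary_invariant n d \<pi> ip"
begin

lemma rep_hom: "\<pi> \<in> hom (GL n) (GL d)"
  using rational unfolding rational_representation_def by auto

lemma rep_carrier [simp]: "g \<in> carrier (GL n) \<Longrightarrow> \<pi> g \<in> carrier_mat d d"
  using rep_hom GL_carrier_mat unfolding hom_def by auto

lemma rep_dim [simp]: "g \<in> carrier (GL n) \<Longrightarrow> dim_row (\<pi> g) = d" "g \<in> carrier (GL n) \<Longrightarrow> dim_col (\<pi> g) = d"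
  using rep_carrier[of g] by (auto simp del: rep_carrier)

lemma rep_vec_carrier [simp]: "g \<in> carrier (GL n) \<Longrightarrow> x \<in> carrier_vec d \<Longrightarrow> \<pi> g *\<^sub>v x \<in> carrier_vec d"
  using rep_carrier by (rule mult_mat_vec_carrier)

lemma rep_mult: "g \<in> carrier (GL n) \<Longrightarrow> h \<in> carrier (GL n) \<Longrightarrow> \<pi> (g * h) = \<pi> g * \<pi> h"
  using hom_mult[OF rep_hom, of g h] by (simp add: GL_mult_mat)

lemma rep_one [simp]: "\<pi> (1\<^sub>m n) = 1\<^sub>m d"
  using hom_one[OF rep_hom group_GL group_GL] by (simp add: GL_one_mat)

lemma rep_mult_vec:
  "g \<in> carrier (GL n) \<Longrightarrow> h \<in> carrier (GL n) \<Longrightarrow> x \<in> carrier_vec d \<Longrightarrow> \<pi> (g * h) *\<^sub>v x = \<pi> g *\<^sub>v (\<pi> h *\<^sub>v x)"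
  by (simp add: rep_mult assoc_mult_mat_vec[of _ d d _ d])

lemma rep_entry_regular:
  assumes "i < d" "j < d"
  obtains p where "p \<in> regular_functions n" "\<forall>g\<in>carrier (GL n). \<pi> g $$ (i, j) = p g"
  using rational assms unfolding rational_representation_def by blast

lemma ip_unitary:
  "u \<in> unitary_mats n \<Longrightarrow> x \<in> carrier_vec d \<Longrightarrow> y \<in> carrier_vec d \<Longrightarrow> ip (\<pi> u *\<^sub>v x) (\<pi> u *\<^sub>v y) = ip x y"
  using unitary unfolding unitary_invariant_def by auto

lemma torus_GL: "t \<in> torus n \<Longrightarrow> dmat n t \<in> carrier (GL n)"
  by (intro dmat_GL) (auto simp: torus_def)

definition weight_space :: "(nat \<Rightarrow> int) \<Rightarrow> complex Matrix.vec set" where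
  "weight_space l = {x \<in> carrier_vec d. \<forall>t\<in>torus n. \<pi> (dmat n t) *\<^sub>v x = torus_char n l t \<cdot>\<^sub>v x}"

definition weights :: "(nat \<Rightarrow> int) set" where
  "weights = {l \<in> weight_lattice n. \<exists>x\<in>weight_space l. x \<noteq> 0\<^sub>v d}"

lemma weight_space_carrier: "x \<in> weight_space l \<Longrightarrow> x \<in> carrier_vec d"
  unfolding weight_space_def by auto

lemma weight_spaceD: "x \<in> weight_space l \<Longrightarrow> t \<in> torus n \<Longrightarrow> \<pi> (dmat n t) *\<^sub>v x = torus_char n l t \<cdot>\<^sub>v x"
  unfolding weight_space_def by auto

text \<open>
  A unitary torus element preserves the inner product of the two vectors and also multiplies it by a
  number other than \<open>1\<close>.
\<close>
lemma weight_space_orthogonal: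
  assumes "x \<in> weight_space l" "y \<in> weight_space m" "l \<in> weight_lattice n" "m \<in> weight_lattice n" "l \<noteq> m"
  shows "ip x y = 0"
proof -
  from assms(3-5) obtain t where t: "\<forall>i. cmod (t i) = 1" "torus_char n l t \<noteq> torus_char n m t"
    by (rule torus_char_separates)
  have tt: "t \<in> torus n" using unit_circle_torus t(1) by auto
  have c: "x \<in> carrier_vec d" "y \<in> carrier_vec d" using assms weight_space_carrier by auto
  have "cmod (torus_char n m t) = 1"
    unfolding torus_char_def using t(1) by (simp add: prod_norm[symmetric] norm_power_int)
  then have m: "torus_char n m t * cnj (torus_char n m t) = 1"
    using complex_norm_square[of "torus_char n m t"] by simp
  have "ip x y = ip (\<pi> (dmat n t) *\<^sub>v x) (\<pi> (dmat n t) *\<^sub>v y)"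
    using c t(1) by (intro ip_unitary[symmetric] dmat_unitary) auto
  also have "\<dots> = torus_char n l t * cnj (torus_char n m t) * ip x y"
    using weight_spaceD[OF assms(1) tt] weight_spaceD[OF assms(2) tt] c
    by (simp add: ip_smult_left ip_smult_right)
  finally have "ip x y = 0 \<or> torus_char n l t * cnj (torus_char n m t) = 1" by auto
  moreover have "torus_char n l t * cnj (torus_char n m t) \<noteq> 1"
  proof
    assume a: "torus_char n l t * cnj (torus_char n m t) = 1"
    have "torus_char n l t = torus_char n l t * (torus_char n m t * cnj (torus_char n m t))"
      unfolding m by simp
    also have "\<dots> = torus_char n l t * cnj (torus_char n m t) * torus_char n m t" by (simp only: mult_ac)
    also have "\<dots> = torus_char n m t" unfolding a by simp
    finally show False using t(2) by simp
  qed
  ultimately show ?thesis by auto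
qed

text \<open>
  The coefficient matrices of the Laurent expansions of all matrix coefficients; they turn out to be
  the projections onto the weight spaces.
\<close>
lemma torus_expansion:
  obtains L P where "finite L" "L \<subseteq> weight_lattice n" "\<forall>l\<in>L. P l \<in> carrier_mat d d"
    "\<forall>t\<in>torus n. \<forall>i<d. \<forall>j<d. \<pi> (dmat n t) $$ (i, j) = (\<Sum>l\<in>L. P l $$ (i, j) * torus_char n l t)"
proof -
  define Q where "Q i j S c \<longleftrightarrow> finite S \<and> S \<subseteq> weight_lattice n \<and>
     (\<forall>t\<in>torus n. \<pi> (dmat n t) $$ (i, j) = (\<Sum>l\<in>S. c l * torus_char n l t))" for i j S c
  have "\<exists>S c. Q i j S c" if "i < d" "j < d" for i j
  proof -
    obtain p where p: "p \<in> regular_functions n" "\<forall>g\<in>carrier (GL n). \<pi> g $$ (i, j) = p g"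
      using \<open>i < d\<close> \<open>j < d\<close> by (rule rep_entry_regular)
    obtain S c where "finite S" "S \<subseteq> weight_lattice n"
      "\<forall>t\<in>torus n. p (dmat n t) = (\<Sum>l\<in>S. c l * torus_char n l t)"
      using laurent_on_torus_regular[OF p(1)] unfolding laurent_on_torus_def by blast
    then have "Q i j S c" unfolding Q_def using p(2) torus_GL by simp
    then show ?thesis by blast
  qed
  then obtain S c where Q: "\<And>i j. i < d \<Longrightarrow> j < d \<Longrightarrow> Q i j (S i j) (c i j)" by metis
  have S: "finite (S i j)" "S i j \<subseteq> weight_lattice n"
     "\<forall>t\<in>torus n. \<pi> (dmat n t) $$ (i, j) = (\<Sum>l\<in>S i j. c i j l * torus_char n l t)"
    if "i < d" "j < d" for i j using Q[OF that] unfolding Q_def by auto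
  define L where "L = (\<Union>i<d. \<Union>j<d. S i j)"
  define P where "P l = Matrix.mat d d (\<lambda>(i, j). if l \<in> S i j then c i j l else 0)" for l
  have L: "finite L" "L \<subseteq> weight_lattice n" unfolding L_def using S(1,2) by (simp, blast)
  have "\<pi> (dmat n t) $$ (i, j) = (\<Sum>l\<in>L. P l $$ (i, j) * torus_char n l t)"
    if "t \<in> torus n" "i < d" "j < d" for t i j
    unfolding S(3)[OF that(2,3), rule_format, OF that(1)]
    by (rule sum.mono_neutral_cong_left) (use L S that in \<open>auto simp: P_def L_def\<close>)
  then show ?thesis using that[of L P] L by (auto simp: P_def)
qed

definition weight_projections :: "((nat \<Rightarrow> int) \<Rightarrow> complex mat) \<Rightarrow> bool" where
  "weight_projections P \<longleftrightarrow> finite weights \<and> (\<forall>l\<in>weights. P l \<in> carrier_mat d d) \<and>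
     (\<forall>l\<in>weights. \<forall>x\<in>carrier_vec d. P l *\<^sub>v x \<in> weight_space l) \<and>
     (\<forall>x\<in>carrier_vec d. x = vsum d weights (\<lambda>l. P l *\<^sub>v x))"

text \<open>
  Comparing coefficients of the characters of \<open>s\<close> in \<open>\<pi> t * \<pi> s = \<pi>
  (t * s)\<close> shows that the columns of each coefficient matrix are weight vectors, and at
  \<open>s = 1\<close> these matrices add up to the identity.  Orthogonality of weight spaces shows
  that no weight is missed.
\<close>
lemma weight_projections_exist: "\<exists>P. weight_projections P"
proof -
  obtain L P where L: "finite L" "L \<subseteq> weight_lattice n" and P: "\<forall>l\<in>L. P l \<in> carrier_mat d d"
    and exp: "\<forall>t\<in>torus n. \<forall>i<d. \<forall>j<d. \<pi> (dmat n t) $$ (i, j) = (\<Sum>l\<in>L. P l $$ (i, j) * torus_char n l t)"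
    by (rule torus_expansion)
  have eig: "(\<pi> (dmat n t) * P l) $$ (i, j) = torus_char n l t * P l $$ (i, j)"
    if t: "t \<in> torus n" and l: "l \<in> L" and i: "i < d" and j: "j < d" for t l i j
  proof -
    \<comment> \<open>The coefficient of the character \<open>l\<close> of \<open>s\<close> in the entry of \<open>\<pi> t * \<pi> s - \<pi> (t * s)\<close>.\<close>
    define c where "c l = (\<Sum>k<d. \<pi> (dmat n t) $$ (i, k) * P l $$ (k, j)) - torus_char n l t * P l $$ (i, j)" for l
    have "(\<Sum>l\<in>L. c l * torus_char n l s) = 0" if s: "s \<in> torus n" for s
    proof -
      have "(\<Sum>l\<in>L. c l * torus_char n l s)
         = (\<Sum>l\<in>L. (\<Sum>k<d. \<pi> (dmat n t) $$ (i, k) * (P l $$ (k, j) * torus_char n l s)))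
           - (\<Sum>l\<in>L. P l $$ (i, j) * torus_char n l (\<lambda>i. t i * s i))"
        by (simp add: c_def torus_char_mult left_diff_distrib right_diff_distrib sum_subtractf
            sum_distrib_left sum_distrib_right mult_ac)
      also have "(\<Sum>l\<in>L. (\<Sum>k<d. \<pi> (dmat n t) $$ (i, k) * (P l $$ (k, j) * torus_char n l s)))
         = (\<Sum>k<d. \<pi> (dmat n t) $$ (i, k) * \<pi> (dmat n s) $$ (k, j))"
        using exp s j by (subst sum.swap) (simp add: sum_distrib_left)
      also have "\<dots> = (\<pi> (dmat n t) * \<pi> (dmat n s)) $$ (i, j)"
        using i j torus_GL s t by (intro index_mult_mat_sum[symmetric]) auto
      also have "\<pi> (dmat n t) * \<pi> (dmat n s) = \<pi> (dmat n (\<lambda>i. t i * s i))"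
        using torus_GL[OF t] torus_GL[OF s] by (simp add: dmat_mult flip: rep_mult)
      also have "\<pi> (dmat n (\<lambda>i. t i * s i)) $$ (i, j) = (\<Sum>l\<in>L. P l $$ (i, j) * torus_char n l (\<lambda>i. t i * s i))"
        using exp torus_mult[OF t s] i j by simp
      finally show ?thesis by simp
    qed
    from torus_char_independent[OF L this l] have "c l = 0" by blast
    moreover have "(\<pi> (dmat n t) * P l) $$ (i, j) = (\<Sum>k<d. \<pi> (dmat n t) $$ (i, k) * P l $$ (k, j))"
      using i j torus_GL[OF t] P l by (intro index_mult_mat_sum) auto
    ultimately show ?thesis unfolding c_def by simp
  qed
  have eigv: "P l *\<^sub>v x \<in> weight_space l" if l: "l \<in> L" and x: "x \<in> carrier_vec d" for l x
    unfolding weight_space_def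
  proof (intro CollectI conjI ballI)
    show "P l *\<^sub>v x \<in> carrier_vec d" using P l x by (auto intro!: mult_mat_vec_carrier)
    fix t assume t: "t \<in> torus n"
    have Pl: "P l \<in> carrier_mat d d" using P l by auto
    have "\<pi> (dmat n t) * P l = torus_char n l t \<cdot>\<^sub>m P l"
      using eig[OF t l] Pl torus_GL[OF t] by (intro eq_matI) auto
    moreover have "\<pi> (dmat n t) *\<^sub>v (P l *\<^sub>v x) = (\<pi> (dmat n t) * P l) *\<^sub>v x"
      using Pl x torus_GL[OF t] by (simp add: assoc_mult_mat_vec[of _ d d _ d])
    moreover have "(torus_char n l t \<cdot>\<^sub>m P l) *\<^sub>v x = torus_char n l t \<cdot>\<^sub>v (P l *\<^sub>v x)"
      using Pl x by (intro eq_vecI) (auto simp: scalar_prod_def sum_distrib_left mult.assoc)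
    ultimately show "\<pi> (dmat n t) *\<^sub>v (P l *\<^sub>v x) = torus_char n l t \<cdot>\<^sub>v (P l *\<^sub>v x)" by simp
  qed
  have sumL: "x = vsum d L (\<lambda>l. P l *\<^sub>v x)" if x: "x \<in> carrier_vec d" for x
  proof (rule eq_vecI)
    fix i assume "i < dim_vec (vsum d L (\<lambda>l. P l *\<^sub>v x))"
    then have i: "i < d" by (simp add: vsum_def)
    have "x $ i = (\<pi> (dmat n (\<lambda>_. 1)) *\<^sub>v x) $ i" using x by (simp add: dmat_one)
    also have "\<dots> = (\<Sum>j<d. \<pi> (dmat n (\<lambda>_. 1)) $$ (i, j) * x $ j)"
      using i x torus_GL[OF torus_one] by (intro index_mult_mat_vec_sum) auto
    also have "\<dots> = (\<Sum>j<d. \<Sum>l\<in>L. P l $$ (i, j) * x $ j)"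
      using exp i torus_one[of n] by (simp add: sum_distrib_right)
    also have "\<dots> = (\<Sum>l\<in>L. \<Sum>j<d. P l $$ (i, j) * x $ j)" by (rule sum.swap)
    also have "\<dots> = (\<Sum>l\<in>L. (P l *\<^sub>v x) $ i)"
      using i x P by (intro sum.cong refl index_mult_mat_vec_sum[symmetric]) auto
    finally show "x $ i = vsum d L (\<lambda>l. P l *\<^sub>v x) $ i" using i by simp
  qed (use x in \<open>auto simp: vsum_def\<close>)
  have wL: "weights \<subseteq> L"
  proof
    fix l assume "l \<in> weights"
    then obtain x where x: "l \<in> weight_lattice n" "x \<in> weight_space l" "x \<noteq> 0\<^sub>v d"
      unfolding weights_def by auto
    have xc: "x \<in> carrier_vec d" using x weight_space_carrier by auto
    show "l \<in> L"
    proof (rule ccontr)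
      assume nl: "l \<notin> L"
      have "ip x x = ip x (vsum d L (\<lambda>l. P l *\<^sub>v x))" using sumL[OF xc] by simp
      also have "\<dots> = (\<Sum>m\<in>L. ip x (P m *\<^sub>v x))"
        using L(1) xc eigv weight_space_carrier by (intro ip_vsum_right) auto
      also have "\<dots> = 0"
      proof (intro sum.neutral ballI)
        fix m assume m: "m \<in> L"
        then show "ip x (P m *\<^sub>v x) = 0"
          using nl L(2) by (intro weight_space_orthogonal[OF x(2) eigv[OF m xc] x(1)]) auto
      qed
      finally show False using ip_pos[OF xc x(3)] by simp
    qed
  qed
  have "x = vsum d weights (\<lambda>l. P l *\<^sub>v x)" if x: "x \<in> carrier_vec d" for x
  proof -
    have z: "P l *\<^sub>v x = 0\<^sub>v d" if "l \<in> L - weights" for l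
      using that eigv[of l x] x L(2) unfolding weights_def by auto
    have "vsum d L (\<lambda>l. P l *\<^sub>v x) = vsum d weights (\<lambda>l. P l *\<^sub>v x)"
      by (rule eq_vecI) (auto simp: vsum_def z intro!: sum.mono_neutral_right L(1) wL)
    then show ?thesis using sumL[OF x] by simp
  qed
  then show ?thesis using wL L(1) finite_subset P eigv unfolding weight_projections_def by (intro exI[of _ P]) auto
qed

definition weight_proj :: "(nat \<Rightarrow> int) \<Rightarrow> complex mat" where
  "weight_proj = (SOME P. weight_projections P)"

lemma weight_proj_props: "weight_projections weight_proj"
  unfolding weight_proj_def by (rule someI_ex[OF weight_projections_exist])

lemma finite_weights: "finite weights"
  using weight_proj_props unfolding weight_projections_def by blast

lemma weight_proj_carrier [simp]: "l \<in> weights \<Longrightarrow> weight_proj l \<in> carrier_mat d d"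
  using weight_proj_props unfolding weight_projections_def by blast

lemma weight_proj_dim [simp]: "l \<in> weights \<Longrightarrow> dim_row (weight_proj l) = d" "l \<in> weights \<Longrightarrow> dim_col (weight_proj l) = d"
  using weight_proj_carrier[of l] by (auto simp del: weight_proj_carrier)

lemma weight_proj_in: "l \<in> weights \<Longrightarrow> x \<in> carrier_vec d \<Longrightarrow> weight_proj l *\<^sub>v x \<in> weight_space l"
  using weight_proj_props unfolding weight_projections_def by blast

lemma weight_proj_vec_carrier [simp]: "l \<in> weights \<Longrightarrow> x \<in> carrier_vec d \<Longrightarrow> weight_proj l *\<^sub>v x \<in> carrier_vec d"
  using weight_proj_in weight_space_carrier by blast

lemma weight_decomposition: "x \<in> carrier_vec d \<Longrightarrow> x = vsum d weights (\<lambda>l. weight_proj l *\<^sub>v x)"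
  using weight_proj_props unfolding weight_projections_def by blast

lemma weights_lattice: "l \<in> weights \<Longrightarrow> l \<in> weight_lattice n"
  unfolding weights_def by auto

text \<open>
  Only the component of \<open>y\<close> of the same weight contributes, as different weight spaces
  are orthogonal.
\<close>
lemma ip_weight_proj:
  assumes "l \<in> weights" "x \<in> weight_space l" "y \<in> carrier_vec d"
  shows "ip x y = ip x (weight_proj l *\<^sub>v y)"
proof -
  have x: "x \<in> carrier_vec d" using assms(2) by (rule weight_space_carrier)
  have "ip x y = ip x (vsum d weights (\<lambda>l. weight_proj l *\<^sub>v y))"
    using weight_decomposition[OF assms(3)] by simp
  also have "\<dots> = (\<Sum>m\<in>weights. ip x (weight_proj m *\<^sub>v y))"
    using x assms(3) finite_weights by (intro ip_vsum_right) auto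
  also have "\<dots> = (\<Sum>m\<in>weights. if m = l then ip x (weight_proj l *\<^sub>v y) else 0)"
    using assms weights_lattice
    by (intro sum.cong refl) (auto intro!: weight_space_orthogonal[of x l] weight_proj_in)
  finally show ?thesis using assms(1) finite_weights by simp
qed

lemma weight_proj_other:
  assumes "l \<in> weights" "x \<in> weight_space m" "m \<in> weight_lattice n" "l \<noteq> m"
  shows "weight_proj l *\<^sub>v x = 0\<^sub>v d"
proof -
  have x: "x \<in> carrier_vec d" using assms(2) by (rule weight_space_carrier)
  have "ip (weight_proj l *\<^sub>v x) (weight_proj l *\<^sub>v x) = ip (weight_proj l *\<^sub>v x) x"
    using assms(1) x by (intro ip_weight_proj[symmetric] weight_proj_in) auto
  also have "\<dots> = 0"
    using assms weights_lattice x by (intro weight_space_orthogonal[of _ l _ m] weight_proj_in) auto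
  finally show ?thesis using ip_pos[of "weight_proj l *\<^sub>v x"] assms(1) x by auto
qed

lemma weight_space_if_proj_zero:
  assumes "x \<in> carrier_vec d" "l \<in> weights" "\<And>m. m \<in> weights \<Longrightarrow> m \<noteq> l \<Longrightarrow> weight_proj m *\<^sub>v x = 0\<^sub>v d"
  shows "x = weight_proj l *\<^sub>v x"
  using weight_decomposition[OF assms(1)] vsum_single[OF finite_weights assms(2), of "\<lambda>m. weight_proj m *\<^sub>v x"] assms
  by auto

lemma torus_act:
  assumes "t \<in> torus n" "x \<in> carrier_vec d"
  shows "\<pi> (dmat n t) *\<^sub>v x = vsum d weights (\<lambda>l. torus_char n l t \<cdot>\<^sub>v (weight_proj l *\<^sub>v x))"
proof -
  have "\<pi> (dmat n t) *\<^sub>v x = \<pi> (dmat n t) *\<^sub>v vsum d weights (\<lambda>l. weight_proj l *\<^sub>v x)"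
    using weight_decomposition[OF assms(2)] by simp
  also have "\<dots> = vsum d weights (\<lambda>l. \<pi> (dmat n t) *\<^sub>v (weight_proj l *\<^sub>v x))"
    using assms torus_GL by (intro mult_mat_vsum) auto
  also have "\<dots> = vsum d weights (\<lambda>l. torus_char n l t \<cdot>\<^sub>v (weight_proj l *\<^sub>v x))"
    using assms by (intro vsum_cong refl weight_spaceD weight_proj_in)
  finally show ?thesis .
qed

lemma weight_proj_torus:
  assumes "t \<in> torus n" "x \<in> carrier_vec d" "l \<in> weights"
  shows "weight_proj l *\<^sub>v (\<pi> (dmat n t) *\<^sub>v x) = torus_char n l t \<cdot>\<^sub>v (weight_proj l *\<^sub>v x)"
proof -
  have "weight_proj l *\<^sub>v (\<pi> (dmat n t) *\<^sub>v x)
     = vsum d weights (\<lambda>m. weight_proj l *\<^sub>v (torus_char n m t \<cdot>\<^sub>v (weight_proj m *\<^sub>v x)))"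
    unfolding torus_act[OF assms(1,2)] using assms by (intro mult_mat_vsum) auto
  also have "\<dots> = weight_proj l *\<^sub>v (torus_char n l t \<cdot>\<^sub>v (weight_proj l *\<^sub>v x))"
  proof (rule vsum_single)
    fix m assume m: "m \<in> weights" "m \<noteq> l"
    have "weight_proj l *\<^sub>v (weight_proj m *\<^sub>v x) = 0\<^sub>v d"
      using m assms weights_lattice by (intro weight_proj_other[of _ _ m] weight_proj_in) auto
    then show "weight_proj l *\<^sub>v (torus_char n m t \<cdot>\<^sub>v (weight_proj m *\<^sub>v x)) = 0\<^sub>v d"
      using m assms by (subst mult_mat_vec[of _ d d]) auto
  qed (use assms finite_weights in \<open>auto intro!: mult_mat_vec_carrier[of _ d d]\<close>)
  also have "\<dots> = torus_char n l t \<cdot>\<^sub>v (weight_proj l *\<^sub>v (weight_proj l *\<^sub>v x))"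
    using assms by (intro mult_mat_vec[of _ d d]) auto
  also have "weight_proj l *\<^sub>v (weight_proj l *\<^sub>v x) = weight_proj l *\<^sub>v x"
    by (rule weight_space_if_proj_zero[symmetric])
       (use assms weights_lattice in \<open>auto intro!: weight_proj_other[of _ _ l] weight_proj_in\<close>)
  finally show ?thesis .
qed

end

section \<open>Weights of maximal norm are highest weights\<close>

definition weight_pairing :: "nat \<Rightarrow> (nat \<Rightarrow> int) \<Rightarrow> (nat \<Rightarrow> int) \<Rightarrow> int" where
  "weight_pairing n l m = (\<Sum>i<n. l i * m i)"

definition swap_mat :: "nat \<Rightarrow> nat \<Rightarrow> nat \<Rightarrow> complex mat" where
  "swap_mat n i j = Matrix.mat n n (\<lambda>(a, b). if a = Transposition.transpose i j b then 1 else 0)"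

lemma swap_mat_carrier [simp]: "swap_mat n i j \<in> carrier_mat n n"
  unfolding swap_mat_def by auto

lemma transpose_less: "i < n \<Longrightarrow> j < n \<Longrightarrow> a < n \<Longrightarrow> Transposition.transpose i j a < (n::nat)"
  unfolding Transposition.transpose_def by auto

lemma swap_mat_index:
  "a < n \<Longrightarrow> b < n \<Longrightarrow> swap_mat n i j $$ (a, b) = (if b = Transposition.transpose i j a then 1 else 0)"
  unfolding swap_mat_def by auto

lemma swap_mat_unitary:
  assumes "i < n" "j < n"
  shows "swap_mat n i j \<in> unitary_mats n"
proof -
  have adj: "mat_adjoint (swap_mat n i j) = swap_mat n i j"
    by (rule eq_matI) (auto simp: swap_mat_index swap_mat_def)
  have "swap_mat n i j * swap_mat n i j = 1\<^sub>m n"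
  proof (rule eq_matI)
    fix a b assume "a < dim_row (1\<^sub>m n :: complex mat)" "b < dim_col (1\<^sub>m n :: complex mat)"
    then have ab: "a < n" "b < n" by auto
    have "(swap_mat n i j * swap_mat n i j) $$ (a, b) = (\<Sum>c<n. swap_mat n i j $$ (a, c) * swap_mat n i j $$ (c, b))"
      using ab by (intro index_mult_mat_sum[of _ n n]) auto
    also have "\<dots> = (\<Sum>c<n. if c = Transposition.transpose i j a then (if a = b then 1 else 0) else 0)"
      using ab by (intro sum.cong refl) (auto simp: swap_mat_index)
    finally show "(swap_mat n i j * swap_mat n i j) $$ (a, b) = (1\<^sub>m n) $$ (a, b)"
      using ab transpose_less[OF assms ab(1)] by simp
  qed (auto simp: swap_mat_def)
  then show ?thesis unfolding unitary_mats_def using adj by auto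
qed

lemma dmat_swap_mat:
  assumes "i < n" "j < n"
  shows "dmat n t * swap_mat n i j = swap_mat n i j * dmat n (\<lambda>a. t (Transposition.transpose i j a))"
proof (rule eq_matI)
  fix a b assume "a < dim_row (swap_mat n i j * dmat n (\<lambda>a. t (Transposition.transpose i j a)))"
    "b < dim_col (swap_mat n i j * dmat n (\<lambda>a. t (Transposition.transpose i j a)))"
  then have ab: "a < n" "b < n" by (auto simp: swap_mat_def)
  show "(dmat n t * swap_mat n i j) $$ (a, b)
      = (swap_mat n i j * dmat n (\<lambda>a. t (Transposition.transpose i j a))) $$ (a, b)"
    unfolding dmat_mult_left_index[OF swap_mat_carrier ab] dmat_mult_right_index[OF swap_mat_carrier ab]
    using ab by (simp add: swap_mat_index)
qed (auto simp: swap_mat_def)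

lemma bij_betw_transpose_less:
  "i < n \<Longrightarrow> j < n \<Longrightarrow> bij_betw (Transposition.transpose i j) {..<n} {..<n::nat}"
  by (rule bij_betwI[of _ _ _ "Transposition.transpose i j"]) (auto simp: transpose_less)

lemma torus_char_swap:
  assumes "i < n" "j < n"
  shows "torus_char n l (\<lambda>a. t (Transposition.transpose i j a)) = torus_char n (\<lambda>a. l (Transposition.transpose i j a)) t"
  unfolding torus_char_def
  by (subst prod.reindex_bij_betw[OF bij_betw_transpose_less[OF assms], symmetric]) simp

text \<open>
  Conjugation by a transposition matrix permutes the diagonal entries of torus elements, so that
  this matrix maps weight spaces to weight spaces.
\<close>
lemma (in unitary_rep) weights_swap:
  assumes l: "l \<in> weights" and ij: "i < n" "j < n"
  shows "(\<lambda>a. l (Transposition.transpose i j a)) \<in> weights"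
proof -
  let ?s = "swap_mat n i j"
  obtain x where x: "x \<in> weight_space l" "x \<noteq> 0\<^sub>v d" using l unfolding weights_def by auto
  have xc: "x \<in> carrier_vec d" using x weight_space_carrier by auto
  have s: "?s \<in> unitary_mats n" using ij by (rule swap_mat_unitary)
  then have sG: "?s \<in> carrier (GL n)" using unitary_matsD by auto
  have "\<pi> ?s *\<^sub>v x \<in> weight_space (\<lambda>a. l (Transposition.transpose i j a))"
    unfolding weight_space_def
  proof (intro CollectI conjI ballI)
    fix t assume t: "t \<in> torus n"
    let ?t = "\<lambda>a. t (Transposition.transpose i j a)"
    have t': "?t \<in> torus n" using t transpose_less[OF ij] unfolding torus_def by auto
    have "\<pi> (dmat n t) *\<^sub>v (\<pi> ?s *\<^sub>v x) = \<pi> (dmat n t * ?s) *\<^sub>v x"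
      using torus_GL[OF t] sG xc by (simp add: rep_mult_vec)
    also have "\<dots> = \<pi> ?s *\<^sub>v (\<pi> (dmat n ?t) *\<^sub>v x)"
      unfolding dmat_swap_mat[OF ij] using torus_GL[OF t'] sG xc by (simp add: rep_mult_vec)
    also have "\<dots> = torus_char n l ?t \<cdot>\<^sub>v (\<pi> ?s *\<^sub>v x)"
      unfolding weight_spaceD[OF x(1) t'] using sG xc by (intro mult_mat_vec[of _ d d]) auto
    finally show "\<pi> (dmat n t) *\<^sub>v (\<pi> ?s *\<^sub>v x)
        = torus_char n (\<lambda>a. l (Transposition.transpose i j a)) t \<cdot>\<^sub>v (\<pi> ?s *\<^sub>v x)"
      unfolding torus_char_swap[OF ij] .
  qed (use sG xc in auto)
  moreover have "\<pi> ?s *\<^sub>v x \<noteq> 0\<^sub>v d"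
    using ip_unitary[OF s xc xc] ip_pos[OF xc x(2)] by auto
  moreover have "(\<lambda>a. l (Transposition.transpose i j a)) \<in> weight_lattice n"
    using weights_lattice[OF l] ij unfolding weight_lattice_def Transposition.transpose_def by auto
  ultimately show ?thesis unfolding weights_def by auto
qed

text \<open>
  This is positivity of the squared norm of \<open>l - m\<close>.
\<close>
lemma weight_pairing_diff:
  assumes "l \<in> weight_lattice n" "m \<in> weight_lattice n" "l \<noteq> m"
  shows "2 * weight_pairing n m l < weight_pairing n m m + weight_pairing n l l"
proof -
  obtain k where k: "k < n" "l k \<noteq> m k" using weight_lattice_eqI[OF assms(1,2)] assms(3) by auto
  have "0 < (\<Sum>i<n. (l i - m i)\<^sup>2)"
    by (rule sum_pos2[of _ k]) (use k in auto)
  also have "\<dots> = weight_pairing n m m + weight_pairing n l l - 2 * weight_pairing n m l"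
    unfolding weight_pairing_def
    by (simp add: power2_diff power2_eq_square sum.distrib sum_subtractf sum_distrib_left algebra_simps)
  finally show ?thesis by simp
qed

lemma weight_pairing_swap:
  assumes "i < n" "j < n"
  shows "weight_pairing n (\<lambda>a. l (Transposition.transpose i j a)) (\<lambda>a. l (Transposition.transpose i j a))
       = weight_pairing n l l"
  unfolding weight_pairing_def
  by (rule sum.reindex_bij_betw[OF bij_betw_transpose_less[OF assms], of "\<lambda>a. l a * l a"])

text \<open>
  Half the sum of the positive roots, shifted by a multiple of \<open>(1, \<dots>, 1)\<close> to
  have integer entries.
\<close>
definition rho :: "nat \<Rightarrow> nat \<Rightarrow> int" where
  "rho n i = int n - int i"

lemma rho_pairing_swap:
  assumes "i < j" "j < n"
  shows "weight_pairing n (\<lambda>a. l (Transposition.transpose i j a)) (rho n)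
       = weight_pairing n l (rho n) + (int j - int i) * (l j - l i)"
proof -
  have "weight_pairing n (\<lambda>a. l (Transposition.transpose i j a)) (rho n) - weight_pairing n l (rho n)
      = (\<Sum>a<n. (l (Transposition.transpose i j a) - l a) * rho n a)"
    unfolding weight_pairing_def by (simp add: left_diff_distrib sum_subtractf)
  also have "\<dots> = (\<Sum>a\<in>{i, j}. (l (Transposition.transpose i j a) - l a) * rho n a)"
    using assms by (intro sum.mono_neutral_right) (auto simp: Transposition.transpose_def)
  also have "\<dots> = (int j - int i) * (l j - l i)"
    using assms by (simp add: rho_def algebra_simps)
  finally show ?thesis by simp
qed

lemma power_int_sum:
  "finite A \<Longrightarrow> s \<noteq> 0 \<Longrightarrow> (\<Prod>i\<in>A. s powi f i) = (s :: complex) powi (\<Sum>i\<in>A. f i)"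
  by (induction A rule: finite_induct) (auto simp: power_int_add)

lemma cocharacter_char:
  "s \<noteq> 0 \<Longrightarrow> torus_char n l (\<lambda>i. s powi \<kappa> i) = s powi weight_pairing n l \<kappa>"
  unfolding torus_char_def weight_pairing_def
  by (simp add: power_int_mult[symmetric] power_int_sum mult.commute)

context unitary_rep
begin

lemma weights_nonempty:
  fixes x :: "complex Matrix.vec"
  assumes "x \<in> carrier_vec d" "x \<noteq> 0\<^sub>v d"
  shows "weights \<noteq> {}"
proof
  assume "weights = {}"
  then have "x = 0\<^sub>v d" using weight_decomposition[OF assms(1)] by simp
  then show False using assms(2) by simp
qed

definition top_weight :: "(nat \<Rightarrow> int) \<Rightarrow> bool" where
  "top_weight l \<longleftrightarrow> l \<in> weights \<and> (\<forall>m\<in>weights. weight_pairing n m m \<le> weight_pairing n l l) \<and>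
     (\<forall>i j. i < j \<longrightarrow> j < n \<longrightarrow> l j \<le> l i)"

text \<open>
  Among the weights of maximal norm take one with the largest pairing with \<open>rho\<close>: were
  it not dominant, exchanging two entries in the wrong order would increase this pairing.
\<close>
lemma top_weight_exists:
  assumes "weights \<noteq> {}"
  obtains l where "top_weight l"
proof -
  define M where "M = Max ((\<lambda>m. weight_pairing n m m) ` weights)"
  have M: "weight_pairing n m m \<le> M" if "m \<in> weights" for m
    unfolding M_def using that finite_weights by auto
  define W where "W = {l \<in> weights. weight_pairing n l l = M}"
  have "M \<in> (\<lambda>m. weight_pairing n m m) ` weights"
    unfolding M_def using finite_weights assms by (intro Max_in) auto
  then have W: "finite W" "W \<noteq> {}" unfolding W_def using finite_weights by auto
  define R where "R = Max ((\<lambda>m. weight_pairing n m (rho n)) ` W)"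
  have "R \<in> (\<lambda>m. weight_pairing n m (rho n)) ` W" unfolding R_def using W by (intro Max_in) auto
  then obtain l where l: "l \<in> W" "weight_pairing n l (rho n) = R" by auto
  have R: "weight_pairing n m (rho n) \<le> R" if "m \<in> W" for m
    unfolding R_def using that W by auto
  have "l j \<le> l i" if ij: "i < j" "j < n" for i j
  proof (rule ccontr)
    assume "\<not> l j \<le> l i"
    moreover define m where "m a = l (Transposition.transpose i j a)" for a
    have "m \<in> W"
      using l(1) weights_swap[of l i j] weight_pairing_swap[of i n j l] ij unfolding W_def m_def by auto
    then have "weight_pairing n m (rho n) \<le> weight_pairing n l (rho n)" using R l by auto
    then have "(int j - int i) * (l j - l i) \<le> 0" using rho_pairing_swap[OF ij, of l] unfolding m_def by simp
    ultimately show False using ij by (simp add: mult_le_0_iff)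
  qed
  then have "top_weight l" unfolding top_weight_def using l M unfolding W_def by auto
  then show ?thesis by (rule that)
qed

text \<open>
  The pairing with \<open>l\<close> itself is strictly larger at \<open>l\<close> than at any other
  weight, since no weight has larger norm.  A large multiple of \<open>l\<close> keeps this property
  after adding \<open>rho\<close>, which makes the sum strictly dominant.
\<close>
lemma top_weight_cocharacter:
  assumes "top_weight l"
  obtains \<kappa> where "\<forall>i j. i < j \<longrightarrow> j < n \<longrightarrow> \<kappa> j < \<kappa> i"
    "\<forall>m\<in>weights. m \<noteq> l \<longrightarrow> weight_pairing n m \<kappa> < weight_pairing n l \<kappa>"
proof -
  define e where "e m = weight_pairing n m (rho n) - weight_pairing n l (rho n)" for m
  \<comment> \<open>The pairings with \<open>l\<close> are integers, so \<open>r\<close> times a difference of them is at least \<open>r\<close>.\<close>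
  define r where "r = 1 + (\<Sum>m\<in>weights. \<bar>e m\<bar>)"
  have r0: "r \<ge> 1" unfolding r_def by (simp add: sum_nonneg)
  define \<kappa> where "\<kappa> i = r * l i + rho n i" for i
  have p: "weight_pairing n m \<kappa> = r * weight_pairing n m l + weight_pairing n m (rho n)" for m
    unfolding weight_pairing_def \<kappa>_def by (simp add: sum_distrib_left sum.distrib algebra_simps)
  show ?thesis
  proof (rule that[of \<kappa>]; intro allI ballI impI)
    fix i j assume "i < j" "j < n"
    then have "l j \<le> l i" "rho n j < rho n i" using assms unfolding top_weight_def rho_def by auto
    then show "\<kappa> j < \<kappa> i" unfolding \<kappa>_def using r0
      by (intro add_le_less_mono mult_left_mono) auto
  next
    fix m assume m: "m \<in> weights" "m \<noteq> l"
    have l: "l \<in> weights" "weight_pairing n m m \<le> weight_pairing n l l"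
      using assms m unfolding top_weight_def by auto
    have "weight_pairing n m l + 1 \<le> weight_pairing n l l"
      using weight_pairing_diff[of l n m] weights_lattice m l by auto
    then have "r * (weight_pairing n m l + 1) \<le> r * weight_pairing n l l"
      using r0 by (intro mult_left_mono) auto
    moreover have "\<bar>e m\<bar> \<le> (\<Sum>m\<in>weights. \<bar>e m\<bar>)"
      using m finite_weights by (intro member_le_sum) auto
    then have "e m < r" unfolding r_def by simp
    ultimately show "weight_pairing n m \<kappa> < weight_pairing n l \<kappa>"
      unfolding p e_def by (simp add: algebra_simps)
  qed
qed

lemma rep_entry_tendsto:
  assumes "\<And>k. \<gamma> k \<in> carrier (GL n)" "g \<in> carrier (GL n)"
    and "\<And>i j. i < n \<Longrightarrow> j < n \<Longrightarrow> ((\<lambda>k. \<gamma> k $$ (i, j)) \<longlongrightarrow> g $$ (i, j)) F"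
    and "i < d" "j < d"
  shows "((\<lambda>k. \<pi> (\<gamma> k) $$ (i, j)) \<longlongrightarrow> \<pi> g $$ (i, j)) F"
proof -
  obtain p where p: "p \<in> regular_functions n" "\<forall>g\<in>carrier (GL n). \<pi> g $$ (i, j) = p g"
    using assms(4,5) by (rule rep_entry_regular)
  have "((\<lambda>k. p (\<gamma> k)) \<longlongrightarrow> p g) F"
    using p(1) by (rule regular_function_tendsto) (use assms GL_carrier_mat in auto)
  then show ?thesis using p(2) assms(1,2) by simp
qed

text \<open>
  Let \<open>t\<close> be the point \<open>s powi \<kappa>\<close> of the separating cocharacter and
  \<open>B = t b t\<^sup>-\<^sup>1\<close>, which tends to the diagonal part of \<open>b\<close> as
  \<open>s\<close> tends to \<open>0\<close>.  On the component of weight \<open>m\<close> the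
  vectors \<open>\<pi> B w\<close> and \<open>\<pi> b w\<close> differ by a power of
  \<open>s\<close> with exponent zero for \<open>m = l\<close> and negative exponent otherwise.  As
  \<open>\<pi> B w\<close> converges, \<open>\<pi> b w\<close> has no components other than that of
  weight \<open>l\<close>, and the latter equals its limit.
\<close>
lemma top_weight_vector_borel:
  assumes top: "top_weight l" and w: "w \<in> weight_space l"
    and b: "b \<in> carrier (GL n)" "upper_triangular b"
  shows "\<pi> b *\<^sub>v w = torus_char n l (\<lambda>i. b $$ (i, i)) \<cdot>\<^sub>v w"
proof -
  obtain \<kappa> where dom: "\<forall>i j. i < j \<longrightarrow> j < n \<longrightarrow> \<kappa> j < \<kappa> i"
    and gap: "\<forall>m\<in>weights. m \<noteq> l \<longrightarrow> weight_pairing n m \<kappa> < weight_pairing n l \<kappa>"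
    using top by (rule top_weight_cocharacter)
  have l: "l \<in> weights" using top unfolding top_weight_def by auto
  have wc: "w \<in> carrier_vec d" using w by (rule weight_space_carrier)
  have bc: "b \<in> carrier_mat n n" using b GL_carrier_mat by auto
  define z where "z = \<pi> b *\<^sub>v w"
  have zc: "z \<in> carrier_vec d" unfolding z_def using b wc by simp
  define D where "D = dmat n (\<lambda>i. b $$ (i, i))"
  have "Determinant.det b = Determinant.det D"
  proof -
    have "diag_mat D = diag_mat b" unfolding diag_mat_def D_def using bc by auto
    moreover have "upper_triangular D" unfolding upper_triangular_def D_def by auto
    ultimately show ?thesis
      using det_upper_triangular[OF b(2) bc] det_upper_triangular[of D n] unfolding D_def by simp
  qed
  then have D: "D \<in> carrier (GL n)" using b(1) GL_det_nonzero unfolding D_def by auto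
  have diag: "(\<lambda>i. b $$ (i, i)) \<in> torus n"
  proof -
    have "(\<Prod>i<n. b $$ (i, i)) \<noteq> 0" using D GL_det_nonzero[of D n] unfolding D_def det_dmat by auto
    then show ?thesis unfolding torus_def by auto
  qed
  define s where "s k = complex_of_real (1 / real (Suc k))" for k
  have s0: "s k \<noteq> 0" for k unfolding s_def by (simp del: of_nat_Suc)
  have s_lim: "s \<longlonglongrightarrow> 0"
  proof -
    have "(\<lambda>k. complex_of_real (1 / real (Suc k))) \<longlonglongrightarrow> complex_of_real 0"
      by (intro tendsto_of_real) (use LIMSEQ_inverse_real_of_nat in \<open>simp add: inverse_eq_divide\<close>)
    then show ?thesis unfolding s_def by simp
  qed
  have s_pow: "(\<lambda>k. s k powi e) \<longlonglongrightarrow> 0" if "e > 0" for e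
  proof -
    have "(\<lambda>k. s k ^ nat e) \<longlonglongrightarrow> 0 ^ nat e" by (intro tendsto_power s_lim)
    then show ?thesis using that by (simp add: power_int_def power_0_left)
  qed
  define t where "t k i = s k powi \<kappa> i" for k i
  define t' where "t' k i = s k powi (- \<kappa> i)" for k i
  have tt: "t k \<in> torus n" "t' k \<in> torus n" for k unfolding t_def t'_def torus_def using s0 by auto
  define B where "B k = dmat n (t k) * b * dmat n (t' k)" for k
  have BG: "B k \<in> carrier (GL n)" for k
    unfolding B_def using tt b torus_GL by (intro GL_mult_closed) auto
  have Bij: "B k $$ (i, j) = s k powi (\<kappa> i - \<kappa> j) * b $$ (i, j)" if "i < n" "j < n" for k i j
  proof -
    have "B k $$ (i, j) = t k i * b $$ (i, j) * t' k j"
      unfolding B_def using that bc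
      by (simp only: dmat_mult_right_index[OF mult_carrier_mat[OF dmat_carrier bc]] dmat_mult_left_index[OF bc])
    then show ?thesis unfolding t_def t'_def using s0 by (simp add: power_int_diff power_int_minus divide_inverse)
  qed
  have Blim: "(\<lambda>k. B k $$ (i, j)) \<longlonglongrightarrow> D $$ (i, j)" if ij: "i < n" "j < n" for i j
  proof -
    consider "i < j" | "i = j" | "j < i" by linarith
    then show ?thesis
    proof cases
      case 1
      then have "\<kappa> i - \<kappa> j > 0" using dom ij by auto
      then have "(\<lambda>k. s k powi (\<kappa> i - \<kappa> j) * b $$ (i, j)) \<longlonglongrightarrow> 0 * b $$ (i, j)"
        by (intro tendsto_mult s_pow tendsto_const)
      then show ?thesis using ij 1 unfolding Bij[OF ij] D_def by simp
    next
      case 2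
      then show ?thesis using ij unfolding Bij[OF ij] D_def by simp
    next
      case 3
      then have "b $$ (i, j) = 0" using b(2) bc ij unfolding upper_triangular_def by auto
      then show ?thesis using ij 3 unfolding Bij[OF ij] D_def by simp
    qed
  qed
  define c where "c = torus_char n l (\<lambda>i. b $$ (i, i))"
  have Dw: "\<pi> D *\<^sub>v w = c \<cdot>\<^sub>v w" unfolding D_def c_def using weight_spaceD[OF w diag] .
  have Bw: "\<pi> (B k) *\<^sub>v w = (s k powi - weight_pairing n l \<kappa>) \<cdot>\<^sub>v (\<pi> (dmat n (t k)) *\<^sub>v z)" for k
  proof -
    have "\<pi> (B k) *\<^sub>v w = \<pi> (dmat n (t k)) *\<^sub>v (\<pi> b *\<^sub>v (\<pi> (dmat n (t' k)) *\<^sub>v w))"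
      unfolding B_def using tt[of k] b(1) torus_GL wc
      by (simp add: rep_mult_vec GL_mult_closed)
    also have "\<pi> (dmat n (t' k)) *\<^sub>v w = (s k powi - weight_pairing n l \<kappa>) \<cdot>\<^sub>v w"
    proof -
      have "torus_char n l (t' k) = s k powi weight_pairing n l (\<lambda>i. - \<kappa> i)"
        unfolding t'_def by (rule cocharacter_char[OF s0])
      also have "weight_pairing n l (\<lambda>i. - \<kappa> i) = - weight_pairing n l \<kappa>"
        unfolding weight_pairing_def by (simp add: sum_negf)
      finally show ?thesis using weight_spaceD[OF w tt(2)] by simp
    qed
    also have "\<pi> b *\<^sub>v ((s k powi - weight_pairing n l \<kappa>) \<cdot>\<^sub>v w) = (s k powi - weight_pairing n l \<kappa>) \<cdot>\<^sub>v z"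
      unfolding z_def using b(1) wc by (intro mult_mat_vec[of _ d d]) auto
    also have "\<pi> (dmat n (t k)) *\<^sub>v \<dots> = (s k powi - weight_pairing n l \<kappa>) \<cdot>\<^sub>v (\<pi> (dmat n (t k)) *\<^sub>v z)"
      using torus_GL[OF tt(1)] zc by (intro mult_mat_vec[of _ d d]) auto
    finally show ?thesis .
  qed
  have proj: "weight_proj m *\<^sub>v (\<pi> (B k) *\<^sub>v w)
      = (s k powi (weight_pairing n m \<kappa> - weight_pairing n l \<kappa>)) \<cdot>\<^sub>v (weight_proj m *\<^sub>v z)" if m: "m \<in> weights" for m k
  proof -
    have "weight_proj m *\<^sub>v (\<pi> (B k) *\<^sub>v w)
        = (s k powi - weight_pairing n l \<kappa>) \<cdot>\<^sub>v (weight_proj m *\<^sub>v (\<pi> (dmat n (t k)) *\<^sub>v z))"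
      unfolding Bw using m torus_GL[OF tt(1)] zc by (intro mult_mat_vec[of _ d d]) auto
    also have "weight_proj m *\<^sub>v (\<pi> (dmat n (t k)) *\<^sub>v z) = (s k powi weight_pairing n m \<kappa>) \<cdot>\<^sub>v (weight_proj m *\<^sub>v z)"
      using weight_proj_torus[OF tt(1) zc m, of k] cocharacter_char[OF s0, of n m k \<kappa>] unfolding t_def by simp
    finally show ?thesis
      using s0[of k] by (simp add: smult_smult_assoc power_int_diff power_int_minus divide_inverse mult.commute)
  qed
  have lim: "(\<lambda>k. (weight_proj m *\<^sub>v (\<pi> (B k) *\<^sub>v w)) $ i) \<longlonglongrightarrow> (weight_proj m *\<^sub>v (c \<cdot>\<^sub>v w)) $ i"
    if m: "m \<in> weights" and i: "i < d" for m i
    unfolding Dw[symmetric]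
  proof (rule mat_vec_tendsto[OF _ _ _ _ tendsto_const _ i])
    fix j assume j: "j < d"
    show "(\<lambda>k. (\<pi> (B k) *\<^sub>v w) $ j) \<longlonglongrightarrow> (\<pi> D *\<^sub>v w) $ j"
      by (rule mat_vec_tendsto[OF _ _ _ _ rep_entry_tendsto tendsto_const j]) (use BG D Blim wc in auto)
  qed (use BG D wc m in auto)
  \<comment> \<open>A constant that is a null sequence times a convergent one is zero.\<close>
  have other: "weight_proj m *\<^sub>v z = 0\<^sub>v d" if m: "m \<in> weights" "m \<noteq> l" for m
  proof (rule eq_vecI)
    fix i assume "i < dim_vec (0\<^sub>v d :: complex Matrix.vec)"
    then have i: "i < d" by simp
    define e where "e = weight_pairing n l \<kappa> - weight_pairing n m \<kappa>"
    have e: "e > 0" using gap m unfolding e_def by auto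
    have "(weight_proj m *\<^sub>v z) $ i = s k powi e * (weight_proj m *\<^sub>v (\<pi> (B k) *\<^sub>v w)) $ i" for k
    proof -
      have "s k powi e * s k powi (weight_pairing n m \<kappa> - weight_pairing n l \<kappa>) = 1"
        using s0[of k] by (simp add: e_def flip: power_int_add)
      moreover have "(weight_proj m *\<^sub>v (\<pi> (B k) *\<^sub>v w)) $ i
          = s k powi (weight_pairing n m \<kappa> - weight_pairing n l \<kappa>) * (weight_proj m *\<^sub>v z) $ i"
        unfolding proj[OF m(1)] using i m(1) by simp
      ultimately show ?thesis by (simp flip: mult.assoc)
    qed
    moreover have "(\<lambda>k. s k powi e * (weight_proj m *\<^sub>v (\<pi> (B k) *\<^sub>v w)) $ i)
        \<longlonglongrightarrow> 0 * (weight_proj m *\<^sub>v (c \<cdot>\<^sub>v w)) $ i"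
      by (intro tendsto_mult s_pow e lim m(1) i)
    ultimately have "(\<lambda>k. (weight_proj m *\<^sub>v z) $ i) \<longlonglongrightarrow> 0 * (weight_proj m *\<^sub>v (c \<cdot>\<^sub>v w)) $ i" by simp
    then have "(weight_proj m *\<^sub>v z) $ i = 0 * (weight_proj m *\<^sub>v (c \<cdot>\<^sub>v w)) $ i"
      by (rule LIMSEQ_const_iff[THEN iffD1])
    then show "(weight_proj m *\<^sub>v z) $ i = 0\<^sub>v d $ i" using i by simp
  qed (use m zc in \<open>auto dest: weight_proj_carrier\<close>)
  have "weight_proj l *\<^sub>v z = weight_proj l *\<^sub>v (c \<cdot>\<^sub>v w)"
  proof (rule eq_vecI)
    fix i assume "i < dim_vec (weight_proj l *\<^sub>v (c \<cdot>\<^sub>v w))"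
    then have i: "i < d" using weight_proj_carrier[OF l] by auto
    have "(\<lambda>k. (weight_proj l *\<^sub>v z) $ i) \<longlonglongrightarrow> (weight_proj l *\<^sub>v (c \<cdot>\<^sub>v w)) $ i"
      using lim[OF l i] i l unfolding proj[OF l] by simp
    then show "(weight_proj l *\<^sub>v z) $ i = (weight_proj l *\<^sub>v (c \<cdot>\<^sub>v w)) $ i"
      by (rule LIMSEQ_const_iff[THEN iffD1])
  qed (use weight_proj_carrier[OF l] in auto)
  also have "weight_proj l *\<^sub>v (c \<cdot>\<^sub>v w) = c \<cdot>\<^sub>v (weight_proj l *\<^sub>v w)"
    using l wc by (intro mult_mat_vec[of _ d d]) auto
  also have "weight_proj l *\<^sub>v w = w"
    using weight_space_if_proj_zero[OF wc l] weight_proj_other[OF _ w weights_lattice[OF l]] by auto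
  finally show ?thesis
    using weight_space_if_proj_zero[OF zc l other] unfolding z_def c_def by simp
qed

end

section \<open>Irreducible subrepresentations and the weight norm\<close>

abbreviation vec_subspace :: "nat \<Rightarrow> complex Matrix.vec set \<Rightarrow> bool" where
  "vec_subspace d W \<equiv> VectorSpace.subspace class_ring W (module_vec TYPE(complex) d)"

lemma vec_subspace_iff:
  "vec_subspace d W \<longleftrightarrow> W \<subseteq> carrier_vec d \<and> 0\<^sub>v d \<in> W \<and>
     (\<forall>x\<in>W. \<forall>y\<in>W. x + y \<in> W) \<and> (\<forall>c. \<forall>x\<in>W. c \<cdot>\<^sub>v x \<in> W)"
proof -
  have "Module.module (class_ring :: complex ring) (module_vec TYPE(complex) d)"
    using vec_module by blast
  then show ?thesis
    unfolding VectorSpace.subspace_def submodule_def using vec_vs[where 'a = complex and n = d]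
    by (auto simp: module_vec_simps)
qed

text \<open>
  The largest size of a linearly independent subset serves as the dimension: a vector outside the
  smaller subspace enlarges every independent subset of it.
\<close>
lemma subspace_measure_exists:
  "\<exists>\<mu> :: complex Matrix.vec set \<Rightarrow> nat. \<forall>U W. vec_subspace d U \<longrightarrow> vec_subspace d W \<longrightarrow> U \<subset> W \<longrightarrow> \<mu> U < \<mu> W"
proof -
  interpret vec_space "TYPE(complex)" d .
  define I where "I W = {B. B \<subseteq> W \<and> lin_indpt B}" for W
  define \<mu> where "\<mu> W = Max (card ` I W)" for W
  have fin: "finite (card ` I W)" "card ` I W \<noteq> {}" if "vec_subspace d W" for W
  proof -
    have "card ` I W \<subseteq> {..dim}"
      using that li_le_dim(2)[OF fin_dim] unfolding I_def vec_subspace_iff by auto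
    then show "finite (card ` I W)" by (rule finite_subset) simp
    have "{} \<in> I W" unfolding I_def lin_dep_def by auto
    then show "card ` I W \<noteq> {}" by auto
  qed
  have "\<mu> U < \<mu> W" if U: "vec_subspace d U" and W: "vec_subspace d W" and UW: "U \<subset> W" for U W
  proof -
    have "\<mu> U \<in> card ` I U" unfolding \<mu>_def using fin[OF U] by (rule Max_in)
    then obtain B where B: "B \<subseteq> U" "lin_indpt B" "\<mu> U = card B" unfolding I_def by auto
    obtain x where x: "x \<in> W" "x \<notin> U" using UW by auto
    have Wc: "W \<subseteq> carrier_vec d" and Uc: "U \<subseteq> carrier_vec d" using U W vec_subspace_iff by auto
    have Bc: "B \<subseteq> carrier_vec d" using B Uc by auto
    have finB: "finite B" using li_le_dim(1)[OF fin_dim _ B(2)] Bc by auto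
    have "span B \<subseteq> U" using B(1) U by (intro span_is_subset) auto
    then have "x \<notin> span B" using x by auto
    then have "lin_indpt (B \<union> {x})"
      using lin_dep_iff_in_span[of B x] Bc B x Wc by auto
    then have "B \<union> {x} \<in> I W" unfolding I_def using B UW x by auto
    then have "card (B \<union> {x}) \<le> \<mu> W" unfolding \<mu>_def using fin[OF W] by (intro Max_ge) auto
    moreover have "x \<notin> B" using x(2) B(1) by auto
    then have "card (B \<union> {x}) = Suc (card B)" using finB by simp
    ultimately show ?thesis using B(3) by simp
  qed
  then show ?thesis by blast
qed

lemma vec_subspaceD:
  assumes "vec_subspace d W"
  shows "W \<subseteq> carrier_vec d" "0\<^sub>v d \<in> W" "x \<in> W \<Longrightarrow> y \<in> W \<Longrightarrow> x + y \<in> W" "x \<in> W \<Longrightarrow> c \<cdot>\<^sub>v x \<in> W"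
  using assms unfolding vec_subspace_iff by blast+

lemma vsum_in_subspace:
  assumes "vec_subspace d W" "finite S" "\<And>s. s \<in> S \<Longrightarrow> X s \<in> W"
  shows "vsum d S X \<in> W"
  using assms(2,3)
proof (induction S rule: finite_induct)
  case empty
  then show ?case using vec_subspaceD[OF assms(1)] by simp
next
  case (insert a S)
  have "X a \<in> W" using insert.prems by simp
  then show ?case using insert vec_subspaceD(1,3)[OF assms(1)] by (subst vsum_insert) auto
qed

context unitary_rep
begin

lemma subrepD:
  assumes "subrepresentation n d \<pi> W"
  shows "vec_subspace d W" "g \<in> carrier (GL n) \<Longrightarrow> w \<in> W \<Longrightarrow> \<pi> g *\<^sub>v w \<in> W"
    "w \<in> W \<Longrightarrow> w \<in> carrier_vec d"
  using assms vec_subspaceD(1) unfolding subrepresentation_def by blast+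

text \<open>
  The matrix acts by real scalars on pairwise orthogonal weight spaces.
\<close>
lemma ip_torus_real:
  assumes t: "\<And>i. i < n \<Longrightarrow> t i > (0::real)" and x: "x \<in> carrier_vec d" and y: "y \<in> carrier_vec d"
  shows "ip (\<pi> (dmat n (\<lambda>i. complex_of_real (t i))) *\<^sub>v x) y = ip x (\<pi> (dmat n (\<lambda>i. complex_of_real (t i))) *\<^sub>v y)"
proof -
  let ?t = "\<lambda>i. complex_of_real (t i)"
  have tt: "?t \<in> torus n" unfolding torus_def using t by fastforce
  have real: "cnj (torus_char n l ?t) = torus_char n l ?t" for l
    unfolding torus_char_def by simp
  have orth: "ip (a \<cdot>\<^sub>v (weight_proj l *\<^sub>v x)) (b \<cdot>\<^sub>v (weight_proj m *\<^sub>v y)) = 0"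
    if "l \<in> weights" "m \<in> weights" "l \<noteq> m" for a b l m
    using weight_space_orthogonal[OF weight_proj_in[OF that(1) x] weight_proj_in[OF that(2) y]] that weights_lattice x y
    by (simp add: ip_smult_left ip_smult_right)
  have "ip (\<pi> (dmat n ?t) *\<^sub>v x) y
      = ip (vsum d weights (\<lambda>l. torus_char n l ?t \<cdot>\<^sub>v (weight_proj l *\<^sub>v x))) (vsum d weights (\<lambda>l. 1 \<cdot>\<^sub>v (weight_proj l *\<^sub>v y)))"
    using torus_act[OF tt x] weight_decomposition[OF y] by simp
  also have "\<dots> = (\<Sum>l\<in>weights. ip (torus_char n l ?t \<cdot>\<^sub>v (weight_proj l *\<^sub>v x)) (1 \<cdot>\<^sub>v (weight_proj l *\<^sub>v y)))"
    using finite_weights x y by (intro ip_vsum_orthogonal orth) auto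
  also have "\<dots> = (\<Sum>l\<in>weights. ip (1 \<cdot>\<^sub>v (weight_proj l *\<^sub>v x)) (torus_char n l ?t \<cdot>\<^sub>v (weight_proj l *\<^sub>v y)))"
    using x y by (intro sum.cong refl) (simp add: ip_smult_left ip_smult_right real)
  also have "\<dots> = ip (vsum d weights (\<lambda>l. 1 \<cdot>\<^sub>v (weight_proj l *\<^sub>v x))) (vsum d weights (\<lambda>l. torus_char n l ?t \<cdot>\<^sub>v (weight_proj l *\<^sub>v y)))"
    using finite_weights x y by (intro ip_vsum_orthogonal[symmetric] orth) auto
  also have "\<dots> = ip x (\<pi> (dmat n ?t) *\<^sub>v y)"
    using torus_act[OF tt y] weight_decomposition[OF x] by simp
  finally show ?thesis .
qed

lemma ip_unitary_adjoint:
  assumes u: "u \<in> unitary_mats n" and "x \<in> carrier_vec d" "y \<in> carrier_vec d"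
  shows "ip (\<pi> u *\<^sub>v x) y = ip x (\<pi> (mat_adjoint u) *\<^sub>v y)"
proof -
  note c = unitary_matsD[OF u] unitary_matsD(4)[OF unitary_matsD(5)[OF u]]
  have "ip x (\<pi> (mat_adjoint u) *\<^sub>v y) = ip (\<pi> u *\<^sub>v x) (\<pi> u *\<^sub>v (\<pi> (mat_adjoint u) *\<^sub>v y))"
    using assms c by (intro ip_unitary[symmetric]) auto
  also have "\<pi> u *\<^sub>v (\<pi> (mat_adjoint u) *\<^sub>v y) = y"
    using assms c by (simp flip: rep_mult_vec)
  finally show ?thesis by simp
qed

text \<open>
  By the Cartan decomposition it suffices to treat unitary and positive diagonal matrices, whose
  adjoints again come from the group.
\<close>
lemma subrep_orthogonal:
  assumes W: "subrepresentation n d \<pi> W" and U: "subrepresentation n d \<pi> U"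
  shows "subrepresentation n d \<pi> {x \<in> W. \<forall>u\<in>U. ip x u = 0}" (is "subrepresentation n d \<pi> ?C")
  unfolding subrepresentation_def
proof (intro conjI ballI)
  note Ws = vec_subspaceD[OF subrepD(1)[OF W]] and Us = vec_subspaceD[OF subrepD(1)[OF U]]
  have Wc: "x \<in> carrier_vec d" if "x \<in> W" for x using that Ws by auto
  have Uc: "x \<in> carrier_vec d" if "x \<in> U" for x using that Us by auto
  show "vec_subspace d ?C"
    unfolding vec_subspace_iff using Ws by (auto simp: Wc Uc ip_add_left ip_smult_left)
  have unit: "\<pi> u *\<^sub>v x \<in> ?C" if "u \<in> unitary_mats n" "x \<in> ?C" for u x
    using that ip_unitary_adjoint[OF that(1)] subrepD(2)[OF W] subrepD(2)[OF U]
      unitary_matsD(4)[OF that(1)] unitary_matsD(4)[OF unitary_matsD(5)[OF that(1)]] Wc Uc by auto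
  fix g w assume g: "g \<in> carrier (GL n)" and w: "w \<in> ?C"
  obtain a c and t :: "nat \<Rightarrow> real" where ac: "a \<in> unitary_mats n" "c \<in> unitary_mats n"
    and t: "\<forall>i<n. t i > 0" and geq: "g = a * dmat n (\<lambda>i. complex_of_real (t i)) * c"
    using GL_cartan[OF g] by metis
  let ?D = "dmat n (\<lambda>i. complex_of_real (t i))"
  have D: "?D \<in> carrier (GL n)" using t by (intro dmat_GL) fastforce
  have x: "\<pi> c *\<^sub>v w \<in> ?C" using ac(2) w by (rule unit)
  then have "\<pi> ?D *\<^sub>v (\<pi> c *\<^sub>v w) \<in> ?C"
    using ip_torus_real[of t] t subrepD(2)[OF W D] subrepD(2)[OF U D] Wc Uc by auto
  then have "\<pi> a *\<^sub>v (\<pi> ?D *\<^sub>v (\<pi> c *\<^sub>v w)) \<in> ?C" by (rule unit[OF ac(1)])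
  moreover have "\<pi> g *\<^sub>v w = \<pi> a *\<^sub>v (\<pi> ?D *\<^sub>v (\<pi> c *\<^sub>v w))"
    unfolding geq using unitary_matsD(4)[OF ac(1)] unitary_matsD(4)[OF ac(2)] D w Wc
    by (simp add: rep_mult_vec GL_mult_closed)
  ultimately show "\<pi> g *\<^sub>v w \<in> ?C" by simp
qed

text \<open>
  For a torus element \<open>t\<close> that separates two weights, applying \<open>\<pi> t\<close>
  and subtracting a multiple of the vector removes one component and rescales the others.
\<close>
lemma subrep_weight_components:
  assumes U: "subrepresentation n d \<pi> U"
    and "finite S" "S \<subseteq> weight_lattice n" "\<forall>s\<in>S. X s \<in> weight_space s" "vsum d S X \<in> U"
  shows "\<forall>s\<in>S. X s \<in> U"
  using assms(2-)
proof (induction S arbitrary: X rule: finite_induct)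
  case empty
  then show ?case by simp
next
  case (insert a S)
  note Us = vec_subspaceD[OF subrepD(1)[OF U]]
  have Xc: "X s \<in> carrier_vec d" if "s \<in> insert a S" for s
    using insert.prems(2) that weight_space_carrier by blast
  have S: "X m \<in> U" if m: "m \<in> S" for m
  proof -
    have "m \<in> weight_lattice n" "a \<in> weight_lattice n" "m \<noteq> a"
      using m insert.hyps insert.prems(1) by auto
    then obtain t where t: "\<forall>i. cmod (t i) = 1" "torus_char n m t \<noteq> torus_char n a t"
      by (rule torus_char_separates)
    have tt: "t \<in> torus n" using unit_circle_torus t(1) by auto
    define Y where "Y s = (torus_char n s t - torus_char n a t) \<cdot>\<^sub>v X s" for s
    have "\<pi> (dmat n t) *\<^sub>v vsum d (insert a S) X = vsum d (insert a S) (\<lambda>s. \<pi> (dmat n t) *\<^sub>v X s)"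
      using torus_GL[OF tt] Xc by (intro mult_mat_vsum) auto
    also have "\<dots> = vsum d (insert a S) (\<lambda>s. torus_char n s t \<cdot>\<^sub>v X s)"
      using insert.prems(2) weight_spaceD[OF _ tt] by (intro vsum_cong) auto
    finally have "\<pi> (dmat n t) *\<^sub>v vsum d (insert a S) X + (- torus_char n a t) \<cdot>\<^sub>v vsum d (insert a S) X = vsum d S Y"
      using insert.hyps Xc
      by (intro eq_vecI) (auto simp: Y_def sum_distrib_left algebra_simps sum_subtractf sum_negf
          carrier_vecD[OF Xc] vsum_def)
    moreover have "\<pi> (dmat n t) *\<^sub>v vsum d (insert a S) X + (- torus_char n a t) \<cdot>\<^sub>v vsum d (insert a S) X \<in> U"
      using insert.prems(3) subrepD(2)[OF U torus_GL[OF tt]] Us(3,4) by auto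
    ultimately have "vsum d S Y \<in> U" by simp
    moreover have "\<forall>s\<in>S. Y s \<in> weight_space s"
    proof
      fix s assume s: "s \<in> S"
      then have c: "X s \<in> carrier_vec d" "X s \<in> weight_space s" using Xc insert.prems(2) by auto
      show "Y s \<in> weight_space s" unfolding weight_space_def Y_def
        using c torus_GL weight_spaceD[OF c(2)]
        by (auto simp: mult_mat_vec[of _ d d] smult_smult_assoc mult.commute)
    qed
    ultimately have "Y m \<in> U" using insert.IH[of Y] insert.prems(1) m by auto
    then have "(1 / (torus_char n m t - torus_char n a t)) \<cdot>\<^sub>v Y m \<in> U" using Us(4) by auto
    then show ?thesis unfolding Y_def using t(2) by (simp add: smult_smult_assoc)
  qed
  have "vsum d S X \<in> U" using S insert.hyps(1) subrepD(1)[OF U] by (intro vsum_in_subspace) auto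
  then have "vsum d (insert a S) X + (-1) \<cdot>\<^sub>v vsum d S X \<in> U" using Us(3,4) insert.prems(3) by auto
  moreover have "vsum d (insert a S) X + (-1) \<cdot>\<^sub>v vsum d S X = X a"
    using insert.hyps Xc[of a] by (intro eq_vecI) (auto simp: vsum_def)
  ultimately show ?case using S by auto
qed

lemma subrep_weight_proj:
  assumes "subrepresentation n d \<pi> U" "u \<in> U" "l \<in> weights"
  shows "weight_proj l *\<^sub>v u \<in> U"
proof -
  have u: "u \<in> carrier_vec d" using subrepD(3)[OF assms(1,2)] .
  have "\<forall>m\<in>weights. weight_proj m *\<^sub>v u \<in> U"
    using assms finite_weights weights_lattice weight_proj_in u weight_decomposition[OF u]
    by (intro subrep_weight_components) auto
  then show ?thesis using assms(3) by blast
qed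

text \<open>
  Take a minimal subrepresentation \<open>W\<close> with a nonzero vector of weight
  \<open>l\<close>.  If a smaller one \<open>U\<close> has no such vector, then the projection to
  weight \<open>l\<close> kills \<open>U\<close>, so that every vector of weight \<open>l\<close> is
  orthogonal to \<open>U\<close>.  By minimality the orthogonal complement of \<open>U\<close> in
  \<open>W\<close> is all of \<open>W\<close>, and \<open>U\<close> is zero.
\<close>
lemma irreducible_meeting_weight_space:
  assumes l: "l \<in> weights"
  obtains W w where "irreducible_subrepresentation n d \<pi> W" "w \<in> W" "w \<in> weight_space l" "w \<noteq> 0\<^sub>v d"
proof -
  obtain \<mu> :: "complex Matrix.vec set \<Rightarrow> nat" where
    \<mu>: "\<forall>U W. vec_subspace d U \<longrightarrow> vec_subspace d W \<longrightarrow> U \<subset> W \<longrightarrow> \<mu> U < \<mu> W"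
    using subspace_measure_exists by blast
  define good where "good W \<longleftrightarrow> subrepresentation n d \<pi> W \<and> (\<exists>w\<in>W. w \<in> weight_space l \<and> w \<noteq> 0\<^sub>v d)" for W
  have "subrepresentation n d \<pi> (carrier_vec d)"
    unfolding subrepresentation_def vec_subspace_iff by auto
  then have "good (carrier_vec d)"
    using l weight_space_carrier unfolding good_def weights_def by blast
  then obtain W where W: "good W" "\<And>U. good U \<Longrightarrow> \<mu> W \<le> \<mu> U"
    using ex_has_least_nat[of good _ \<mu>] by blast
  have Ws: "subrepresentation n d \<pi> W" using W(1) unfolding good_def by auto
  have min: "U = W" if "good U" "U \<subseteq> W" for U
  proof (rule ccontr)
    assume "U \<noteq> W"
    then have "\<mu> U < \<mu> W" using that \<mu> subrepD(1) Ws unfolding good_def by blast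
    then show False using W(2)[OF that(1)] by simp
  qed
  obtain w where w: "w \<in> W" "w \<in> weight_space l" "w \<noteq> 0\<^sub>v d" using W(1) unfolding good_def by auto
  have "irreducible_subrepresentation n d \<pi> W"
    unfolding irreducible_subrepresentation_def
  proof (intro conjI allI impI)
    fix U assume "subrepresentation n d \<pi> U \<and> U \<subseteq> W"
    then have U: "subrepresentation n d \<pi> U" "U \<subseteq> W" by auto
    show "U = {0\<^sub>v d} \<or> U = W"
    proof (cases "good U")
      case True
      then show ?thesis using min U by auto
    next
      case False
      define C where "C = {x \<in> W. \<forall>u\<in>U. ip x u = 0}"
      have "ip w u = 0" if u: "u \<in> U" for u
      proof -
        have uc: "u \<in> carrier_vec d" using subrepD(3)[OF U(1) u] .
        have "weight_proj l *\<^sub>v u = 0\<^sub>v d"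
          using False subrep_weight_proj[OF U(1) u l] weight_proj_in[OF l uc] U(1) unfolding good_def by blast
        then show ?thesis using ip_weight_proj[OF l w(2) uc] weight_space_carrier[OF w(2)] by simp
      qed
      then have "good C"
        unfolding good_def C_def using w subrep_orthogonal[OF Ws U(1)] by auto
      then have "C = W" by (rule min) (auto simp: C_def)
      then have "ip u u = 0" if "u \<in> U" for u using that U(2) unfolding C_def by blast
      then have "u = 0\<^sub>v d" if "u \<in> U" for u
        using ip_pos[of u] subrepD(3)[OF U(1) that] that by fastforce
      then show ?thesis using vec_subspaceD(2)[OF subrepD(1)[OF U(1)]] by blast
    qed
  qed (use Ws w in auto)
  then show ?thesis using that w by blast
qed

lemma highest_weight_is_weight:
  assumes W: "subrepresentation n d \<pi> W" and hw: "highest_weight n d \<pi> W wt"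
  shows "(\<lambda>i. if i < n then vec_index wt i else 0) \<in> weights" (is "?l \<in> weights")
proof -
  obtain w where w: "w \<in> W" "w \<noteq> 0\<^sub>v d"
    and eq: "\<And>b. b \<in> carrier (GL n) \<Longrightarrow> upper_triangular b \<Longrightarrow>
       \<pi> b *\<^sub>v w = (\<Prod>i<n. b $$ (i, i) powi (vec_index wt i)) \<cdot>\<^sub>v w"
    using hw unfolding highest_weight_def by blast
  have "w \<in> weight_space ?l"
    unfolding weight_space_def
  proof (intro CollectI conjI ballI)
    show "w \<in> carrier_vec d" using subrepD(3)[OF W w(1)] .
    fix t assume t: "t \<in> torus n"
    have "upper_triangular (dmat n t)" unfolding upper_triangular_def by auto
    from eq[OF torus_GL[OF t] this]
    show "\<pi> (dmat n t) *\<^sub>v w = torus_char n ?l t \<cdot>\<^sub>v w" unfolding torus_char_def by simp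
  qed
  then show ?thesis unfolding weights_def weight_lattice_def using w(2) by auto
qed

text \<open>
  Every highest weight is a weight, so the maximum is over a finite set, and the largest norm of any
  weight is attained by a highest weight.
\<close>
theorem weight_norm_bounds_weights:
  assumes m: "m \<in> weights"
  shows "sqrt (\<Sum>i<n. (real_of_int (m i))\<^sup>2) \<le> weight_norm n d \<pi>"
proof -
  define nrm where "nrm l = sqrt (\<Sum>i<n. (real_of_int (l i))\<^sup>2)" for l :: "nat \<Rightarrow> int"
  have nrm: "nrm l = sqrt (real_of_int (weight_pairing n l l))" for l
    unfolding nrm_def weight_pairing_def by (simp add: power2_eq_square)
  define S where "S = {sqrt (\<Sum>i<n. (real_of_int (vec_index wt i))\<^sup>2) | wt.
            \<exists>W. irreducible_subrepresentation n d \<pi> W \<and> highest_weight n d \<pi> W wt}"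
  have "S \<subseteq> nrm ` weights"
  proof
    fix s assume "s \<in> S"
    then obtain wt W where s: "s = sqrt (\<Sum>i<n. (real_of_int (vec_index wt i))\<^sup>2)"
      and W: "irreducible_subrepresentation n d \<pi> W" "highest_weight n d \<pi> W wt"
      unfolding S_def by blast
    have "(\<lambda>i. if i < n then vec_index wt i else 0) \<in> weights"
      using highest_weight_is_weight W unfolding irreducible_subrepresentation_def by blast
    moreover have "s = nrm (\<lambda>i. if i < n then vec_index wt i else 0)"
      unfolding s nrm_def by simp
    ultimately show "s \<in> nrm ` weights" by blast
  qed
  then have fin: "finite S" using finite_weights finite_surj by blast
  obtain l where top: "top_weight l" using top_weight_exists m by blast
  then have l: "l \<in> weights" "weight_pairing n m m \<le> weight_pairing n l l"
    using m unfolding top_weight_def by auto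
  obtain W w where W: "irreducible_subrepresentation n d \<pi> W" "w \<in> W" "w \<in> weight_space l" "w \<noteq> 0\<^sub>v d"
    using l(1) by (rule irreducible_meeting_weight_space)
  have "highest_weight n d \<pi> W (Matrix.vec n l)"
    unfolding highest_weight_def
    using W top_weight_vector_borel[OF top W(3)] by (auto simp: torus_char_def)
  then have "nrm l \<in> S" unfolding S_def nrm_def using W(1)
    by (auto intro!: exI[of _ "Matrix.vec n l"])
  then have "nrm l \<le> weight_norm n d \<pi>"
    unfolding weight_norm_def S_def[symmetric] using fin by auto
  moreover have "nrm m \<le> nrm l" unfolding nrm using l(2) by simp
  ultimately show ?thesis unfolding nrm_def by linarith
qed

end

section \<open>Norms along exponential curves and the moment map\<close>

lemma Cauchy_Schwarz_sum:
  fixes a b :: "nat \<Rightarrow> real"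
  shows "\<bar>\<Sum>i<n. a i * b i\<bar> \<le> sqrt (\<Sum>i<n. (a i)\<^sup>2) * sqrt (\<Sum>i<n. (b i)\<^sup>2)"
proof -
  have "\<bar>\<Sum>i<n. a i * b i\<bar> \<le> (\<Sum>i<n. \<bar>a i\<bar> * \<bar>b i\<bar>)"
    by (rule order_trans[OF sum_abs]) (simp add: abs_mult)
  also have "\<dots> \<le> L2_set a {..<n} * L2_set b {..<n}" by (rule L2_set_mult_ineq)
  finally show ?thesis unfolding L2_set_def .
qed

lemma mat_trace_mult:
  assumes "A \<in> carrier_mat n n" "B \<in> carrier_mat n n"
  shows "mat_trace (A * B) = (\<Sum>i<n. \<Sum>j<n. A $$ (i, j) * B $$ (j, i))"
proof -
  have "mat_trace (A * B) = (\<Sum>i<n. (A * B) $$ (i, i))" unfolding mat_trace_def using assms by auto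
  then show ?thesis using index_mult_mat_sum[OF assms] by simp
qed

lemma frobenius_norm_nonneg: "frobenius_norm A \<ge> 0"
  unfolding frobenius_norm_def by (intro real_sqrt_ge_zero sum_nonneg) auto

lemma frobenius_norm_hermitian:
  assumes H: "H \<in> hermitian_mats n"
  shows "mat_trace (H * H) = complex_of_real ((frobenius_norm H)\<^sup>2)"
proof -
  have c: "H \<in> carrier_mat n n" using H unfolding hermitian_mats_def by auto
  have "mat_trace (H * H) = (\<Sum>i<n. (H * H) $$ (i, i))" unfolding mat_trace_def using c by auto
  also have "\<dots> = (\<Sum>i<n. \<Sum>j<n. H $$ (i, j) * H $$ (j, i))"
    using c by (intro sum.cong refl index_mult_mat_sum) auto
  also have "\<dots> = (\<Sum>i<n. \<Sum>j<n. complex_of_real ((cmod (H $$ (i, j)))\<^sup>2))"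
    unfolding complex_norm_square using hermitian_index[OF H] by (intro sum.cong refl) auto
  also have "\<dots> = complex_of_real ((frobenius_norm H)\<^sup>2)"
    unfolding frobenius_norm_def using c by (simp add: sum_nonneg)
  finally show ?thesis .
qed

lemma frobenius_norm_conj_dmat:
  assumes u: "u \<in> unitary_mats n" and H: "H \<in> hermitian_mats n"
    and eq: "H = u * dmat n (\<lambda>i. complex_of_real (h i)) * mat_adjoint u"
  shows "(frobenius_norm H)\<^sup>2 = (\<Sum>i<n. (h i)\<^sup>2)"
proof -
  note c = unitary_matsD[OF u]
  have HH: "H * H = u * dmat n (\<lambda>i. complex_of_real (h i) * complex_of_real (h i)) * mat_adjoint u"
    unfolding eq by (rule mult_conj_dmat[OF u])
  have "mat_trace (H * H) = (\<Sum>i<n. (H * H) $$ (i, i))"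
    unfolding mat_trace_def using H unfolding hermitian_mats_def by auto
  also have "\<dots> = (\<Sum>i<n. \<Sum>a<n. u $$ (i, a) * (complex_of_real (h a) * complex_of_real (h a)) * cnj (u $$ (i, a)))"
    unfolding HH using c(1) by (intro sum.cong refl conj_dmat_index) auto
  also have "\<dots> = (\<Sum>a<n. complex_of_real ((h a)\<^sup>2) * (\<Sum>i<n. cnj (u $$ (i, a)) * u $$ (i, a)))"
    by (subst sum.swap) (simp add: sum_distrib_left power2_eq_square mult_ac)
  also have "\<dots> = (\<Sum>a<n. complex_of_real ((h a)\<^sup>2))"
  proof (intro sum.cong refl)
    fix a assume "a \<in> {..<n}"
    then have a: "a < n" by simp
    have "(\<Sum>i<n. cnj (u $$ (i, a)) * u $$ (i, a)) = (\<Sum>i<n. mat_adjoint u $$ (a, i) * u $$ (i, a))"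
      using c(1) a by (intro sum.cong) auto
    also have "\<dots> = (mat_adjoint u * u) $$ (a, a)"
      using c(1) a by (intro index_mult_mat_sum[symmetric]) auto
    finally show "complex_of_real ((h a)\<^sup>2) * (\<Sum>i<n. cnj (u $$ (i, a)) * u $$ (i, a)) = complex_of_real ((h a)\<^sup>2)"
      using c(2) a by simp
  qed
  finally have "complex_of_real ((frobenius_norm H)\<^sup>2) = complex_of_real (\<Sum>a<n. (h a)\<^sup>2)"
    unfolding frobenius_norm_hermitian[OF H] by simp
  then show ?thesis by (simp only: of_real_eq_iff)
qed

lemma mat_exp_hermitian:
  assumes u: "u \<in> unitary_mats n"
    and eq: "H = u * dmat n (\<lambda>i. complex_of_real (h i)) * mat_adjoint u"
  shows "mat_exp (complex_of_real s \<cdot>\<^sub>m H) = u * dmat n (\<lambda>i. complex_of_real (exp (s * h i))) * mat_adjoint u"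
  unfolding eq smult_conj_dmat[OF unitary_matsD(1)[OF u]] mat_exp_conj_dmat[OF u]
  by (simp flip: of_real_mult exp_of_real)

lemma mat_exp_GL:
  assumes "H \<in> hermitian_mats n"
  shows "mat_exp (complex_of_real s \<cdot>\<^sub>m H) \<in> carrier (GL n)"
proof -
  obtain u h where u: "u \<in> unitary_mats n" and eq: "H = u * dmat n (\<lambda>i. complex_of_real (h i)) * mat_adjoint u"
    using hermitian_spectral[OF assms] by blast
  show ?thesis unfolding mat_exp_hermitian[OF u eq]
    by (intro conj_dmat_GL u unitary_matsD(5)) simp
qed

lemma mat_exp_zero:
  assumes "H \<in> hermitian_mats n"
  shows "mat_exp (complex_of_real 0 \<cdot>\<^sub>m H) = 1\<^sub>m n"
proof -
  obtain u h where u: "u \<in> unitary_mats n" and eq: "H = u * dmat n (\<lambda>i. complex_of_real (h i)) * mat_adjoint u"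
    using hermitian_spectral[OF assms] by blast
  show ?thesis unfolding mat_exp_hermitian[OF u eq] using unitary_matsD[OF u] by (simp add: dmat_one)
qed

lemma group_curve_exp:
  assumes H: "H \<in> hermitian_mats n"
  shows "group_curve n (\<lambda>s. mat_exp (complex_of_real s \<cdot>\<^sub>m H)) (\<lambda>i j. H $$ (i, j))"
proof -
  obtain u h where u: "u \<in> unitary_mats n" and eq: "H = u * dmat n (\<lambda>i. complex_of_real (h i)) * mat_adjoint u"
    using hermitian_spectral[OF H] by blast
  note c = unitary_matsD[OF u]
  have "((\<lambda>s. mat_exp (complex_of_real s \<cdot>\<^sub>m H) $$ (i, j)) has_vector_derivative H $$ (i, j)) (at 0)"
    if ij: "i < n" "j < n" for i j
  proof -
    have e: "((\<lambda>s. complex_of_real (exp (s * y))) has_vector_derivative complex_of_real y) (at 0)" for y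
    proof -
      have "((\<lambda>s. exp (s * y)) has_real_derivative y) (at 0)"
        by (auto intro!: derivative_eq_intros)
      then have "((\<lambda>s. exp (s * y)) has_vector_derivative y) (at 0)"
        by (simp add: has_real_derivative_iff_has_vector_derivative)
      from bounded_linear.has_vector_derivative[OF bounded_linear_of_real this] show ?thesis .
    qed
    have "((\<lambda>s. \<Sum>a<n. u $$ (i, a) * complex_of_real (exp (s * h a)) * cnj (u $$ (j, a)))
      has_vector_derivative (\<Sum>a<n. u $$ (i, a) * complex_of_real (h a) * cnj (u $$ (j, a)))) (at 0)"
      by (intro has_vector_derivative_sum has_vector_derivative_mult_left has_vector_derivative_mult_right e)
    then show ?thesis
      unfolding mat_exp_hermitian[OF u eq] conj_dmat_index[OF c(1) ij]
      unfolding eq conj_dmat_index[OF c(1) ij] .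
  qed
  then show ?thesis unfolding group_curve_def using mat_exp_GL[OF H] mat_exp_zero[OF H] by auto
qed

context unitary_rep
begin

text \<open>
  Here \<open>a l\<close> is the pairing of \<open>l\<close> with the eigenvalues of
  \<open>H\<close>, and \<open>q l\<close> is the squared norm of the component of weight
  \<open>l\<close> of \<open>x\<close> in an eigenbasis of \<open>H\<close>; the bound on \<open>a
  l\<close> is the Cauchy-Schwarz inequality.
\<close>
lemma exp_norm_expansion:
  assumes H: "H \<in> hermitian_mats n" and x: "x \<in> carrier_vec d"
  obtains q a :: "(nat \<Rightarrow> int) \<Rightarrow> real" where "\<forall>l\<in>weights. q l \<ge> 0"
    "\<forall>l\<in>weights. \<bar>a l\<bar> \<le> weight_norm n d \<pi> * frobenius_norm H"
    "\<forall>s. Re (ip (\<pi> (mat_exp (complex_of_real s \<cdot>\<^sub>m H)) *\<^sub>v x) (\<pi> (mat_exp (complex_of_real s \<cdot>\<^sub>m H)) *\<^sub>v x))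
       = (\<Sum>l\<in>weights. q l * exp (2 * s * a l))"
proof -
  obtain u h where u: "u \<in> unitary_mats n" and eq: "H = u * dmat n (\<lambda>i. complex_of_real (h i)) * mat_adjoint u"
    using hermitian_spectral[OF H] by blast
  note c = unitary_matsD[OF u] and ca = unitary_matsD[OF unitary_matsD(5)[OF u]]
  define y where "y = \<pi> (mat_adjoint u) *\<^sub>v x"
  have y: "y \<in> carrier_vec d" unfolding y_def using ca x by simp
  define a where "a l = (\<Sum>i<n. real_of_int (l i) * h i)" for l :: "nat \<Rightarrow> int"
  define q where "q l = Re (ip (weight_proj l *\<^sub>v y) (weight_proj l *\<^sub>v y))" for l
  have "\<bar>a l\<bar> \<le> weight_norm n d \<pi> * frobenius_norm H" if l: "l \<in> weights" for l
  proof -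
    have "sqrt (\<Sum>i<n. (h i)\<^sup>2) = frobenius_norm H"
      unfolding frobenius_norm_conj_dmat[OF u H eq, symmetric] using frobenius_norm_nonneg by simp
    then have "\<bar>a l\<bar> \<le> sqrt (\<Sum>i<n. (real_of_int (l i))\<^sup>2) * frobenius_norm H"
      using Cauchy_Schwarz_sum[of "\<lambda>i. real_of_int (l i)" h n] unfolding a_def by simp
    also have "\<dots> \<le> weight_norm n d \<pi> * frobenius_norm H"
      by (intro mult_right_mono weight_norm_bounds_weights l frobenius_norm_nonneg)
    finally show ?thesis .
  qed
  moreover have "q l \<ge> 0" if "l \<in> weights" for l
    unfolding q_def using that y by (intro ip_self_nonneg) auto
  moreover have "Re (ip (\<pi> (mat_exp (complex_of_real s \<cdot>\<^sub>m H)) *\<^sub>v x) (\<pi> (mat_exp (complex_of_real s \<cdot>\<^sub>m H)) *\<^sub>v x))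
       = (\<Sum>l\<in>weights. q l * exp (2 * s * a l))" for s
  proof -
    define t where "t i = complex_of_real (exp (s * h i))" for i
    have t: "t \<in> torus n" unfolding torus_def t_def by simp
    have ch: "torus_char n l t = complex_of_real (exp (s * a l))" for l
    proof -
      have "torus_char n l t = complex_of_real (\<Prod>i<n. exp (s * h i) powi l i)"
        unfolding torus_char_def t_def by simp
      also have "(\<Prod>i<n. exp (s * h i) powi l i) = (\<Prod>i<n. exp (s * (real_of_int (l i) * h i)))"
        by (intro prod.cong refl) (simp add: exp_power_int mult_ac)
      also have "\<dots> = exp (s * a l)"
        unfolding a_def sum_distrib_left by (simp add: exp_sum)
      finally show ?thesis .
    qed
    let ?z = "\<pi> (dmat n t) *\<^sub>v y"
    have z: "?z = vsum d weights (\<lambda>l. complex_of_real (exp (s * a l)) \<cdot>\<^sub>v (weight_proj l *\<^sub>v y))"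
      using torus_act[OF t y] by (simp add: ch)
    have orth: "ip (complex_of_real (exp (s * a l)) \<cdot>\<^sub>v (weight_proj l *\<^sub>v y)) (complex_of_real (exp (s * a m)) \<cdot>\<^sub>v (weight_proj m *\<^sub>v y)) = 0"
      if "l \<in> weights" "m \<in> weights" "l \<noteq> m" for l m
      using weight_space_orthogonal[OF weight_proj_in[OF that(1) y] weight_proj_in[OF that(2) y]] that weights_lattice y
      by (simp add: ip_smult_left ip_smult_right)
    have "\<pi> (mat_exp (complex_of_real s \<cdot>\<^sub>m H)) *\<^sub>v x = \<pi> u *\<^sub>v ?z"
      unfolding mat_exp_hermitian[OF u eq] t_def[symmetric] y_def using c ca torus_GL[OF t] x
      by (simp add: rep_mult_vec GL_mult_closed)
    then have "ip (\<pi> (mat_exp (complex_of_real s \<cdot>\<^sub>m H)) *\<^sub>v x) (\<pi> (mat_exp (complex_of_real s \<cdot>\<^sub>m H)) *\<^sub>v x) = ip ?z ?z"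
      using ip_unitary[OF u] torus_GL[OF t] y by simp
    also have "\<dots> = (\<Sum>l\<in>weights. ip (complex_of_real (exp (s * a l)) \<cdot>\<^sub>v (weight_proj l *\<^sub>v y))
         (complex_of_real (exp (s * a l)) \<cdot>\<^sub>v (weight_proj l *\<^sub>v y)))"
      unfolding z using finite_weights y by (intro ip_vsum_orthogonal orth) auto
    also have "Re \<dots> = (\<Sum>l\<in>weights. q l * exp (2 * s * a l))"
      unfolding Re_sum
    proof (intro sum.cong refl)
      fix l assume l: "l \<in> weights"
      have "exp (2 * s * a l) = exp (s * a l) * exp (s * a l)" by (simp flip: exp_add)
      then show "Re (ip (complex_of_real (exp (s * a l)) \<cdot>\<^sub>v (weight_proj l *\<^sub>v y))
         (complex_of_real (exp (s * a l)) \<cdot>\<^sub>v (weight_proj l *\<^sub>v y))) = q l * exp (2 * s * a l)"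
        using l y by (simp add: ip_smult_left ip_smult_right q_def)
    qed
    finally show ?thesis by simp
  qed
  ultimately show ?thesis using that by blast
qed

lemma differentiable_at_one_norm:
  assumes x: "x \<in> carrier_vec d"
  shows "differentiable_at_one n (\<lambda>g. ip (\<pi> g *\<^sub>v x) (\<pi> g *\<^sub>v x))"
proof -
  have "differentiable_at_one n (\<lambda>g. \<Sum>k<d. \<pi> g $$ (i, k) * x $ k)" if i: "i < d" for i
  proof (intro differentiable_at_one_sum differentiable_at_one_mult differentiable_at_one_const)
    fix k assume "k \<in> {..<d}"
    then have "k < d" by simp
    with i obtain p where p: "p \<in> regular_functions n" "\<forall>g\<in>carrier (GL n). \<pi> g $$ (i, k) = p g"
      by (rule rep_entry_regular)
    show "differentiable_at_one n (\<lambda>g. \<pi> g $$ (i, k))"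
      by (rule differentiable_at_one_cong[OF differentiable_at_one_regular[OF p(1)]]) (use p(2) in auto)
  qed auto
  note entry = this
  have "differentiable_at_one n (\<lambda>g. \<Sum>i<d. \<Sum>j<d. (\<Sum>k<d. \<pi> g $$ (i, k) * x $ k) *
     cnj (\<Sum>k<d. \<pi> g $$ (j, k) * x $ k) * ip (unit_vec d i) (unit_vec d j))"
    by (intro differentiable_at_one_sum differentiable_at_one_mult differentiable_at_one_const differentiable_at_one_cnj entry) auto
  then show ?thesis
  proof (rule differentiable_at_one_cong)
    fix g assume g: "g \<in> carrier (GL n)"
    have e: "(\<pi> g *\<^sub>v x) $ i = (\<Sum>k<d. \<pi> g $$ (i, k) * x $ k)" if "i < d" for i
      using g x that by (intro index_mult_mat_vec_sum) auto
    show "(\<Sum>i<d. \<Sum>j<d. (\<Sum>k<d. \<pi> g $$ (i, k) * x $ k) *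
     cnj (\<Sum>k<d. \<pi> g $$ (j, k) * x $ k) * ip (unit_vec d i) (unit_vec d j)) = ip (\<pi> g *\<^sub>v x) (\<pi> g *\<^sub>v x)"
      unfolding ip_gram[OF rep_vec_carrier[OF g x] rep_vec_carrier[OF g x]]
      by (intro sum.cong refl) (simp add: e)
  qed
qed

definition is_moment :: "complex Matrix.vec \<Rightarrow> complex mat \<Rightarrow> bool" where
  "is_moment x M \<longleftrightarrow> M \<in> hermitian_mats n \<and>
        (\<forall>H\<in>hermitian_mats n.
           ((\<lambda>t::real. ln (ip_norm ip (\<pi> (mat_exp (complex_of_real t \<cdot>\<^sub>m H)) *\<^sub>v x)))
              has_real_derivative Re (mat_trace (M * H))) (at 0))"

text \<open>
  The derivative of the logarithm of the norm is the real part of a pairing of \<open>H\<close> with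
  a fixed matrix \<open>K\<close>, and on Hermitian \<open>H\<close> only the Hermitian part of the
  transpose of \<open>K\<close> matters.
\<close>
lemma is_moment_exists:
  assumes x: "x \<in> carrier_vec d" "x \<noteq> 0\<^sub>v d"
  shows "\<exists>M. is_moment x M"
proof -
  obtain c e where ce: "\<forall>\<gamma> D. group_curve n \<gamma> D \<longrightarrow>
     ((\<lambda>t. ip (\<pi> (\<gamma> t) *\<^sub>v x) (\<pi> (\<gamma> t) *\<^sub>v x)) has_vector_derivative
       (\<Sum>i<n. \<Sum>j<n. c i j * D i j + e i j * cnj (D i j))) (at 0)"
    using differentiable_at_one_norm[OF x(1)] unfolding differentiable_at_one_def by blast
  define f where "f = Re (ip x x)"
  have f: "f > 0" unfolding f_def using ip_pos x by auto
  \<comment> \<open>On Hermitian matrices conjugation is transposition, so the conjugate terms can be merged with the others.\<close>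
  define K where "K i j = (c i j + e j i) / complex_of_real (2 * f)" for i j
  define M where "M = Matrix.mat n n (\<lambda>(i, j). (K j i + cnj (K i j)) / 2)"
  have M: "M \<in> hermitian_mats n"
    unfolding hermitian_mats_def M_def by (auto intro!: eq_matI simp: add.commute)
  have "((\<lambda>t::real. ln (ip_norm ip (\<pi> (mat_exp (complex_of_real t \<cdot>\<^sub>m H)) *\<^sub>v x)))
              has_real_derivative Re (mat_trace (M * H))) (at 0)" if H: "H \<in> hermitian_mats n" for H
  proof -
    have Hc: "H \<in> carrier_mat n n" using H unfolding hermitian_mats_def by auto
    define S where "S = (\<Sum>i<n. \<Sum>j<n. c i j * H $$ (i, j) + e i j * cnj (H $$ (i, j)))"
    define F where "F t = Re (ip (\<pi> (mat_exp (complex_of_real t \<cdot>\<^sub>m H)) *\<^sub>v x) (\<pi> (mat_exp (complex_of_real t \<cdot>\<^sub>m H)) *\<^sub>v x))" for t :: real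
    have "((\<lambda>t. ip (\<pi> (mat_exp (complex_of_real t \<cdot>\<^sub>m H)) *\<^sub>v x) (\<pi> (mat_exp (complex_of_real t \<cdot>\<^sub>m H)) *\<^sub>v x))
       has_vector_derivative S) (at 0)"
      unfolding S_def using ce group_curve_exp[OF H] by blast
    from bounded_linear.has_vector_derivative[OF bounded_linear_Re this]
    have dF: "(F has_real_derivative Re S) (at 0)"
      unfolding F_def[abs_def] by (simp add: has_real_derivative_iff_has_vector_derivative)
    have F0: "F 0 = f" unfolding F_def mat_exp_zero[OF H] f_def using x by simp
    have "((\<lambda>t. ln (sqrt (F t))) has_real_derivative Re S / (2 * f)) (at 0)"
    proof -
      have "((\<lambda>t. sqrt (F t)) has_real_derivative Re S * (inverse (sqrt f) / 2)) (at 0)"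
        using DERIV_chain2[OF DERIV_real_sqrt dF] f F0 by (simp add: mult.commute)
      then have "((\<lambda>t. ln (sqrt (F t))) has_real_derivative 1 / sqrt (F 0) * (Re S * (inverse (sqrt f) / 2))) (at 0)"
        by (rule DERIV_chain2[OF DERIV_ln_divide, rotated]) (use f F0 in simp)
      moreover have "1 / sqrt (F 0) * (Re S * (inverse (sqrt f) / 2)) = Re S / (2 * f)"
        using f unfolding F0 by (simp add: field_simps)
      ultimately show ?thesis by simp
    qed
    moreover have "Re S / (2 * f) = Re (mat_trace (M * H))"
    proof -
      define Z where "Z = (\<Sum>i<n. \<Sum>j<n. K i j * H $$ (i, j))"
      have "S = (\<Sum>i<n. \<Sum>j<n. c i j * H $$ (i, j)) + (\<Sum>i<n. \<Sum>j<n. e i j * H $$ (j, i))"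
        unfolding S_def by (simp add: sum.distrib hermitian_index[OF H])
      also have "(\<Sum>i<n. \<Sum>j<n. e i j * H $$ (j, i)) = (\<Sum>i<n. \<Sum>j<n. e j i * H $$ (i, j))"
        by (rule sum.swap)
      finally have S: "S / complex_of_real (2 * f) = Z"
        unfolding Z_def K_def by (simp add: add_divide_distrib distrib_right sum.distrib sum_divide_distrib del: of_real_mult)
      have "mat_trace (M * H) = (\<Sum>i<n. \<Sum>j<n. (K j i + cnj (K i j)) / 2 * H $$ (j, i))"
        using Hc by (subst mat_trace_mult) (auto simp: M_def)
      also have "\<dots> = ((\<Sum>i<n. \<Sum>j<n. K j i * H $$ (j, i)) + (\<Sum>i<n. \<Sum>j<n. cnj (K i j) * H $$ (j, i))) / 2"
        by (simp add: add_divide_distrib distrib_right sum.distrib sum_divide_distrib)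
      also have "(\<Sum>i<n. \<Sum>j<n. K j i * H $$ (j, i)) = Z"
        unfolding Z_def by (rule sum.swap)
      also have "(\<Sum>i<n. \<Sum>j<n. cnj (K i j) * H $$ (j, i)) = cnj Z"
        by (simp add: Z_def hermitian_index[OF H])
      finally have "Re (mat_trace (M * H)) = Re ((Z + cnj Z) / 2)" by (rule arg_cong)
      also have "\<dots> = Re (S / complex_of_real (2 * f))" unfolding S by simp
      finally have "Re (mat_trace (M * H)) = Re (S / complex_of_real (2 * f))" .
      then show ?thesis by (simp only: Re_divide_of_real)
    qed
    ultimately show ?thesis unfolding ip_norm_def F_def by simp
  qed
  then show ?thesis using M unfolding is_moment_def by blast
qed

text \<open>
  Testing against the difference of two candidates gives its squared Frobenius norm.
\<close>
lemma is_moment_unique: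
  assumes "is_moment x M" "is_moment x M'"
  shows "M = M'"
proof -
  have h: "M \<in> hermitian_mats n" "M' \<in> hermitian_mats n" using assms unfolding is_moment_def by auto
  then have c: "M \<in> carrier_mat n n" "M' \<in> carrier_mat n n" unfolding hermitian_mats_def by auto
  define D where "D = Matrix.mat n n (\<lambda>(i, j). M $$ (i, j) - M' $$ (i, j))"
  have Dc: "D \<in> carrier_mat n n" unfolding D_def by auto
  have D: "D \<in> hermitian_mats n"
    unfolding hermitian_mats_def D_def by (auto intro!: eq_matI simp: hermitian_index[OF h(1)] hermitian_index[OF h(2)])
  have "Re (mat_trace (M * D)) = Re (mat_trace (M' * D))"
    using assms D unfolding is_moment_def by (blast intro: DERIV_unique)
  moreover have "mat_trace (D * D) = mat_trace (M * D) - mat_trace (M' * D)"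
    unfolding mat_trace_mult[OF c(1) Dc] mat_trace_mult[OF c(2) Dc] mat_trace_mult[OF Dc Dc]
    by (simp add: D_def left_diff_distrib sum_subtractf)
  ultimately have "Re (mat_trace (D * D)) = 0" by simp
  then have "(frobenius_norm D)\<^sup>2 = 0" unfolding frobenius_norm_hermitian[OF D] by (simp del: of_real_power)
  then have "(\<Sum>i<n. \<Sum>j<n. (cmod (D $$ (i, j)))\<^sup>2) = 0"
    unfolding frobenius_norm_def using Dc by (simp add: sum_nonneg)
  then have "\<forall>i<n. \<forall>j<n. D $$ (i, j) = 0"
    by (simp add: sum_nonneg_eq_0_iff sum_nonneg)
  then show ?thesis using c unfolding D_def by (intro eq_matI) auto
qed

lemma is_moment_moment_map:
  assumes "x \<in> carrier_vec d" "x \<noteq> 0\<^sub>v d"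
  shows "is_moment x (moment_map n \<pi> ip x)"
proof -
  have "moment_map n \<pi> ip x = (THE M. is_moment x M)"
    unfolding moment_map_def is_moment_def ..
  then show ?thesis using is_moment_exists[OF assms] is_moment_unique by (metis theI)
qed

end

section \<open>Descent\<close>

text \<open>
  Any coefficient of the quadratic term below \<open>1\<close> would make a descent step decrease
  the norm; the usual bound with coefficient \<open>1\<close> just fails.
\<close>
lemma exp_le_quadratic:
  fixes x :: real
  assumes "\<bar>x\<bar> \<le> 1"
  shows "exp x \<le> 1 + x + 7 / 8 * x\<^sup>2"
proof -
  obtain t where t: "\<bar>t\<bar> \<le> \<bar>x\<bar>" "exp x = (\<Sum>m<4. x ^ m / fact m) + exp t / fact 4 * x ^ 4"
    using Maclaurin_exp_le[of x 4] by auto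
  have s: "(\<Sum>m<4. x ^ m / fact m) = 1 + x + x\<^sup>2 / 2 + x ^ 3 / 6"
    by (simp add: eval_nat_numeral fact_numeral)
  have x2: "x\<^sup>2 \<le> 1" "x\<^sup>2 \<ge> 0" using assms by (auto simp: abs_square_le_1)
  have "exp t \<le> exp 1" using t(1) assms by simp
  then have "exp t \<le> 3" using exp_le by linarith
  then have "exp t / fact 4 \<le> 3 / 24" by (simp add: fact_numeral)
  moreover have "x ^ 4 = x\<^sup>2 * x\<^sup>2" by (simp add: eval_nat_numeral)
  moreover have "x\<^sup>2 * x\<^sup>2 \<le> x\<^sup>2 * 1" using x2 by (intro mult_left_mono) auto
  ultimately have 4: "exp t / fact 4 * x ^ 4 \<le> 3 / 24 * x\<^sup>2"
    using x2 by (intro order_trans[OF mult_mono[of _ "3 / 24" "x ^ 4" "x\<^sup>2"]]) auto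
  have "x ^ 3 = x * x\<^sup>2" by (simp add: eval_nat_numeral)
  also have "\<dots> \<le> 1 * x\<^sup>2" using x2 assms by (intro mult_right_mono) auto
  finally show ?thesis using t(2) s 4 x2(2) by linarith
qed

context unitary_rep
begin

lemma moment_map_hermitian:
  "x \<in> carrier_vec d \<Longrightarrow> x \<noteq> 0\<^sub>v d \<Longrightarrow> moment_map n \<pi> ip x \<in> hermitian_mats n"
  using is_moment_moment_map unfolding is_moment_def by blast

lemma weight_norm_nonneg:
  fixes x :: "complex Matrix.vec"
  assumes "x \<in> carrier_vec d" "x \<noteq> 0\<^sub>v d"
  shows "weight_norm n d \<pi> \<ge> 0"
proof -
  obtain l where "l \<in> weights" using weights_nonempty[OF assms] by blast
  then have "sqrt (\<Sum>i<n. (real_of_int (l i))\<^sup>2) \<le> weight_norm n d \<pi>" by (rule weight_norm_bounds_weights)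
  moreover have "sqrt (\<Sum>i<n. (real_of_int (l i))\<^sup>2) \<ge> 0" by (intro real_sqrt_ge_zero sum_nonneg) auto
  ultimately show ?thesis by linarith
qed

text \<open>
  The expansion in the direction of the moment map itself: the mean of \<open>a\<close> with respect
  to \<open>q\<close> is the derivative of the logarithm of the norm, which is the squared Frobenius
  norm.
\<close>
lemma moment_map_expansion:
  assumes x: "x \<in> carrier_vec d" "x \<noteq> 0\<^sub>v d"
  defines "M \<equiv> moment_map n \<pi> ip x"
  defines "r \<equiv> weight_norm n d \<pi> * frobenius_norm M"
  obtains q a :: "(nat \<Rightarrow> int) \<Rightarrow> real" where "\<forall>l\<in>weights. q l \<ge> 0" "\<forall>l\<in>weights. \<bar>a l\<bar> \<le> r"
    "(\<Sum>l\<in>weights. q l) = Re (ip x x)"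
    "\<forall>s. Re (ip (\<pi> (mat_exp (complex_of_real s \<cdot>\<^sub>m M)) *\<^sub>v x) (\<pi> (mat_exp (complex_of_real s \<cdot>\<^sub>m M)) *\<^sub>v x))
       = (\<Sum>l\<in>weights. q l * exp (2 * s * a l))"
    "(\<Sum>l\<in>weights. q l * a l) = (frobenius_norm M)\<^sup>2 * Re (ip x x)"
proof -
  have mom: "is_moment x M" unfolding M_def by (rule is_moment_moment_map[OF x])
  then have M: "M \<in> hermitian_mats n" unfolding is_moment_def by blast
  obtain q a :: "(nat \<Rightarrow> int) \<Rightarrow> real" where q: "\<forall>l\<in>weights. q l \<ge> 0" and a: "\<forall>l\<in>weights. \<bar>a l\<bar> \<le> r"
    and F: "\<forall>s. Re (ip (\<pi> (mat_exp (complex_of_real s \<cdot>\<^sub>m M)) *\<^sub>v x) (\<pi> (mat_exp (complex_of_real s \<cdot>\<^sub>m M)) *\<^sub>v x))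
       = (\<Sum>l\<in>weights. q l * exp (2 * s * a l))"
    unfolding r_def using M x(1) by (rule exp_norm_expansion)
  define f where "f = Re (ip x x)"
  have f: "f > 0" unfolding f_def using ip_pos x by auto
  define G where "G s = (\<Sum>l\<in>weights. q l * exp (2 * s * a l))" for s
  have G0: "G 0 = f" using F[rule_format, of 0] mat_exp_zero[OF M] x unfolding G_def f_def by simp
  have sum: "(\<Sum>l\<in>weights. q l) = f" using G0 unfolding G_def by simp
  have dG: "(G has_real_derivative 2 * (\<Sum>l\<in>weights. q l * a l)) (at 0)"
  proof -
    have "(G has_real_derivative (\<Sum>l\<in>weights. q l * (2 * a l))) (at 0)"
      unfolding G_def[abs_def] by (auto intro!: derivative_eq_intros sum.cong)
    then show ?thesis by (simp add: sum_distrib_left mult_ac)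
  qed
  have "((\<lambda>s. ln (sqrt (G s))) has_real_derivative 1 / sqrt (G 0) * (2 * (\<Sum>l\<in>weights. q l * a l) * (inverse (sqrt f) / 2))) (at 0)"
  proof (rule DERIV_chain2[OF DERIV_ln_divide, rotated])
    show "((\<lambda>s. sqrt (G s)) has_real_derivative 2 * (\<Sum>l\<in>weights. q l * a l) * (inverse (sqrt f) / 2)) (at 0)"
      using DERIV_chain2[OF DERIV_real_sqrt dG] f G0 by (simp add: mult.commute)
  qed (use f G0 in simp)
  moreover have "(\<lambda>s. ln (sqrt (G s))) = (\<lambda>s. ln (ip_norm ip (\<pi> (mat_exp (complex_of_real s \<cdot>\<^sub>m M)) *\<^sub>v x)))"
    unfolding ip_norm_def using F G_def by auto
  moreover have "((\<lambda>s. ln (ip_norm ip (\<pi> (mat_exp (complex_of_real s \<cdot>\<^sub>m M)) *\<^sub>v x)))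
     has_real_derivative Re (mat_trace (M * M))) (at 0)"
    using mom M unfolding is_moment_def by blast
  ultimately have "1 / sqrt (G 0) * (2 * (\<Sum>l\<in>weights. q l * a l) * (inverse (sqrt f) / 2)) = Re (mat_trace (M * M))"
    by (metis DERIV_unique)
  then have "(\<Sum>l\<in>weights. q l * a l) / f = (frobenius_norm M)\<^sup>2"
    using f unfolding G0 frobenius_norm_hermitian[OF M] by (simp add: field_simps del: of_real_power)
  then have "(\<Sum>l\<in>weights. q l * a l) = (frobenius_norm M)\<^sup>2 * f" using f by (simp add: field_simps)
  then show ?thesis using that[of q a] q a F sum unfolding f_def by blast
qed

text \<open>
  The squared Frobenius norm is a weighted mean of numbers bounded by its root times the weight
  norm.
\<close>
lemma moment_map_le_weight_norm:
  assumes x: "x \<in> carrier_vec d" "x \<noteq> 0\<^sub>v d"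
  shows "frobenius_norm (moment_map n \<pi> ip x) \<le> weight_norm n d \<pi>"
proof -
  define m where "m = frobenius_norm (moment_map n \<pi> ip x)"
  define N where "N = weight_norm n d \<pi>"
  obtain q a :: "(nat \<Rightarrow> int) \<Rightarrow> real" where q: "\<forall>l\<in>weights. q l \<ge> 0" and a: "\<forall>l\<in>weights. \<bar>a l\<bar> \<le> N * m"
    and sq: "(\<Sum>l\<in>weights. q l) = Re (ip x x)"
    and "\<forall>s. Re (ip (\<pi> (mat_exp (complex_of_real s \<cdot>\<^sub>m moment_map n \<pi> ip x)) *\<^sub>v x)
        (\<pi> (mat_exp (complex_of_real s \<cdot>\<^sub>m moment_map n \<pi> ip x)) *\<^sub>v x))
       = (\<Sum>l\<in>weights. q l * exp (2 * s * a l))"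
    and sa: "(\<Sum>l\<in>weights. q l * a l) = m\<^sup>2 * Re (ip x x)"
    by (rule moment_map_expansion[OF x, folded m_def N_def])
  have "(\<Sum>l\<in>weights. q l * a l) \<le> (\<Sum>l\<in>weights. q l * (N * m))"
    using q a by (intro sum_mono mult_left_mono) auto
  also have "\<dots> = N * m * Re (ip x x)" by (simp add: sq flip: sum_distrib_right)
  finally have "m\<^sup>2 \<le> N * m" unfolding sa using ip_pos[OF x] by simp
  moreover have "m \<ge> 0" unfolding m_def by (rule frobenius_norm_nonneg)
  moreover have "N \<ge> 0" unfolding N_def using x by (rule weight_norm_nonneg)
  ultimately show ?thesis unfolding m_def[symmetric] N_def[symmetric]
    by (cases "m = 0") (auto simp: power2_eq_square)
qed

text \<open>
  With this step length the exponents \<open>2 s a l\<close> are at most \<open>1\<close> in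
  absolute value, because the moment map is bounded by the weight norm.  The linear terms contribute
  \<open>- m\<^sup>2 / N\<^sup>2\<close> to the relative change of the squared norm and the
  quadratic terms at most \<open>7 / 8\<close> of this amount with the opposite sign.
\<close>
lemma descent_step:
  assumes x: "x \<in> carrier_vec d" "x \<noteq> 0\<^sub>v d" and pos: "weight_norm n d \<pi> > 0"
  defines "M \<equiv> moment_map n \<pi> ip x" and "N \<equiv> weight_norm n d \<pi>"
  shows "ln (ip_norm ip (\<pi> (mat_exp (complex_of_real (- (1 / (2 * N\<^sup>2))) \<cdot>\<^sub>m M)) *\<^sub>v x))
       \<le> ln (ip_norm ip x) - (frobenius_norm M)\<^sup>2 / (16 * N\<^sup>2)"
proof -
  define m where "m = frobenius_norm M"
  define f where "f = Re (ip x x)"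
  define s where "s = - (1 / (2 * N\<^sup>2))"
  have N: "N > 0" unfolding N_def by (rule pos)
  have f: "f > 0" unfolding f_def using ip_pos x by auto
  have m: "m \<ge> 0" "m \<le> N"
    unfolding m_def M_def N_def using frobenius_norm_nonneg moment_map_le_weight_norm[OF x] by auto
  obtain q a :: "(nat \<Rightarrow> int) \<Rightarrow> real" where q: "\<forall>l\<in>weights. q l \<ge> 0" and a: "\<forall>l\<in>weights. \<bar>a l\<bar> \<le> N * m"
    and sq: "(\<Sum>l\<in>weights. q l) = f"
    and F: "\<forall>s. Re (ip (\<pi> (mat_exp (complex_of_real s \<cdot>\<^sub>m M)) *\<^sub>v x) (\<pi> (mat_exp (complex_of_real s \<cdot>\<^sub>m M)) *\<^sub>v x))
       = (\<Sum>l\<in>weights. q l * exp (2 * s * a l))"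
    and sa: "(\<Sum>l\<in>weights. q l * a l) = m\<^sup>2 * f"
    by (rule moment_map_expansion[OF x, folded M_def, folded m_def N_def f_def])
  have le: "exp (2 * s * a l) \<le> 1 + 2 * s * a l + 7 / 8 * (m\<^sup>2 / N\<^sup>2)" if l: "l \<in> weights" for l
  proof -
    have "\<bar>2 * s * a l\<bar> = \<bar>a l\<bar> / N\<^sup>2" unfolding s_def by (simp add: abs_mult)
    also have "\<dots> \<le> N * m / N\<^sup>2" using a l by (intro divide_right_mono) auto
    also have "\<dots> = m / N" using N by (simp add: power2_eq_square)
    finally have b: "\<bar>2 * s * a l\<bar> \<le> m / N" .
    moreover have "m / N \<le> 1" using m N by simp
    ultimately have "exp (2 * s * a l) \<le> 1 + 2 * s * a l + 7 / 8 * (2 * s * a l)\<^sup>2"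
      by (intro exp_le_quadratic) auto
    moreover have "\<bar>2 * s * a l\<bar>\<^sup>2 \<le> (m / N)\<^sup>2" using b by (intro power_mono) auto
    then have "(2 * s * a l)\<^sup>2 \<le> m\<^sup>2 / N\<^sup>2" by (simp add: power_divide)
    ultimately show ?thesis by simp
  qed
  define K where "K = 7 / 8 * (m\<^sup>2 / N\<^sup>2)"
  have "(\<Sum>l\<in>weights. q l * exp (2 * s * a l)) \<le> (\<Sum>l\<in>weights. q l * (1 + 2 * s * a l + K))"
    using q le unfolding K_def by (intro sum_mono mult_left_mono) auto
  also have "\<dots> = (1 + K) * (\<Sum>l\<in>weights. q l) + 2 * s * (\<Sum>l\<in>weights. q l * a l)"
    by (simp add: sum_distrib_left distrib_left distrib_right sum.distrib mult_ac)
  also have "\<dots> = f * (1 - m\<^sup>2 / (8 * N\<^sup>2))"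
    unfolding sq sa s_def K_def using N by (simp add: field_simps)
  finally have up: "(\<Sum>l\<in>weights. q l * exp (2 * s * a l)) \<le> f * (1 - m\<^sup>2 / (8 * N\<^sup>2))" .
  define y where "y = \<pi> (mat_exp (complex_of_real s \<cdot>\<^sub>m M)) *\<^sub>v x"
  have yf: "Re (ip y y) \<le> f * (1 - m\<^sup>2 / (8 * N\<^sup>2))" using up F unfolding y_def by simp
  have "\<exists>l\<in>weights. q l \<noteq> 0" using sq f by (metis less_irrefl sum.neutral)
  then obtain l where l: "l \<in> weights" "q l \<noteq> 0" by blast
  have "0 < (\<Sum>l\<in>weights. q l * exp (2 * s * a l))"
    using l q finite_weights by (intro sum_pos2[of _ l]) (auto simp: less_le)
  then have ypos: "Re (ip y y) > 0" using F unfolding y_def by simp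
  then have "f * (1 - m\<^sup>2 / (8 * N\<^sup>2)) > 0" using yf by linarith
  then have c: "1 - m\<^sup>2 / (8 * N\<^sup>2) > 0" using f by (simp add: zero_less_mult_iff)
  have "ln (Re (ip y y)) \<le> ln (f * (1 - m\<^sup>2 / (8 * N\<^sup>2)))" using yf ypos by simp
  also have "\<dots> = ln f + ln (1 - m\<^sup>2 / (8 * N\<^sup>2))" using f c by (rule ln_mult_pos)
  also have "ln (1 - m\<^sup>2 / (8 * N\<^sup>2)) \<le> - (m\<^sup>2 / (8 * N\<^sup>2))"
    using ln_le_minus_one[OF c] by simp
  finally have "ln (Re (ip y y)) \<le> ln f - m\<^sup>2 / (8 * N\<^sup>2)" by simp
  then have "ln (Re (ip y y)) / 2 \<le> ln f / 2 - m\<^sup>2 / (16 * N\<^sup>2)" by simp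
  then show ?thesis
    using ypos f unfolding ip_norm_def y_def[symmetric, unfolded s_def] m_def f_def by (simp add: ln_sqrt)
qed

lemma rep_vec_nonzero:
  assumes "g \<in> carrier (GL n)" "x \<in> carrier_vec d" "x \<noteq> 0\<^sub>v d"
  shows "\<pi> g *\<^sub>v x \<noteq> 0\<^sub>v d"
proof
  assume z: "\<pi> g *\<^sub>v x = 0\<^sub>v d"
  obtain h where h: "h \<in> carrier (GL n)" "h * g = 1\<^sub>m n" using GL_inverse[OF assms(1)] by metis
  have "x = \<pi> h *\<^sub>v (\<pi> g *\<^sub>v x)" using h assms by (simp flip: rep_mult_vec)
  also have "\<dots> = 0\<^sub>v d" unfolding z using h by (intro eq_vecI) (auto simp: scalar_prod_def)
  finally show False using assms(3) by simp
qed

lemma descent_iterate_GL: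
  assumes v: "v \<in> carrier_vec d" "v \<noteq> 0\<^sub>v d"
  shows "descent_iterate n \<pi> ip v \<eta> t \<in> carrier (GL n)"
proof (induction t)
  case (Suc t)
  define g where "g = descent_iterate n \<pi> ip v \<eta> t"
  have g: "g \<in> carrier (GL n)" using Suc unfolding g_def .
  have "\<pi> g *\<^sub>v v \<noteq> 0\<^sub>v d" using rep_vec_nonzero[OF g v] .
  then have "moment_map n \<pi> ip (\<pi> g *\<^sub>v v) \<in> hermitian_mats n"
    using g v by (intro moment_map_hermitian) auto
  then show ?case using g unfolding descent_iterate.simps Let_def g_def[symmetric]
    by (intro GL_mult_closed mat_exp_GL)
qed simp

lemma descent_progress:
  assumes v: "v \<in> carrier_vec d" "v \<noteq> 0\<^sub>v d" and pos: "weight_norm n d \<pi> > 0"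
  defines "N \<equiv> weight_norm n d \<pi>"
  defines "g \<equiv> descent_iterate n \<pi> ip v (1 / (2 * N\<^sup>2))"
  shows "ln (ip_norm ip (\<pi> (g T) *\<^sub>v v))
     \<le> ln (ip_norm ip v) - (\<Sum>t<T. (frobenius_norm (moment_map n \<pi> ip (\<pi> (g t) *\<^sub>v v)))\<^sup>2) / (16 * N\<^sup>2)"
proof (induction T)
  case 0
  then show ?case using v unfolding g_def by simp
next
  case (Suc T)
  define x where "x = \<pi> (g T) *\<^sub>v v"
  have gG: "g T \<in> carrier (GL n)" unfolding g_def by (rule descent_iterate_GL[OF v])
  have x: "x \<in> carrier_vec d" "x \<noteq> 0\<^sub>v d" unfolding x_def using gG v rep_vec_nonzero by auto
  define E where "E = mat_exp (complex_of_real (- (1 / (2 * N\<^sup>2))) \<cdot>\<^sub>m moment_map n \<pi> ip x)"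
  have E: "E \<in> carrier (GL n)" unfolding E_def by (intro mat_exp_GL moment_map_hermitian x)
  have "g (Suc T) = E * g T" unfolding g_def E_def x_def by (simp add: Let_def)
  then have "\<pi> (g (Suc T)) *\<^sub>v v = \<pi> E *\<^sub>v x" unfolding x_def using E gG v by (simp add: rep_mult_vec)
  then have "ln (ip_norm ip (\<pi> (g (Suc T)) *\<^sub>v v)) \<le> ln (ip_norm ip x) - (frobenius_norm (moment_map n \<pi> ip x))\<^sup>2 / (16 * N\<^sup>2)"
    using descent_step[OF x pos] unfolding E_def N_def by simp
  then show ?case using Suc unfolding x_def by (simp add: add_divide_distrib)
qed

lemma capacity_le:
  assumes "g \<in> carrier (GL n)" "v \<in> carrier_vec d"
  shows "capacity n \<pi> ip v \<le> ip_norm ip (\<pi> g *\<^sub>v v)"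
  unfolding capacity_def
proof (rule cINF_lower)
  show "bdd_below ((\<lambda>g. ip_norm ip (\<pi> g *\<^sub>v v)) ` carrier (GL n))"
    unfolding ip_norm_def using assms(2) ip_self_nonneg by (intro bdd_belowI[of _ 0]) auto
qed (rule assms(1))

text \<open>
  The smallest squared norm of the moment map is at most the mean over all iterates, which the sum
  of the decrements bounds.  If the weight norm is zero, then so is the moment map everywhere.
\<close>
theorem descent_outputs_small:
  assumes v: "v \<in> carrier_vec d" "ip_norm ip v = 1" and cap: "capacity n \<pi> ip v > 0" and \<epsilon>: "\<epsilon> > 0"
    and T: "T = max 1 (nat \<lceil>16 * ((weight_norm n d \<pi>)\<^sup>2 / \<epsilon>\<^sup>2) * \<bar>ln (capacity n \<pi> ip v)\<bar>\<rceil>)"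
    and g: "g \<in> descent_outputs n d \<pi> ip v T"
  shows "g \<in> carrier (GL n)" "frobenius_norm (moment_map n \<pi> ip (\<pi> g *\<^sub>v v)) \<le> \<epsilon>"
proof -
  define N where "N = weight_norm n d \<pi>"
  define h where "h = descent_iterate n \<pi> ip v (1 / (2 * N\<^sup>2))"
  define \<phi> where "\<phi> g = frobenius_norm (moment_map n \<pi> ip (\<pi> g *\<^sub>v v))" for g
  have v0: "v \<noteq> 0\<^sub>v d" using v unfolding ip_norm_def by auto
  have hG: "h t \<in> carrier (GL n)" for t unfolding h_def by (rule descent_iterate_GL[OF v(1) v0])
  have gmin: "is_arg_min \<phi> (\<lambda>g. g \<in> h ` {..<T}) g"
    using g unfolding descent_outputs_def Let_def \<phi>_def[abs_def] h_def N_def by simp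
  then have gh: "g \<in> h ` {..<T}" and min: "\<And>t. t < T \<Longrightarrow> \<phi> g \<le> \<phi> (h t)"
    unfolding is_arg_min_def by (auto simp: not_less)
  show gG: "g \<in> carrier (GL n)" using gh hG by auto
  have \<phi>N: "\<phi> g \<le> N" and \<phi>0: "\<phi> g \<ge> 0"
    unfolding \<phi>_def N_def using moment_map_le_weight_norm rep_vec_nonzero[OF gG v(1) v0] gG v(1) frobenius_norm_nonneg
    by auto
  show "\<phi> g \<le> \<epsilon>" unfolding \<phi>_def[symmetric]
  proof (cases "N > 0")
    case False
    then show ?thesis using \<phi>N \<epsilon> by simp
  next
    case True
    define c where "c = \<bar>ln (capacity n \<pi> ip v)\<bar>"
    have "capacity n \<pi> ip v \<le> 1" using capacity_le[OF GL_one_closed v(1)] v by simp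
    then have c: "c = - ln (capacity n \<pi> ip v)" unfolding c_def using cap by simp
    have "ln (capacity n \<pi> ip v) \<le> ln (ip_norm ip (\<pi> (h T) *\<^sub>v v))"
      using capacity_le[OF hG v(1), of T] cap by simp
    also have "\<dots> \<le> ln (ip_norm ip v) - (\<Sum>t<T. (\<phi> (h t))\<^sup>2) / (16 * N\<^sup>2)"
      unfolding h_def \<phi>_def N_def using True unfolding N_def by (rule descent_progress[OF v(1) v0])
    finally have "(\<Sum>t<T. (\<phi> (h t))\<^sup>2) / (16 * N\<^sup>2) \<le> c" unfolding c using v(2) by simp
    then have S: "(\<Sum>t<T. (\<phi> (h t))\<^sup>2) \<le> 16 * N\<^sup>2 * c" using True by (simp add: field_simps)
    have "real T * (\<phi> g)\<^sup>2 = (\<Sum>t<T. (\<phi> g)\<^sup>2)" by simp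
    also have "\<dots> \<le> (\<Sum>t<T. (\<phi> (h t))\<^sup>2)" using min \<phi>0 by (intro sum_mono power_mono) auto
    also note S
    also have "16 * N\<^sup>2 * c \<le> real T * \<epsilon>\<^sup>2"
    proof -
      have "16 * (N\<^sup>2 / \<epsilon>\<^sup>2) * c \<le> real (nat \<lceil>16 * (N\<^sup>2 / \<epsilon>\<^sup>2) * c\<rceil>)" by (rule real_nat_ceiling_ge)
      also have "\<dots> \<le> real T" unfolding T N_def c_def by simp
      finally show ?thesis using \<epsilon> by (simp add: field_simps)
    qed
    finally have "(\<phi> g)\<^sup>2 \<le> \<epsilon>\<^sup>2" using T by (simp add: mult_le_cancel_left)
    then show ?thesis using \<epsilon> by (simp add: power2_le_iff_abs_le)
  qed
qed

lemma descent_outputs_nonempty: "T \<ge> 1 \<Longrightarrow> descent_outputs n d \<pi> ip v T \<noteq> {}"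
  unfolding descent_outputs_def Let_def
  using ex_is_arg_min_if_finite[of "descent_iterate n \<pi> ip v (1 / (2 * (weight_norm n d \<pi>)\<^sup>2)) ` {..<T}"]
  by (auto simp: lessThan_empty_iff)

end

theorem theorem1p20:
  shows "\<exists>C::real. C > 0 \<and>
    (\<forall>(n::nat) (d::nat) (\<pi> :: complex mat \<Rightarrow> complex mat)
       (ip :: complex Matrix.vec \<Rightarrow> complex Matrix.vec \<Rightarrow> complex)
       (v :: complex Matrix.vec) (\<epsilon> :: real) (T :: nat).
       n \<ge> 1 \<and>
       rational_representation n d \<pi> \<and>
       hermitian_inner_product d ip \<and>
       unitary_invariant n d \<pi> ip \<and>
       v \<in> carrier_vec d \<and> ip_norm ip v = 1 \<and>
       capacity n \<pi> ip v > 0 \<and>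
       \<epsilon> > 0 \<and>
       T = max 1 (nat \<lceil>C * ((weight_norm n d \<pi>)\<^sup>2 / \<epsilon>\<^sup>2) * \<bar>ln (capacity n \<pi> ip v)\<bar>\<rceil>)
       \<longrightarrow>
       descent_outputs n d \<pi> ip v T \<noteq> {} \<and>
       (\<forall>g \<in> descent_outputs n d \<pi> ip v T.
          g \<in> carrier (GL n) \<and> frobenius_norm (moment_map n \<pi> ip (\<pi> g *\<^sub>v v)) \<le> \<epsilon>))"
proof (intro exI[of _ 16] conjI allI impI; (elim conjE)?)
  fix n d :: nat and \<pi> ip v and \<epsilon> :: real and T :: nat
  assume rep: "rational_representation n d \<pi>" "hermitian_inner_product d ip" "unitary_invariant n d \<pi> ip"
    and v: "v \<in> carrier_vec d" "ip_norm ip v = 1" "capacity n \<pi> ip v > 0" "\<epsilon> > 0"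
    and T: "T = max 1 (nat \<lceil>16 * ((weight_norm n d \<pi>)\<^sup>2 / \<epsilon>\<^sup>2) * \<bar>ln (capacity n \<pi> ip v)\<bar>\<rceil>)"
  interpret unitary_rep d ip n \<pi> by unfold_locales (use rep in auto)
  show "descent_outputs n d \<pi> ip v T \<noteq> {}" by (rule descent_outputs_nonempty) (simp add: T)
  show "\<forall>g\<in>descent_outputs n d \<pi> ip v T. g \<in> carrier (GL n) \<and> frobenius_norm (moment_map n \<pi> ip (\<pi> g *\<^sub>v v)) \<le> \<epsilon>"
    using descent_outputs_small[OF v T] by blast
qed simp

end
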